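(* Let $\theta:\mathcal P\to B$ be the unital $^*$-homomorphism from the underlying $^*$-algebra $\mathcal P$ of Woronowicz's quantum group $SU_\nu(2)$, with $\nu=\lambda^{-1}$, to the dual $B$ of $(A,\Delta_A)$ given by $\theta(\alpha)=u_{11}$ and $\theta(\gamma)=u_{21}$. Then $\theta$ is surjective.
   Context: Let $t>0$ be real and $\lambda=\exp(t)$. $\mathfrak A_t$ is the unital complex $^*$-algebra generated by $e,f,q$ with $q$ invertible, subject to $qe=\lambda eq$, $qf=\lambda^{-1}fq$, $ef-fe=(\lambda-\lambda^{-1})^{-1}(q^2-q^{-2})$, with $e^*=f$, $q^*=q$; it is a Hopf $^*$-algebra with $\Delta(q)=q\otimes q$, $\Delta(e)=q\otimes e+e\otimes q^{-1}$, $\Delta(f)=q\otimes f+f\otimes q^{-1}$, $S(q)=q^{-1}$, $S(e)=-\lambda^{-1}e$, $S(f)=-\lambda f$. Let $I=\{0,\frac12,1,\dots\}$. For $n\in I$ let $\mathcal H_n$ be the Hilbert space with orthonormal basis $\xi(n,j)$, $j=-n,\dots,n$, and $\pi_n$ the irreducible $^*$-representation given by $\pi_n(q)\xi(n,j)=\lambda^j\xi(n,j)$, $\pi_n(e)\xi(n,j)=r_j\xi(n,j+1)$ ($j\neq n$), $\pi_n(e)\xi(n,n)=0$, $\pi_n(f)\xi(n,j)=r_{j-1}\xi(n,j-1)$ ($j\neq-n$), $\pi_n(f)\xi(n,-n)=0$, with $r_j>0$ for $-n\le j\le n-1$ determined by $r_n=0$ and $r_{j-1}^2-r_j^2=(\lambda-\lambda^{-1})^{-1}(\lambda^{2j}-\lambda^{-2j})$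 for $-n<j\le n$. $A_n$ is the $^*$-algebra of all linear operators on $\mathcal H_n$, $A=\bigoplus_{n\in I}A_n$ (algebraic direct sum), $M(A\otimes A)=\prod_{n,m}A_n\otimes A_m$. With $I_{nm}=\{|n-m|,\dots,n+m\}$, the coproduct $\Delta_A:A\to M(A\otimes A)$ is determined by: $\Delta_A(a)_{nm}=(\pi_n\otimes\pi_m)\Delta(x)$ if $a=(\pi_k(x))_{k\in I_{nm}}\in\bigoplus_{k\in I_{nm}}A_k$ with $x\in\mathfrak A_t$ (every element of this finite direct sum has this form, and the result does not depend on $x$), and $\Delta_A(a)_{nm}=0$ if $a\in A_k$, $k\notin I_{nm}$. $(A,\Delta_A)$ is a discrete quantum group; its antipode $S$ satisfies $S(\pi_n(x))=\pi_n(S(x))$, and its counit is $0$ on $A_k$ for $k\neq0$ and the identification $A_0\cong\mathbb C$ on $A_0$. $B=\widehat A$ is the dual of $(A,\Delta_A)$: the space of linear functionals on $A$ of the form $\varphi_A(\,\cdot\,a)$, $a\in A$, with $\varphi_A$ the left integral on $A$; as a vector space it is the direct sum $\bigoplus_k A_k'$, i.e. the functionals on $A$ vanishing on all but finitely many $A_k$. Write $\langle a,b\rangle=b(a)$. $B$ is a unital Hopf $^*$-algebra with $\langle a,bb'\rangle=\langle\Delta_A(a),b'\otimes b\rangle$, $\langle a\otimes a',\Delta(b)\rangle=\langle aa',b\rangle$, $\langle a,S(b)\rangle=\langle S^{-1}(a),b\rangle$, $\langle a,b^*\rangle=\overline{\langle S(a^* ),b\rangle}$; its unit is the counit of $A$.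 The elements $u_{ij}\in B$ ($i,j\in\{1,2\}$) are defined by $\langle a,u_{ij}\rangle=a_{ij}$ for $a\in A_{\frac12}$, where $(a_{ij})$ is the matrix of $a$ with respect to the basis $(\xi(\frac12,\frac12),\xi(\frac12,-\frac12))$, and $\langle a,u_{ij}\rangle=0$ for $a$ in any other component $A_k$. $\mathcal P$ is the unital $^*$-algebra generated by $\alpha,\gamma$ subject to the relations expressing that $\begin{pmatrix}\alpha&-\nu\gamma^*\\ \gamma&\alpha^*\end{pmatrix}$ is unitary: $\alpha^*\alpha+\gamma^*\gamma=1$, $\alpha\alpha^*+\nu^2\gamma\gamma^*=1$, $\gamma\gamma^*=\gamma^*\gamma$, $\alpha\gamma=\nu\gamma\alpha$, $\alpha\gamma^*=\nu\gamma^*\alpha$. The $^*$-homomorphism $\theta$ is known to exist. *)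

theory Defs
  imports
    Complex_Main
    "HOL-Library.Poly_Mapping"
    "HOL-Library.Product_Plus"
    "HOL-Library.FuncSet"
    "HOL-Algebra.QuotRing"
    "HOL-Algebra.Module"
    "Jordan_Normal_Form.Schur_Decomposition"
begin

record 'a star_algebra = "(complex, 'a) module" +
  adj :: "'a \<Rightarrow> 'a"

definition star_alg_hom :: "('a, 'm) star_algebra_scheme \<Rightarrow> ('b, 'n) star_algebra_scheme \<Rightarrow> ('a \<Rightarrow> 'b) \<Rightarrow> bool"
  where "star_alg_hom R T h \<longleftrightarrow>
    h \<in> Ring.ring_hom R T \<and>
    (\<forall>c. \<forall>x\<in>carrier R. h (module.smult R c x) = module.smult T c (h x)) \<and>
    (\<forall>x\<in>carrier R. h (adj R x) = adj T (h x))"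

text \<open>
  Words form the free monoid, and pairs of words a monoid under the componentwise operation
  (theory Product_Plus). Hence \<open>'g list \<Rightarrow>\<^sub>0 complex\<close> with the convolution product is the free
  unital algebra on the letters \<open>'g\<close>, and \<open>('g list \<times> 'g list) \<Rightarrow>\<^sub>0 complex\<close> is its tensor square.
\<close>

instantiation list :: (type) monoid_add
begin

definition zero_list :: "'a list" where "zero_list = []"

definition plus_list :: "'a list \<Rightarrow> 'a list \<Rightarrow> 'a list" where "plus_list = (@)"

instance
  by standard (simp_all add: zero_list_def plus_list_def)

end

text \<open>
  The monoid algebra of \<open>'w\<close>, with the conjugate-linear extension of \<open>s\<close> as involution;
  \<open>s\<close> is meant to be an involutive anti-automorphism of the monoid.
\<close>

definition monoid_alg :: "('w::monoid_add \<Rightarrow> 'w) \<Rightarrow> ('w \<Rightarrow>\<^sub>0 complex) star_algebra"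
  where "monoid_alg s = \<lparr>
    carrier = UNIV, monoid.mult = (*), one = 1, zero = 0, add = (+),
    module.smult = (\<lambda>c x. Poly_Mapping.single 0 c * x),
    adj = (\<lambda>x. \<Sum>w\<in>Poly_Mapping.keys x. Poly_Mapping.single (s w) (cnj (Poly_Mapping.lookup x w)))\<rparr>"

lemma ring_monoid_alg: "ring (monoid_alg s)"
proof (rule ringI)
  show "abelian_group (monoid_alg s)"
    by (rule abelian_groupI)
      (auto simp: monoid_alg_def algebra_simps intro: exI[of _ "- x" for x] left_minus)
  show "monoid (monoid_alg s)"
    by (rule monoidI) (auto simp: monoid_alg_def mult.assoc)
qed (auto simp: monoid_alg_def algebra_simps)

definition word_inv :: "('g \<Rightarrow> 'g) \<Rightarrow> 'g list \<Rightarrow> 'g list"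
  where "word_inv s w = map s (rev w)"

definition quot_alg :: "('a, 'm) star_algebra_scheme \<Rightarrow> 'a set \<Rightarrow> 'a set star_algebra"
  where "quot_alg R J = \<lparr>
    carrier = carrier (R Quot J), monoid.mult = monoid.mult (R Quot J), one = one (R Quot J),
    zero = zero (R Quot J), add = add (R Quot J),
    module.smult = (\<lambda>c X. \<Union>x\<in>X. J +>\<^bsub>R\<^esub> module.smult R c x),
    adj = (\<lambda>X. \<Union>x\<in>X. J +>\<^bsub>R\<^esub> adj R x)\<rparr>"

text \<open>
  The unital star-algebra with generating letters \<open>'g\<close>, whose adjoints are given by the involution
  \<open>s\<close> of the letters, subject to the relations \<open>x = 0\<close> for \<open>x \<in> R\<close> (and their adjoints).
  A two-sided ring ideal of the free algebra is automatically a complex subspace.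
\<close>

definition free_alg :: "('g \<Rightarrow> 'g) \<Rightarrow> ('g list \<Rightarrow>\<^sub>0 complex) star_algebra"
  where "free_alg s = monoid_alg (word_inv s)"

definition rel_ideal :: "('g \<Rightarrow> 'g) \<Rightarrow> ('g list \<Rightarrow>\<^sub>0 complex) set \<Rightarrow> ('g list \<Rightarrow>\<^sub>0 complex) set"
  where "rel_ideal s R = Idl\<^bsub>free_alg s\<^esub> (R \<union> adj (free_alg s) ` R)"

definition presented_alg :: "('g \<Rightarrow> 'g) \<Rightarrow> ('g list \<Rightarrow>\<^sub>0 complex) set \<Rightarrow> ('g list \<Rightarrow>\<^sub>0 complex) set star_algebra"
  where "presented_alg s R = quot_alg (free_alg s) (rel_ideal s R)"

definition letter :: "'g \<Rightarrow> 'g list \<Rightarrow>\<^sub>0 complex"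
  where "letter g = Poly_Mapping.single [g] 1"

definition scalar :: "complex \<Rightarrow> ('w::monoid_add \<Rightarrow>\<^sub>0 complex)"
  where "scalar c = Poly_Mapping.single 0 c"

definition free_tensor :: "('g list \<Rightarrow>\<^sub>0 complex) \<Rightarrow> ('g list \<Rightarrow>\<^sub>0 complex) \<Rightarrow> ('g list \<times> 'g list \<Rightarrow>\<^sub>0 complex)"
  where "free_tensor x y = (\<Sum>u\<in>Poly_Mapping.keys x. \<Sum>v\<in>Poly_Mapping.keys y.
    Poly_Mapping.single (u, v) (Poly_Mapping.lookup x u * Poly_Mapping.lookup y v))"

text \<open>With \<open>F\<close> the free algebra, \<open>F/J \<otimes> F/J\<close> is \<open>(F \<otimes> F)/(J \<otimes> F + F \<otimes> J)\<close>.\<close>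

definition tensor_ideal :: "('g \<Rightarrow> 'g) \<Rightarrow> ('g list \<Rightarrow>\<^sub>0 complex) set \<Rightarrow> ('g list \<times> 'g list \<Rightarrow>\<^sub>0 complex) set"
  where "tensor_ideal s R = Idl\<^bsub>monoid_alg (map_prod (word_inv s) (word_inv s))\<^esub>
    ((\<lambda>x. free_tensor x 1) ` rel_ideal s R \<union> free_tensor 1 ` rel_ideal s R)"

definition tensor_square_alg :: "('g \<Rightarrow> 'g) \<Rightarrow> ('g list \<Rightarrow>\<^sub>0 complex) set \<Rightarrow> ('g list \<times> 'g list \<Rightarrow>\<^sub>0 complex) set star_algebra"
  where "tensor_square_alg s R =
    quot_alg (monoid_alg (map_prod (word_inv s) (word_inv s))) (tensor_ideal s R)"

definition free_eval :: "('b, 'm) star_algebra_scheme \<Rightarrow> ('g \<Rightarrow> 'b) \<Rightarrow> ('g list \<Rightarrow>\<^sub>0 complex) \<Rightarrow> 'b"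
  where "free_eval T v x = finsum T
    (\<lambda>w. module.smult T (Poly_Mapping.lookup x w) (foldr (\<lambda>g y. v g \<otimes>\<^bsub>T\<^esub> y) w \<one>\<^bsub>T\<^esub>))
    (Poly_Mapping.keys x)"

text \<open>
  The homomorphism from a presented algebra to \<open>T\<close> sending each generator \<open>g\<close> to \<open>v g\<close>,
  provided the elements \<open>v g\<close> satisfy the relations: then \<open>free_eval T v\<close> is constant on each
  coset \<open>X\<close>.
\<close>

definition presented_hom :: "('b, 'm) star_algebra_scheme \<Rightarrow> ('g \<Rightarrow> 'b) \<Rightarrow> ('g list \<Rightarrow>\<^sub>0 complex) set \<Rightarrow> 'b"
  where "presented_hom T v X = the_elem (free_eval T v ` X)"

definition lam :: "real \<Rightarrow> real" where "lam t = exp t"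

text \<open>
  The algebra \<open>\<AA>\<^sub>t\<close>. Since \<open>e\<^sup>* = f\<close> and \<open>q\<^sup>* = q\<close>, the adjoints of the
  generators need no letters of their own. The coproduct and antipode of the letter \<open>Gen_qi\<close> are
  forced by those of \<open>q\<close>.
\<close>

datatype ugen = Gen_e | Gen_f | Gen_q | Gen_qi  \<comment> \<open>\<open>Gen_qi\<close> is the inverse of \<open>q\<close>\<close>

fun ugen_star :: "ugen \<Rightarrow> ugen" where
  "ugen_star Gen_e = Gen_f"
| "ugen_star Gen_f = Gen_e"
| "ugen_star Gen_q = Gen_q"
| "ugen_star Gen_qi = Gen_qi"

definition urels :: "real \<Rightarrow> (ugen list \<Rightarrow>\<^sub>0 complex) set" where
  "urels t = (let e = letter Gen_e; f = letter Gen_f; q = letter Gen_q; qi = letter Gen_qi;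
      l = complex_of_real (lam t) in
    {q * qi - 1,
     qi * q - 1,
     q * e - scalar l * e * q,
     q * f - scalar (inverse l) * f * q,
     e * f - f * e - scalar (inverse (l - inverse l)) * (q * q - qi * qi)})"

definition Ualg :: "real \<Rightarrow> (ugen list \<Rightarrow>\<^sub>0 complex) set star_algebra"
  where "Ualg t = presented_alg ugen_star (urels t)"

definition Ualg2 :: "real \<Rightarrow> (ugen list \<times> ugen list \<Rightarrow>\<^sub>0 complex) set star_algebra"
  where "Ualg2 t = tensor_square_alg ugen_star (urels t)"

fun ucoprod_gen :: "ugen \<Rightarrow> (ugen list \<times> ugen list \<Rightarrow>\<^sub>0 complex)" where
  "ucoprod_gen Gen_e = free_tensor (letter Gen_q) (letter Gen_e) + free_tensor (letter Gen_e) (letter Gen_qi)"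
| "ucoprod_gen Gen_f = free_tensor (letter Gen_q) (letter Gen_f) + free_tensor (letter Gen_f) (letter Gen_qi)"
| "ucoprod_gen Gen_q = free_tensor (letter Gen_q) (letter Gen_q)"
| "ucoprod_gen Gen_qi = free_tensor (letter Gen_qi) (letter Gen_qi)"

definition Ucoprod :: "real \<Rightarrow> (ugen list \<Rightarrow>\<^sub>0 complex) set \<Rightarrow> (ugen list \<times> ugen list \<Rightarrow>\<^sub>0 complex) set"
  where "Ucoprod t = presented_hom (Ualg2 t)
    (\<lambda>g. tensor_ideal ugen_star (urels t)
           +>\<^bsub>monoid_alg (map_prod (word_inv ugen_star) (word_inv ugen_star))\<^esub> ucoprod_gen g)"

fun uantipode_gen :: "real \<Rightarrow> ugen \<Rightarrow> (ugen list \<Rightarrow>\<^sub>0 complex)" where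
  "uantipode_gen t Gen_e = - (scalar (complex_of_real (inverse (lam t))) * letter Gen_e)"
| "uantipode_gen t Gen_f = - (scalar (complex_of_real (lam t)) * letter Gen_f)"
| "uantipode_gen t Gen_q = letter Gen_qi"
| "uantipode_gen t Gen_qi = letter Gen_q"

definition opposite_alg :: "('a, 'm) star_algebra_scheme \<Rightarrow> ('a, 'm) star_algebra_scheme"
  where "opposite_alg R = R\<lparr>monoid.mult := (\<lambda>x y. y \<otimes>\<^bsub>R\<^esub> x)\<rparr>"

definition Uantipode :: "real \<Rightarrow> (ugen list \<Rightarrow>\<^sub>0 complex) set \<Rightarrow> (ugen list \<Rightarrow>\<^sub>0 complex) set"
  where "Uantipode t = presented_hom (opposite_alg (Ualg t))
    (\<lambda>g. rel_ideal ugen_star (urels t) +>\<^bsub>free_alg ugen_star\<^esub> uantipode_gen t g)"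

text \<open>
  A half-integer spin \<open>n\<close> is encoded by the natural number \<open>N = 2n\<close>, and the basis vector
  \<open>\<xi>(n,j)\<close> of \<open>H\<^sub>n\<close> by the index \<open>p = n - j \<in> {0..N}\<close>, so that bases are
  listed with decreasing weight \<open>j\<close>. Operators are \<open>(N+1) \<times> (N+1)\<close> complex matrices.
\<close>

definition mat_alg :: "nat \<Rightarrow> complex mat star_algebra"
  where "mat_alg d = \<lparr>carrier = carrier_mat d d, monoid.mult = (*), one = 1\<^sub>m d, zero = 0\<^sub>m d d,
    add = (+), module.smult = (\<cdot>\<^sub>m), adj = mat_adjoint\<rparr>"

definition wt :: "nat \<Rightarrow> nat \<Rightarrow> real" where "wt N p = real N / 2 - real p"

text \<open>
  \<open>rsq t N p\<close> is \<open>r\<^sub>j\<^sup>2\<close> for \<open>j = wt N p\<close>; the step from \<open>p\<close> to \<open>Suc p\<close> lowers \<open>j\<close> by one.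
\<close>

fun rsq :: "real \<Rightarrow> nat \<Rightarrow> nat \<Rightarrow> real" where
  "rsq t N 0 = 0"
| "rsq t N (Suc p) = rsq t N p +
     inverse (lam t - inverse (lam t)) * (lam t powr (2 * wt N p) - lam t powr (- 2 * wt N p))"

definition rcoef :: "real \<Rightarrow> nat \<Rightarrow> nat \<Rightarrow> real" where "rcoef t N p = sqrt (rsq t N p)"

fun rep_gen :: "real \<Rightarrow> nat \<Rightarrow> ugen \<Rightarrow> complex mat" where
  "rep_gen t N Gen_q = mat (N + 1) (N + 1)
     (\<lambda>(i, p). if i = p then complex_of_real (lam t powr wt N p) else 0)"
| "rep_gen t N Gen_qi = mat (N + 1) (N + 1)
     (\<lambda>(i, p). if i = p then complex_of_real (lam t powr (- wt N p)) else 0)"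
| "rep_gen t N Gen_e = mat (N + 1) (N + 1)
     (\<lambda>(i, p). if p = Suc i then complex_of_real (rcoef t N p) else 0)"
| "rep_gen t N Gen_f = mat (N + 1) (N + 1)
     (\<lambda>(i, p). if i = Suc p then complex_of_real (rcoef t N (Suc p)) else 0)"

definition rep :: "real \<Rightarrow> nat \<Rightarrow> (ugen list \<Rightarrow>\<^sub>0 complex) set \<Rightarrow> complex mat"
  where "rep t N = presented_hom (mat_alg (N + 1)) (rep_gen t N)"

definition kron :: "complex mat \<Rightarrow> complex mat \<Rightarrow> complex mat"
  where "kron X Y = mat (dim_row X * dim_row Y) (dim_col X * dim_col Y)
    (\<lambda>(i, j). X $$ (i div dim_row Y, j div dim_col Y) * Y $$ (i mod dim_row Y, j mod dim_col Y))"

text \<open>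
  The linear extension of \<open>u \<otimes> v \<mapsto> \<pi>\<^sub>n(u) \<otimes> \<pi>\<^sub>m(v)\<close> on words, evaluated on the coset \<open>Z\<close>,
  on which it is constant.
\<close>

definition rep_tensor :: "real \<Rightarrow> nat \<Rightarrow> nat \<Rightarrow> (ugen list \<times> ugen list \<Rightarrow>\<^sub>0 complex) set \<Rightarrow> complex mat"
  where "rep_tensor t N M Z = the_elem ((\<lambda>z. finsum (mat_alg ((N + 1) * (M + 1)))
    (\<lambda>(u, v). Poly_Mapping.lookup z (u, v) \<cdot>\<^sub>m
       kron (free_eval (mat_alg (N + 1)) (rep_gen t N) (Poly_Mapping.single u 1))
            (free_eval (mat_alg (M + 1)) (rep_gen t M) (Poly_Mapping.single v 1)))
    (Poly_Mapping.keys z)) ` Z)"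

definition Acarrier :: "(nat \<Rightarrow> complex mat) set"
  where "Acarrier = {a. (\<forall>k. a k \<in> carrier_mat (k + 1) (k + 1)) \<and> finite {k. a k \<noteq> 0\<^sub>m (k + 1) (k + 1)}}"

definition Aemb :: "nat \<Rightarrow> complex mat \<Rightarrow> (nat \<Rightarrow> complex mat)"
  where "Aemb k X = (\<lambda>l. if l = k then X else 0\<^sub>m (l + 1) (l + 1))"

text \<open>Spins in \<open>{|n - m|, \<dots>, n + m}\<close> go up in steps of one, i.e. of two in the doubled encoding.\<close>

definition Iset :: "nat \<Rightarrow> nat \<Rightarrow> nat set"
  where "Iset N M = {k. \<bar>int N - int M\<bar> \<le> int k \<and> k \<le> N + M \<and> even (N + M + k)}"

text \<open>
  The component of the coproduct of \<open>a\<close> in \<open>A\<^sub>n \<otimes> A\<^sub>m\<close>. The components of \<open>a\<close> outside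
  \<open>Iset N M\<close> are ignored, which is the linear extension of the two defining cases.
\<close>

definition Acoprod :: "real \<Rightarrow> (nat \<Rightarrow> complex mat) \<Rightarrow> nat \<Rightarrow> nat \<Rightarrow> complex mat"
  where "Acoprod t a N M = (THE Y. \<exists>x\<in>carrier (Ualg t).
    (\<forall>k\<in>Iset N M. rep t k x = a k) \<and> Y = rep_tensor t N M (Ucoprod t x))"

definition Aantipode :: "real \<Rightarrow> (nat \<Rightarrow> complex mat) \<Rightarrow> (nat \<Rightarrow> complex mat)"
  where "Aantipode t a = (\<lambda>k. THE Y. \<exists>x\<in>carrier (Ualg t).
    rep t k x = a k \<and> Y = rep t k (Uantipode t x))"

definition Aadj :: "(nat \<Rightarrow> complex mat) \<Rightarrow> (nat \<Rightarrow> complex mat)"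
  where "Aadj a = (\<lambda>k. mat_adjoint (a k))"

definition Acounit :: "(nat \<Rightarrow> complex mat) \<Rightarrow> complex"
  where "Acounit a = a 0 $$ (0, 0)"

definition dual_supp :: "((nat \<Rightarrow> complex mat) \<Rightarrow> complex) \<Rightarrow> nat set"
  where "dual_supp b = {k. \<exists>X\<in>carrier_mat (k + 1) (k + 1). b (Aemb k X) \<noteq> 0}"

text \<open>
  The dual of \<open>A\<close>: the functionals \<open>\<phi>\<^sub>A(\<cdot> a)\<close> with \<open>a \<in> A\<close> are exactly the functionals
  vanishing on all but finitely many \<open>A\<^sub>k\<close>. Functionals are functions on \<open>Acarrier\<close>, made \<open>undefined\<close> outside it so that equality of
  functionals is equality of functions.
\<close>

definition Bcarrier :: "((nat \<Rightarrow> complex mat) \<Rightarrow> complex) set"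
  where "Bcarrier = {b \<in> extensional Acarrier.
    (\<forall>x\<in>Acarrier. \<forall>y\<in>Acarrier. b (\<lambda>k. x k + y k) = b x + b y) \<and>
    (\<forall>c. \<forall>x\<in>Acarrier. b (\<lambda>k. c \<cdot>\<^sub>m x k) = c * b x) \<and>
    finite (dual_supp b)}"

definition mat_unit :: "nat \<Rightarrow> nat \<Rightarrow> nat \<Rightarrow> complex mat"
  where "mat_unit d i j = mat d d (\<lambda>(p, r). if p = i \<and> r = j then 1 else 0)"

text \<open>
  \<open>\<langle>Y, b \<otimes> b'\<rangle>\<close> for \<open>Y\<close> in the multiplier algebra, the product of all \<open>A\<^sub>n \<otimes> A\<^sub>m\<close>:
  each component of \<open>Y\<close> is expanded in the basis of tensor products of matrix units.
\<close>

definition pair_tensor :: "(nat \<Rightarrow> nat \<Rightarrow> complex mat) \<Rightarrow> ((nat \<Rightarrow> complex mat) \<Rightarrow> complex)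
    \<Rightarrow> ((nat \<Rightarrow> complex mat) \<Rightarrow> complex) \<Rightarrow> complex"
  where "pair_tensor Y b b' = (\<Sum>N\<in>dual_supp b. \<Sum>M\<in>dual_supp b'.
    \<Sum>i\<le>N. \<Sum>j\<le>N. \<Sum>k\<le>M. \<Sum>l\<le>M.
      Y N M $$ (i * (M + 1) + k, j * (M + 1) + l)
        * b (Aemb N (mat_unit (N + 1) i j)) * b' (Aemb M (mat_unit (M + 1) k l)))"

definition Bdual :: "real \<Rightarrow> ((nat \<Rightarrow> complex mat) \<Rightarrow> complex) star_algebra"
  where "Bdual t = \<lparr>
    carrier = Bcarrier,
    monoid.mult = (\<lambda>b b'. \<lambda>a\<in>Acarrier. pair_tensor (Acoprod t a) b' b),
    one = (\<lambda>a\<in>Acarrier. Acounit a),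
    zero = (\<lambda>a\<in>Acarrier. 0),
    add = (\<lambda>b b'. \<lambda>a\<in>Acarrier. b a + b' a),
    module.smult = (\<lambda>c b. \<lambda>a\<in>Acarrier. c * b a),
    adj = (\<lambda>b. \<lambda>a\<in>Acarrier. cnj (b (Aantipode t (Aadj a))))\<rparr>"

definition umat :: "nat \<Rightarrow> nat \<Rightarrow> ((nat \<Rightarrow> complex mat) \<Rightarrow> complex)"
  where "umat i j = (\<lambda>a\<in>Acarrier. a 1 $$ (i - 1, j - 1))"  \<comment> \<open>\<open>i, j \<in> {1, 2}\<close>; index 1 stands for spin \<open>1/2\<close>\<close>

datatype pgen = Gen_alpha | Gen_alpha_star | Gen_gamma | Gen_gamma_star

fun pgen_star :: "pgen \<Rightarrow> pgen" where
  "pgen_star Gen_alpha = Gen_alpha_star"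
| "pgen_star Gen_alpha_star = Gen_alpha"
| "pgen_star Gen_gamma = Gen_gamma_star"
| "pgen_star Gen_gamma_star = Gen_gamma"

definition prels :: "real \<Rightarrow> (pgen list \<Rightarrow>\<^sub>0 complex) set" where
  "prels nu = (let a = letter Gen_alpha; a' = letter Gen_alpha_star;
      c = letter Gen_gamma; c' = letter Gen_gamma_star; v = scalar (complex_of_real nu) in
    {a' * a + c' * c - 1,
     a * a' + v * v * c * c' - 1,
     c * c' - c' * c,
     a * c - v * c * a,
     a * c' - v * c' * a})"

definition Palg :: "real \<Rightarrow> (pgen list \<Rightarrow>\<^sub>0 complex) set star_algebra"
  where "Palg nu = presented_alg pgen_star (prels nu)"

definition Pgen :: "real \<Rightarrow> pgen \<Rightarrow> (pgen list \<Rightarrow>\<^sub>0 complex) set"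
  where "Pgen nu g = rel_ideal pgen_star (prels nu) +>\<^bsub>free_alg pgen_star\<^esub> letter g"

end

theory Submission
  imports Defs
begin

text \<open>
  The product of a matrix coefficient of \<open>\<pi>\<^sub>n\<close> and one of \<open>\<pi>\<^sub>1\<^sub>/\<^sub>2\<close> is a matrix coefficient of
  \<open>(\<pi>\<^sub>n \<otimes> \<pi>\<^sub>1\<^sub>/\<^sub>2) \<circ> \<Delta>\<close>, and this representation contains \<open>\<pi>\<^sub>n\<^sub>+\<^sub>1\<^sub>/\<^sub>2\<close>. An explicit intertwiner
  with at most two nonzero entries in each column therefore writes every coefficient of
  \<open>\<pi>\<^sub>n\<^sub>+\<^sub>1\<^sub>/\<^sub>2\<close> as a combination of products of coefficients of \<open>\<pi>\<^sub>n\<close> with the \<open>u\<^sub>i\<^sub>j\<close>. The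
  range of \<open>\<theta>\<close> contains \<open>u\<^sub>1\<^sub>1\<close>, \<open>u\<^sub>2\<^sub>1\<close> and their adjoints \<open>u\<^sub>2\<^sub>2\<close>, \<open>-\<lambda> u\<^sub>1\<^sub>2\<close>; hence, by
  induction on the spin, it contains all matrix coefficients, and these span the dual.
  
  The product of the dual is defined through preimages under the representations. It can be evaluated because
  finitely many of the \<open>\<pi>\<^sub>k\<close> are jointly surjective (a polynomial in \<open>q\<close> isolates the highest
  weight vector of the largest spin) and because \<open>\<pi>\<^sub>n \<otimes> \<pi>\<^sub>1\<^sub>/\<^sub>2\<close> is exhausted by the two
  components \<open>\<pi>\<^sub>n\<^sub>\<plusminus>\<^sub>1\<^sub>/\<^sub>2\<close>.
\<close>

section \<open>Algebra homomorphisms from monoid algebras\<close>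

text \<open>Neither the coproduct nor the antipode of \<open>A\<close> comes as a formula: each is a
  \<open>THE\<close> over preimages in \<AA>, itself a quotient whose maps are read off cosets.
  Every such value requires a preimage and independence of its choice. For the coproduct against
  spin one half, independence says that an element killed by the representations of spin n + 1/2
  and, if n > 0, n - 1/2 is killed by the tensor product representation. This is why a second
  intertwiner, for the lower component, is built beside the one that the induction uses: the columns
  of the two together span the tensor product.

  The induction reads single entries of V a = \<Delta>(a) V, with V the upper intertwiner. Each row
  of V has exactly one nonzero entry, so the left side is one coefficient of a times a positive
  number, and one division isolates it. Products in the dual reverse the tensor legs, so the factor
  of spin one half stands on the left.\<close>

lemma poly_mapping_sum_single:
  "x = (\<Sum>w\<in>Poly_Mapping.keys x. Poly_Mapping.single w (Poly_Mapping.lookup x w))"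
proof (rule poly_mapping_eqI)
  fix k
  have "Poly_Mapping.lookup (\<Sum>w\<in>Poly_Mapping.keys x. Poly_Mapping.single w (Poly_Mapping.lookup x w)) k
      = (\<Sum>w\<in>Poly_Mapping.keys x. if w = k then Poly_Mapping.lookup x w else 0)"
    by (simp add: lookup_sum lookup_single when_def)
  also have "\<dots> = Poly_Mapping.lookup x k"
    by (simp add: sum.delta' in_keys_iff)
  finally show "Poly_Mapping.lookup x k
      = Poly_Mapping.lookup (\<Sum>w\<in>Poly_Mapping.keys x. Poly_Mapping.single w (Poly_Mapping.lookup x w)) k" ..
qed

text \<open>Zero is covered by the first case, as a monomial with coefficient 0; linear and bilinear
  identities thus reduce to monomials.\<close>

lemma poly_mapping_add_induct [case_names single add]:
  fixes x :: "'w \<Rightarrow>\<^sub>0 'c::comm_monoid_add"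
  assumes "\<And>w c. P (Poly_Mapping.single w c)"
    and "\<And>x y. P x \<Longrightarrow> P y \<Longrightarrow> P (x + y)"
  shows "P x"
proof -
  have "P 0" using assms(1)[of undefined 0] by simp
  have "P (\<Sum>w\<in>S. Poly_Mapping.single w (Poly_Mapping.lookup x w))" if "finite S" for S
    using that by (induction S rule: finite_induct) (auto intro: assms \<open>P 0\<close>)
  from this[of "Poly_Mapping.keys x"] show ?thesis
    using poly_mapping_sum_single[of x] by simp
qed

lemma scalar_central: "scalar c * x = x * scalar c"
  for x :: "'w::monoid_add \<Rightarrow>\<^sub>0 complex"
  by (induction x rule: poly_mapping_add_induct)
    (simp_all add: scalar_def mult_single mult.commute distrib_left distrib_right)

lemma scalar_left_commute: "x * (scalar c * y) = scalar c * (x * y)"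
  for x :: "'w::monoid_add \<Rightarrow>\<^sub>0 complex"
  by (simp only: mult.assoc[symmetric] scalar_central[of c x])

lemma scalar_simps [simp]:
  "scalar 1 = (1 :: 'w::monoid_add \<Rightarrow>\<^sub>0 complex)"
  "scalar 0 = (0 :: 'w::monoid_add \<Rightarrow>\<^sub>0 complex)"
  by (simp_all add: scalar_def single_one)

lemma scalar_add: "scalar (c + d) = (scalar c + scalar d :: 'w::monoid_add \<Rightarrow>\<^sub>0 complex)"
  by (simp add: scalar_def single_add)

lemma scalar_uminus: "scalar (- c) = (- scalar c :: 'w::monoid_add \<Rightarrow>\<^sub>0 complex)"
  by (simp add: scalar_def single_uminus)

lemma scalar_mult: "scalar (c * d) = (scalar c * scalar d :: 'w::monoid_add \<Rightarrow>\<^sub>0 complex)"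
  by (simp add: scalar_def mult_single)

text \<open>The axioms of a unital complex algebra, with none for \<open>adj\<close>: matrix
  algebras, quotients and their opposites all serve as targets of maps that are only linear and
  multiplicative.\<close>

locale calg = ring T for T :: "('a, 'm) star_algebra_scheme" (structure) +
  assumes smult_closed [simp, intro]: "x \<in> carrier T \<Longrightarrow> c \<odot>\<^bsub>T\<^esub> x \<in> carrier T"
    and smult_add_left: "x \<in> carrier T \<Longrightarrow> (c + d) \<odot>\<^bsub>T\<^esub> x = c \<odot>\<^bsub>T\<^esub> x \<oplus> d \<odot>\<^bsub>T\<^esub> x"
    and smult_add_right: "x \<in> carrier T \<Longrightarrow> y \<in> carrier T \<Longrightarrow>
      c \<odot>\<^bsub>T\<^esub> (x \<oplus> y) = c \<odot>\<^bsub>T\<^esub> x \<oplus> c \<odot>\<^bsub>T\<^esub> y"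
    and smult_smult: "x \<in> carrier T \<Longrightarrow> c \<odot>\<^bsub>T\<^esub> (d \<odot>\<^bsub>T\<^esub> x) = (c * d) \<odot>\<^bsub>T\<^esub> x"
    and smult_one [simp]: "x \<in> carrier T \<Longrightarrow> 1 \<odot>\<^bsub>T\<^esub> x = x"
    and smult_mult_left: "x \<in> carrier T \<Longrightarrow> y \<in> carrier T \<Longrightarrow>
      (c \<odot>\<^bsub>T\<^esub> x) \<otimes> y = c \<odot>\<^bsub>T\<^esub> (x \<otimes> y)"
    and smult_mult_right: "x \<in> carrier T \<Longrightarrow> y \<in> carrier T \<Longrightarrow>
      x \<otimes> (c \<odot>\<^bsub>T\<^esub> y) = c \<odot>\<^bsub>T\<^esub> (x \<otimes> y)"
begin

lemma smult_zero_left [simp]: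
  assumes "x \<in> carrier T" shows "0 \<odot>\<^bsub>T\<^esub> x = \<zero>"
proof -
  have "0 \<odot>\<^bsub>T\<^esub> x \<oplus> 0 \<odot>\<^bsub>T\<^esub> x = 0 \<odot>\<^bsub>T\<^esub> x"
    using smult_add_left[OF assms, of 0 0] by simp
  then show ?thesis
    using assms by (metis add.l_cancel_one smult_closed)
qed

lemma diff_eq_zero_iff:
  assumes "x \<in> carrier T" "y \<in> carrier T"
  shows "x \<ominus> y = \<zero> \<longleftrightarrow> x = y"
proof
  assume "x \<ominus> y = \<zero>"
  then have "x \<oplus> (\<ominus> y \<oplus> y) = y"
    using assms by (simp add: a_minus_def flip: a_assoc)
  then show "x = y" using assms by (simp add: l_neg)
qed (use assms in \<open>simp add: a_minus_def r_neg\<close>)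

end

text \<open>Scalars embed as \<open>scalar c\<close>, so homogeneity follows from
  \<open>map_mult\<close> and \<open>map_scalar\<close>.\<close>

locale alg_map = calg T for T :: "('a, 'm) star_algebra_scheme" (structure) +
  fixes h :: "('w::monoid_add \<Rightarrow>\<^sub>0 complex) \<Rightarrow> 'a"
  assumes closed [simp, intro]: "h x \<in> carrier T"
    and map_add: "h (x + y) = h x \<oplus> h y"
    and map_mult: "h (x * y) = h x \<otimes> h y"
    and map_scalar: "h (scalar c) = c \<odot>\<^bsub>T\<^esub> \<one>"
begin

lemma map_one [simp]: "h 1 = \<one>"
  using map_scalar[of 1] by simp

lemma map_zero [simp]: "h 0 = \<zero>"
  using map_scalar[of 0] by simp

lemma map_smult: "h (scalar c * x) = c \<odot>\<^bsub>T\<^esub> h x"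
  by (simp add: map_mult map_scalar smult_mult_left)

lemma map_uminus: "h (- x) = \<ominus> h x"
  using map_add[of "-x" x] by (simp add: minus_equality)

lemma map_diff: "h (x - y) = h x \<ominus> h y"
  using map_add[of x "-y"] by (simp add: map_uminus a_minus_def)

end

text \<open>Both \<open>free_eval\<close> and the sum inside \<open>rep_tensor\<close> have this
  shape, so one proof of additivity and multiplicativity serves both.\<close>

definition lin_ext :: "('b, 'm) star_algebra_scheme \<Rightarrow> ('w \<Rightarrow> 'b) \<Rightarrow> ('w \<Rightarrow>\<^sub>0 complex) \<Rightarrow> 'b"
  where "lin_ext T g x = finsum T (\<lambda>w. module.smult T (Poly_Mapping.lookup x w) (g w)) (Poly_Mapping.keys x)"

context calg
begin

text \<open>Cancellation can make \<open>keys (x + y)\<close> smaller than the union of the keys;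
  additivity therefore compares sums over a common larger set.\<close>

lemma lin_ext_superset:
  assumes g: "\<And>w. g w \<in> carrier T" and S: "finite S" "Poly_Mapping.keys x \<subseteq> S"
  shows "lin_ext T g x = (\<Oplus>w\<in>S. Poly_Mapping.lookup x w \<odot>\<^bsub>T\<^esub> g w)"
  unfolding lin_ext_def
  by (rule add.finprod_mono_neutral_cong_left) (use S g in \<open>auto simp: in_keys_iff\<close>)

lemma lin_ext_closed [simp, intro]:
  "(\<And>w. g w \<in> carrier T) \<Longrightarrow> lin_ext T g x \<in> carrier T"
  unfolding lin_ext_def by (intro finsum_closed) auto

lemma lin_ext_single:
  assumes g: "\<And>w. g w \<in> carrier T"
  shows "lin_ext T g (Poly_Mapping.single w c) = c \<odot>\<^bsub>T\<^esub> g w"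
  by (subst lin_ext_superset[OF g, of "{w}"]) (use g in \<open>auto simp: lookup_single\<close>)

lemma lin_ext_add:
  assumes g: "\<And>w. g w \<in> carrier T"
  shows "lin_ext T g (x + y) = lin_ext T g x \<oplus> lin_ext T g y"
proof -
  let ?S = "Poly_Mapping.keys x \<union> Poly_Mapping.keys y"
  have k: "Poly_Mapping.keys (x + y) \<subseteq> ?S" by (rule Poly_Mapping.keys_add)
  show ?thesis
    by (subst (1 2 3) lin_ext_superset[OF g, of ?S])
      (use g k in \<open>auto simp: lookup_add smult_add_left finsum_addf\<close>)
qed

lemma lin_ext_mult:
  fixes g :: "'w::monoid_add \<Rightarrow> 'a"
  assumes g: "\<And>w. g w \<in> carrier T" and gg: "\<And>v w. g (v + w) = g v \<otimes> g w"
  shows "lin_ext T g (x * y) = lin_ext T g x \<otimes> lin_ext T g y"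
proof (induction x rule: poly_mapping_add_induct)
  case (single v c)
  show ?case
  proof (induction y rule: poly_mapping_add_induct)
    case (single w d)
    show ?case
      by (simp add: mult_single lin_ext_single g gg smult_mult_left smult_mult_right smult_smult mult.commute)
  next
    case (add y z)
    then show ?case by (simp add: distrib_left lin_ext_add g r_distr)
  qed
next
  case (add x z)
  then show ?case by (simp add: distrib_right lin_ext_add g l_distr)
qed

lemma alg_map_lin_ext:
  assumes "\<And>w. g w \<in> carrier T" "\<And>v w. g (v + w) = g v \<otimes> g w" "g 0 = \<one>"
  shows "alg_map T (lin_ext T g)"
  by unfold_locales (use assms in \<open>simp_all add: lin_ext_add lin_ext_mult lin_ext_single scalar_def\<close>)

definition word_eval where "word_eval v w = foldr (\<lambda>g y. v g \<otimes> y) w \<one>"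

lemma free_eval_eq_lin_ext: "free_eval T v = lin_ext T (word_eval v)"
  by (simp add: fun_eq_iff free_eval_def lin_ext_def word_eval_def)

lemma word_eval_closed [simp, intro]: "(\<And>g. v g \<in> carrier T) \<Longrightarrow> word_eval v w \<in> carrier T"
  by (induction w) (auto simp: word_eval_def)

lemma word_eval_append:
  "(\<And>g. v g \<in> carrier T) \<Longrightarrow> word_eval v (u + w) = word_eval v u \<otimes> word_eval v w"
  by (induction u) (auto simp: word_eval_def plus_list_def m_assoc word_eval_closed[unfolded word_eval_def])

lemma alg_map_free_eval:
  assumes "\<And>g. v g \<in> carrier T"
  shows "alg_map T (free_eval T v)"
  unfolding free_eval_eq_lin_ext
  by (rule alg_map_lin_ext) (use assms in \<open>auto simp: word_eval_append word_eval_closed\<close>, simp add: word_eval_def zero_list_def)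

lemma free_eval_letter:
  assumes "\<And>g. v g \<in> carrier T"
  shows "free_eval T v (letter g) = v g"
  unfolding free_eval_eq_lin_ext letter_def
  by (subst lin_ext_single) (use assms in \<open>auto simp: word_eval_closed\<close>, simp add: word_eval_def)

end

text \<open>Peeling letters off the left suits homomorphisms and antihomomorphisms alike: only
  scalars, one letter and sums have to be checked.\<close>

lemma free_alg_induct [case_names scalar letter add]:
  fixes x :: "'g list \<Rightarrow>\<^sub>0 complex"
  assumes s: "\<And>c. P (scalar c)" and l: "\<And>g x. P x \<Longrightarrow> P (letter g * x)"
    and a: "\<And>x y. P x \<Longrightarrow> P y \<Longrightarrow> P (x + y)"
  shows "P x"
proof (induction x rule: poly_mapping_add_induct)
  case (single w c)
  show ?case
  proof (induction w)
    case Nil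
    show ?case using s[of c] by (simp add: scalar_def zero_list_def)
  next
    case (Cons g w)
    have "Poly_Mapping.single (g # w) c = letter g * Poly_Mapping.single w c"
      by (simp add: letter_def mult_single plus_list_def)
    then show ?case using l[OF Cons] by simp
  qed
qed (rule a)

lemma alg_map_unique:
  assumes "alg_map T h" "alg_map T k" "\<And>g. h (letter g) = k (letter g)"
  shows "h x = k x"
proof -
  interpret h: alg_map T h by fact
  interpret k: alg_map T k by fact
  show ?thesis
    by (induction x rule: free_alg_induct)
      (simp_all add: h.map_add k.map_add h.map_mult k.map_mult h.map_scalar k.map_scalar assms(3))
qed

lemma monoid_alg_simps [simp]:
  "carrier (monoid_alg s) = UNIV" "x \<otimes>\<^bsub>monoid_alg s\<^esub> y = x * y" "\<one>\<^bsub>monoid_alg s\<^esub> = 1"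
  "\<zero>\<^bsub>monoid_alg s\<^esub> = 0" "x \<oplus>\<^bsub>monoid_alg s\<^esub> y = x + y" "c \<odot>\<^bsub>monoid_alg s\<^esub> x = scalar c * x"
  by (simp_all add: monoid_alg_def scalar_def)

lemma calg_monoid_alg: "calg (monoid_alg s)"
proof -
  interpret ring "monoid_alg s" by (rule ring_monoid_alg)
  show ?thesis
    by unfold_locales (auto simp: scalar_add scalar_mult algebra_simps, metis mult.assoc scalar_central)
qed

lemma monoid_alg_a_inv [simp]: "\<ominus>\<^bsub>monoid_alg s\<^esub> x = - x"
proof -
  interpret ring "monoid_alg s" by (rule ring_monoid_alg)
  show ?thesis using minus_equality[of "-x" x] by simp
qed

lemma monoid_alg_a_minus [simp]: "x \<ominus>\<^bsub>monoid_alg s\<^esub> y = x - y"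
  by (simp add: a_minus_def)

section \<open>Quotients by ideals\<close>

locale alg_ideal = ideal J "monoid_alg s" for J :: "('w::monoid_add \<Rightarrow>\<^sub>0 complex) set" and s
begin

abbreviation Q where "Q \<equiv> quot_alg (monoid_alg s) J"
abbreviation proj where "proj x \<equiv> J +>\<^bsub>monoid_alg s\<^esub> x"

lemma proj_eq: "proj x = (\<lambda>j. j + x) ` J"
  by (auto simp: a_r_coset_def r_coset_def)

lemma proj_eq_iff: "proj x = proj y \<longleftrightarrow> x - y \<in> J"
  using quotient_eq_iff_same_a_r_cos[OF ideal_axioms, of x y] by simp

lemma in_proj_iff: "y \<in> proj x \<longleftrightarrow> y - x \<in> J"
proof
  assume "y - x \<in> J"
  then show "y \<in> proj x" unfolding proj_eq by (rule image_eqI[rotated]) simp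
qed (auto simp: proj_eq)

lemma self_in_proj: "x \<in> proj x"
  using additive_subgroup.zero_closed[OF is_additive_subgroup] by (simp add: in_proj_iff)

lemma J_minus: "x \<in> J \<Longrightarrow> - x \<in> J"
  using additive_subgroup.a_inv_closed[OF is_additive_subgroup] by simp

lemma J_scalar: "x \<in> J \<Longrightarrow> scalar c * x \<in> J"
  using I_l_closed by simp

lemma carrier_Q: "carrier Q = range proj"
  by (auto simp: quot_alg_def FactRing_def A_RCOSETS_def' simp del: ideal.Icarr)

lemma zero_Q: "\<zero>\<^bsub>Q\<^esub> = proj 0"
  by (simp add: quot_alg_def FactRing_def proj_eq)

lemma one_Q: "\<one>\<^bsub>Q\<^esub> = proj 1"
  by (simp add: quot_alg_def FactRing_def)

lemma add_Q: "proj x \<oplus>\<^bsub>Q\<^esub> proj y = proj (x + y)"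
  using a_rcos_sum[of x y] by (simp add: quot_alg_def FactRing_def)

lemma mult_Q: "proj x \<otimes>\<^bsub>Q\<^esub> proj y = proj (x * y)"
  using rcoset_mult_add[of x y] by (simp add: quot_alg_def FactRing_def)

text \<open>\<open>quot_alg\<close> takes the union of the cosets obtained from all representatives;
  the ideal absorbs scalars, so these cosets coincide.\<close>

lemma smult_Q: "c \<odot>\<^bsub>Q\<^esub> proj x = proj (scalar c * x)"
proof -
  have "proj (scalar c * y) = proj (scalar c * x)" if "y \<in> proj x" for y
    using J_scalar[of "y - x" c] that by (simp add: proj_eq_iff in_proj_iff right_diff_distrib)
  then have "(\<Union>y\<in>proj x. proj (scalar c * y)) = proj (scalar c * x)"
    using self_in_proj[of x] by blast
  then show ?thesis by (simp add: quot_alg_def)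
qed

lemma adj_Q:
  assumes "\<And>x y. adj (monoid_alg s) (x - y) = adj (monoid_alg s) x - adj (monoid_alg s) y"
    and "\<And>x. x \<in> J \<Longrightarrow> adj (monoid_alg s) x \<in> J"
  shows "adj Q (proj x) = proj (adj (monoid_alg s) x)"
proof -
  have "proj (adj (monoid_alg s) y) = proj (adj (monoid_alg s) x)" if "y \<in> proj x" for y
    using assms(2)[of "y - x"] that by (simp add: proj_eq_iff in_proj_iff assms(1))
  then have "(\<Union>y\<in>proj x. proj (adj (monoid_alg s) y)) = proj (adj (monoid_alg s) x)"
    using self_in_proj[of x] by blast
  then show ?thesis by (simp add: quot_alg_def)
qed

lemmas Q_simps = carrier_Q zero_Q one_Q add_Q mult_Q smult_Q

lemma ring_Q: "ring Q"
proof (rule ringI)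
  show "abelian_group Q"
  proof (rule abelian_groupI)
    fix x assume "x \<in> carrier Q"
    then obtain a where "x = proj a" by (auto simp: carrier_Q)
    then have "proj (- a) \<oplus>\<^bsub>Q\<^esub> x = \<zero>\<^bsub>Q\<^esub>" by (simp add: Q_simps)
    then show "\<exists>y\<in>carrier Q. y \<oplus>\<^bsub>Q\<^esub> x = \<zero>\<^bsub>Q\<^esub>" by (auto simp: carrier_Q)
  qed (auto simp: Q_simps ac_simps)
  show "monoid Q"
    by (rule monoidI) (auto simp: Q_simps mult.assoc)
qed (auto simp: Q_simps algebra_simps)

sublocale quot: calg Q
proof (rule calg.intro[OF ring_Q], rule calg_axioms.intro, goal_cases)
  case (7 x y c)
  then obtain a b where xy: "x = proj a" "y = proj b" by (auto simp: carrier_Q)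
  have "a * (scalar c * b) = scalar c * (a * b)"
    by (metis mult.assoc scalar_central)
  then show ?case by (simp add: Q_simps xy)
qed (auto simp: Q_simps scalar_add scalar_mult algebra_simps)

sublocale proj: alg_map Q proj
  by (rule alg_map.intro[OF quot.calg_axioms], rule alg_map_axioms.intro) (auto simp: Q_simps)

end

text \<open>A map that kills the ideal is constant on each coset, so the image of a coset is a
  singleton. Every \<open>presented_hom\<close>, and also \<open>rep_tensor\<close>, is evaluated
  through this.\<close>

lemma (in alg_map) presented_hom_eq:
  assumes "alg_ideal J s" and k: "\<And>x. x \<in> J \<Longrightarrow> h x = \<zero>"
  shows "the_elem (h ` (J +>\<^bsub>monoid_alg s\<^esub> x)) = h x"
proof -
  interpret J: alg_ideal J s by fact
  have "h y = h x" if "y \<in> J.proj x" for y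
  proof -
    have "h (y - x) = \<zero>" using that k by (simp add: J.in_proj_iff)
    then show ?thesis using map_add[of "y - x" x] by simp
  qed
  then have "h ` J.proj x = {h x}" using J.self_in_proj[of x] by blast
  then show ?thesis by simp
qed

text \<open>Combined with \<open>genideal_le\<close>: a map kills a generated ideal as soon as it
  kills the generators.\<close>

lemma (in alg_map) ideal_kernel: "alg_ideal {x. h x = \<zero>} s"
proof -
  interpret R: ring "monoid_alg s" by (rule ring_monoid_alg)
  have "ideal {x. h x = \<zero>} (monoid_alg s)"
  proof (rule idealI)
    show "subgroup {x. h x = \<zero>} (add_monoid (monoid_alg s))"
      using R.add.group_axioms
      by (rule group.subgroupI)
        (auto simp: map_add map_uminus monoid_alg_a_inv[unfolded a_inv_def, simplified]
          intro: exI[of _ 0])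
  qed (auto simp: map_mult R.ring_axioms)
  then show ?thesis by (rule alg_ideal.intro)
qed

lemma genideal_alg_ideal: "alg_ideal (Idl\<^bsub>monoid_alg s\<^esub> R) s"
proof -
  interpret R: ring "monoid_alg s" by (rule ring_monoid_alg)
  show ?thesis by (rule alg_ideal.intro, rule R.genideal_ideal) simp
qed

lemma genideal_le:
  assumes "alg_ideal K s" "R \<subseteq> K" "x \<in> Idl\<^bsub>monoid_alg s\<^esub> R"
  shows "x \<in> K"
proof -
  interpret R: ring "monoid_alg s" by (rule ring_monoid_alg)
  show ?thesis
    using R.genideal_minimal[OF alg_ideal.axioms[OF assms(1)] assms(2)] assms(3) by blast
qed

lemma genideal_self: "x \<in> R \<Longrightarrow> x \<in> Idl\<^bsub>monoid_alg s\<^esub> R"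
proof -
  interpret R: ring "monoid_alg s" by (rule ring_monoid_alg)
  show "x \<in> R \<Longrightarrow> x \<in> Idl\<^bsub>monoid_alg s\<^esub> R"
    using R.genideal_self[of R] by auto
qed

lemma alg_ideal_rel_ideal: "alg_ideal (rel_ideal s R) (word_inv s)"
  unfolding rel_ideal_def free_alg_def by (rule genideal_alg_ideal)

lemma alg_ideal_tensor_ideal: "alg_ideal (tensor_ideal s R) (map_prod (word_inv s) (word_inv s))"
  unfolding tensor_ideal_def by (rule genideal_alg_ideal)

text \<open>
  In this algebra the involution of a free algebra becomes a linear homomorphism.
\<close>

definition conj_opposite :: "('a, 'm) star_algebra_scheme \<Rightarrow> ('a, 'm) star_algebra_scheme"
  where "conj_opposite T = (opposite_alg T)\<lparr>module.smult := (\<lambda>c. module.smult T (cnj c))\<rparr>"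

lemma opposite_alg_simps [simp]:
  "carrier (opposite_alg T) = carrier T" "x \<otimes>\<^bsub>opposite_alg T\<^esub> y = y \<otimes>\<^bsub>T\<^esub> x" "\<one>\<^bsub>opposite_alg T\<^esub> = \<one>\<^bsub>T\<^esub>"
  "\<zero>\<^bsub>opposite_alg T\<^esub> = \<zero>\<^bsub>T\<^esub>" "x \<oplus>\<^bsub>opposite_alg T\<^esub> y = x \<oplus>\<^bsub>T\<^esub> y" "c \<odot>\<^bsub>opposite_alg T\<^esub> x = c \<odot>\<^bsub>T\<^esub> x"
  by (simp_all add: opposite_alg_def)

lemma conj_opposite_simps [simp]:
  "carrier (conj_opposite T) = carrier T" "x \<otimes>\<^bsub>conj_opposite T\<^esub> y = y \<otimes>\<^bsub>T\<^esub> x" "\<one>\<^bsub>conj_opposite T\<^esub> = \<one>\<^bsub>T\<^esub>"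
  "\<zero>\<^bsub>conj_opposite T\<^esub> = \<zero>\<^bsub>T\<^esub>" "x \<oplus>\<^bsub>conj_opposite T\<^esub> y = x \<oplus>\<^bsub>T\<^esub> y" "c \<odot>\<^bsub>conj_opposite T\<^esub> x = cnj c \<odot>\<^bsub>T\<^esub> x"
  by (simp_all add: conj_opposite_def)

context calg
begin

lemma ring_opposite: "ring (opposite_alg T)" and ring_conj_opposite: "ring (conj_opposite T)"
proof -
  \<comment> \<open>The two rings differ only in the scalar action, which the ring axioms do not
    see, so one argument covers both.\<close>
  have 1: "ring T'" if "carrier T' = carrier T" "\<And>x y. x \<otimes>\<^bsub>T'\<^esub> y = y \<otimes> x" "\<one>\<^bsub>T'\<^esub> = \<one>"
    "\<zero>\<^bsub>T'\<^esub> = \<zero>" "\<And>x y. x \<oplus>\<^bsub>T'\<^esub> y = x \<oplus> y" for T' :: "('a, 'm) star_algebra_scheme"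
  proof (rule ringI)
    show "abelian_group T'"
    proof (rule abelian_groupI)
      fix x assume "x \<in> carrier T'"
      then show "\<exists>y\<in>carrier T'. y \<oplus>\<^bsub>T'\<^esub> x = \<zero>\<^bsub>T'\<^esub>"
        by (intro bexI[of _ "\<ominus> x"]) (simp_all add: that l_neg)
    qed (simp_all add: that a_ac)
    show "monoid T'" by (rule monoidI) (simp_all add: that m_assoc)
  qed (simp_all add: that l_distr r_distr)
  show "ring (opposite_alg T)" "ring (conj_opposite T)" by (rule 1; simp)+
qed

lemma calg_opposite: "calg (opposite_alg T)"
proof -
  interpret O: ring "opposite_alg T" by (rule ring_opposite)
  show ?thesis
    by unfold_locales
      (simp_all add: smult_add_left smult_add_right smult_smult smult_mult_left smult_mult_right)
qed

lemma calg_conj_opposite: "calg (conj_opposite T)"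
proof -
  interpret O: ring "conj_opposite T" by (rule ring_conj_opposite)
  show ?thesis
    by unfold_locales
      (simp_all add: smult_add_left smult_add_right smult_smult smult_mult_left smult_mult_right)
qed

end

lemma alg_map_adj_free_alg:
  assumes "\<And>g. s (s g) = g"
  shows "alg_map (conj_opposite (free_alg s)) (adj (free_alg s))"
proof -
  interpret F: calg "free_alg s" unfolding free_alg_def by (rule calg_monoid_alg)
  interpret C: calg "conj_opposite (free_alg s)" by (rule F.calg_conj_opposite)
  have "adj (free_alg s) = lin_ext (conj_opposite (free_alg s)) (\<lambda>w. Poly_Mapping.single (word_inv s w) 1)"
  proof (rule ext)
    fix x :: "'a list \<Rightarrow>\<^sub>0 complex"
    have fs: "finsum (conj_opposite (free_alg s)) f S = (\<Sum>w\<in>S. f w)" if "finite S" for S and f :: "'a list \<Rightarrow> _"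
      using that
    proof (induction S rule: finite_induct)
      case empty
      then show ?case using C.finsum_empty by (simp add: free_alg_def)
    next
      case (insert w S)
      then show ?case by (subst C.finsum_insert) (auto simp: free_alg_def)
    qed
    show "adj (free_alg s) x = lin_ext (conj_opposite (free_alg s)) (\<lambda>w. Poly_Mapping.single (word_inv s w) 1) x"
      unfolding lin_ext_def by (subst fs) (simp_all add: free_alg_def monoid_alg_def mult_single)
  qed
  then show ?thesis
    using C.alg_map_lin_ext[of "\<lambda>w. Poly_Mapping.single (word_inv s w) 1"]
    using single_one[where ?'a = "'a list"]
    by (simp add: free_alg_def mult_single plus_list_def word_inv_def zero_list_def)
qed

section \<open>The representations on the generators\<close>

lemma mat_alg_simps [simp]:
  "carrier (mat_alg d) = carrier_mat d d" "X \<otimes>\<^bsub>mat_alg d\<^esub> Y = X * Y" "\<one>\<^bsub>mat_alg d\<^esub> = 1\<^sub>m d"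
  "\<zero>\<^bsub>mat_alg d\<^esub> = 0\<^sub>m d d" "X \<oplus>\<^bsub>mat_alg d\<^esub> Y = X + Y" "c \<odot>\<^bsub>mat_alg d\<^esub> X = c \<cdot>\<^sub>m X"
  by (simp_all add: mat_alg_def)

lemma calg_mat_alg: "calg (mat_alg d)"
proof (rule calg.intro)
  show "ring (mat_alg d)"
  proof (rule ringI)
    show "abelian_group (mat_alg d)"
    proof (rule abelian_groupI)
      fix X assume "X \<in> carrier (mat_alg d)"
      then show "\<exists>Y\<in>carrier (mat_alg d). Y \<oplus>\<^bsub>mat_alg d\<^esub> X = \<zero>\<^bsub>mat_alg d\<^esub>"
        by (intro bexI[of _ "- X"]) auto
    qed (auto simp: comm_add_mat)
    show "monoid (mat_alg d)" by (rule monoidI) auto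
  qed (auto simp: add_mult_distrib_mat mult_add_distrib_mat)
  show "calg_axioms (mat_alg d)"
    by (rule calg_axioms.intro)
      (auto simp: add_smult_distrib_right_mat add_smult_distrib_left_mat 
        mult_smult_distrib intro!: eq_matI simp: algebra_simps)
qed

lemma mat_alg_minus:
  assumes "X \<in> carrier_mat d d" "Y \<in> carrier_mat d d"
  shows "X \<ominus>\<^bsub>mat_alg d\<^esub> Y = X - Y"
proof -
  interpret M: calg "mat_alg d" by (rule calg_mat_alg)
  have "\<ominus>\<^bsub>mat_alg d\<^esub> Y = - Y"
    by (rule M.minus_equality) (use assms in auto)
  then show ?thesis using assms by (simp add: a_minus_def add_uminus_minus_mat)
qed

lemma mult_mat_index:
  assumes "A \<in> carrier_mat n m" "B \<in> carrier_mat m l" "i < n" "j < l"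
  shows "(A * B) $$ (i, j) = (\<Sum>k<m. A $$ (i, k) * B $$ (k, j))"
  using assms by (simp add: scalar_prod_def atLeast0LessThan)

text \<open>
  The number \<open>[x]\<close> with deformation parameter \<open>\<lambda> = exp t\<close>; thus \<open>r\<^sub>j\<^sup>2 = [p] [N + 1 - p]\<close> for \<open>j = wt N p\<close>.
\<close>

definition qnum :: "real \<Rightarrow> real \<Rightarrow> real"
  where "qnum t x = (exp (t * x) - exp (- (t * x))) / (exp t - exp (- t))"

lemma qnum_0 [simp]: "qnum t 0 = 0"
  by (simp add: qnum_def)

lemma qnum_1 [simp]: "t > 0 \<Longrightarrow> qnum t 1 = 1"
  by (simp add: qnum_def)

lemma qnum_pos: "t > 0 \<Longrightarrow> x > 0 \<Longrightarrow> qnum t x > 0"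
proof -
  assume "t > 0" "x > 0"
  then have "- (t * x) < t * x" by (simp add: mult_pos_pos)
  then show ?thesis using \<open>t > 0\<close> by (simp add: qnum_def)
qed

lemma qnum_nonneg: "t > 0 \<Longrightarrow> x \<ge> 0 \<Longrightarrow> qnum t x \<ge> 0"
  using qnum_pos[of t x] by (cases "x = 0") auto

text \<open>The q-analogue of (x + 1) y - x (y + 1) = y - x: when the products are expanded, the
  exponentials of exponent x + y + 1 and its negative cancel. It sums the recursion for
  \<open>rsq\<close>.\<close>

lemma qnum_product_diff:
  assumes "t > 0"
  shows "qnum t (x + 1) * qnum t y - qnum t x * qnum t (y + 1) = qnum t (y - x)"
proof -
  define X Y L where "X = exp (t * x)" and "Y = exp (t * y)" and "L = exp t"
  have pos: "X > 0" "Y > 0" "L > 1" using assms by (auto simp: X_def Y_def L_def)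
  then have L: "L - 1 / L \<noteq> 0"    using pos less_trans[of "1 / L" 1 L] by simp
  have e: "qnum t x = (X - 1 / X) / (L - 1 / L)" "qnum t y = (Y - 1 / Y) / (L - 1 / L)"
    "qnum t (x + 1) = (X * L - 1 / (X * L)) / (L - 1 / L)"
    "qnum t (y + 1) = (Y * L - 1 / (Y * L)) / (L - 1 / L)"
    "qnum t (y - x) = (Y / X - X / Y) / (L - 1 / L)"
    by (simp_all add: qnum_def X_def Y_def L_def exp_add exp_diff exp_minus algebra_simps divide_inverse)
  have "(X * L - 1 / (X * L)) * (Y - 1 / Y) - (X - 1 / X) * (Y * L - 1 / (Y * L)) = (Y / X - X / Y) * (L - 1 / L)"
    using pos by (simp add: field_simps)
  moreover have "a / d * (b / d) - c / d * (b' / d) = g / d" if "a * b - c * b' = g * d" "d \<noteq> 0"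
    for a b c b' g d :: real
    using that by (simp add: divide_simps)
  ultimately show ?thesis
    unfolding e using L by blast
qed

lemma lam_powr: "lam t powr x = exp (t * x)"
  by (simp add: lam_def powr_def mult.commute)

lemma rsq_step:
  assumes "t > 0"
  shows "rsq t N (Suc p) - rsq t N p = qnum t (real N - 2 * real p)"
proof -
  have "rsq t N (Suc p) - rsq t N p =
    inverse (lam t - inverse (lam t)) * (lam t powr (2 * wt N p) - lam t powr (- 2 * wt N p))"
    by (simp only: rsq.simps add_diff_cancel_left')
  moreover have "t * (2 * wt N p) = t * (real N - 2 * real p)"
    "t * (- 2 * wt N p) = - (t * (real N - 2 * real p))"
    by (simp_all add: wt_def algebra_simps)
  ultimately have "rsq t N (Suc p) - rsq t N p = inverse (lam t - inverse (lam t)) *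
      (exp (t * (real N - 2 * real p)) - exp (- (t * (real N - 2 * real p))))"
    by (simp only: lam_powr)
  then show ?thesis
    by (simp only: qnum_def lam_def exp_minus divide_inverse mult.commute)
qed

text \<open>The step of the recursion is [N - 2p], which is \<open>qnum_product_diff\<close> at x =
  p and y = N - p. The closed form shows that \<open>rsq\<close> is nonnegative up to p = N + 1, so
  the square roots are genuine, and that it is symmetric under p to N + 1 - p.\<close>

lemma rsq_eq:
  assumes "t > 0"
  shows "rsq t N p = qnum t (real p) * qnum t (real N + 1 - real p)"
proof (induction p)
  case (Suc p)
  have "rsq t N (Suc p) = rsq t N p + qnum t (real N - 2 * real p)"
    using rsq_step[OF assms, of N p] by simp
  also have "\<dots> = qnum t (real p + 1) * qnum t (real N - real p)"
    using qnum_product_diff[OF assms, of "real p" "real N - real p"] Suc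
    by (simp add: algebra_simps)
  finally show ?case by (simp add: algebra_simps)
qed simp

lemma rsq_nonneg: "t > 0 \<Longrightarrow> p \<le> N + 1 \<Longrightarrow> rsq t N p \<ge> 0"
  by (simp add: rsq_eq qnum_nonneg del: rsq.simps)

lemma rcoef_eq:
  "t > 0 \<Longrightarrow> rcoef t N p = sqrt (qnum t (real p)) * sqrt (qnum t (real N + 1 - real p))"
  by (simp add: rcoef_def rsq_eq real_sqrt_mult del: rsq.simps)

lemma rcoef_pos: "t > 0 \<Longrightarrow> 0 < p \<Longrightarrow> p \<le> N \<Longrightarrow> rcoef t N p > 0"
  by (simp add: rcoef_eq qnum_pos)

lemma rcoef_0 [simp]: "t > 0 \<Longrightarrow> rcoef t N 0 = 0"
  and rcoef_last [simp]: "t > 0 \<Longrightarrow> rcoef t N (Suc N) = 0"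
  by (simp_all add: rcoef_eq)

lemma rcoef_sq: "t > 0 \<Longrightarrow> p \<le> N + 1 \<Longrightarrow> rcoef t N p * rcoef t N p = rsq t N p"
  by (simp add: rcoef_def rsq_nonneg del: rsq.simps)

lemma rcoef_sym: "t > 0 \<Longrightarrow> p + p' = N + 1 \<Longrightarrow> rcoef t N p = rcoef t N p'"
proof -
  assume "t > 0" and "p + p' = N + 1"
  then have e: "real N + 1 - real p = real p'" "real N + 1 - real p' = real p" by linarith+
  show ?thesis unfolding rcoef_eq[OF \<open>t > 0\<close>] e by (rule mult.commute)
qed

declare rsq.simps [simp del]

lemma rep_gen_carrier [simp, intro]: "rep_gen t N g \<in> carrier_mat (Suc N) (Suc N)"
  by (cases g) auto

lemma rep_gen_dim [simp]: "dim_row (rep_gen t N g) = Suc N" "dim_col (rep_gen t N g) = Suc N"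
  by (cases g; simp)+

lemma rep_gen_index:
  assumes "i < Suc N" "j < Suc N"
  shows "rep_gen t N Gen_q $$ (i, j) = (if j = i then complex_of_real (exp (t * wt N i)) else 0)"
    and "rep_gen t N Gen_qi $$ (i, j) = (if j = i then complex_of_real (exp (- (t * wt N i))) else 0)"
    and "rep_gen t N Gen_e $$ (i, j) = (if j = Suc i then complex_of_real (rcoef t N (Suc i)) else 0)"
    and "rep_gen t N Gen_f $$ (i, j) = (if i = Suc j then complex_of_real (rcoef t N i) else 0)"
  using assms by (auto simp: lam_powr)

declare rep_gen.simps [simp del]

lemma sum_delta_times:
  "(\<Sum>k<n. (if k = a then c else 0) * f k) = (if a < n then c * f a else (0 :: complex))"
  for n :: nat
proof -
  have "(\<Sum>k<n. (if k = a then c else 0) * f k) = (\<Sum>k<n. if k = a then c * f a else 0)"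
    by (rule sum.cong) auto
  then show ?thesis by (simp add: sum.delta)
qed

text \<open>Each row of a generator has at most one nonzero entry, so multiplying by it rescales a
  row of X. As the index counts down from the highest weight, \<open>Gen_e\<close> fetches row i + 1
  and \<open>Gen_f\<close> row i - 1.\<close>

lemma rep_gen_mult_left:
  assumes X: "X \<in> carrier_mat (Suc N) m" and ij: "i < Suc N" "j < m"
  shows "(rep_gen t N Gen_q * X) $$ (i, j) = complex_of_real (exp (t * wt N i)) * X $$ (i, j)"
    and "(rep_gen t N Gen_qi * X) $$ (i, j) = complex_of_real (exp (- (t * wt N i))) * X $$ (i, j)"
    and "(rep_gen t N Gen_e * X) $$ (i, j) =
      (if Suc i \<le> N then complex_of_real (rcoef t N (Suc i)) * X $$ (Suc i, j) else 0)"
    and "(rep_gen t N Gen_f * X) $$ (i, j) =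
      (if i = 0 then 0 else complex_of_real (rcoef t N i) * X $$ (i - 1, j))"
proof -
  note m = mult_mat_index[OF rep_gen_carrier X ij]
  have s: "(rep_gen t N g * X) $$ (i, j) = (if a < Suc N then c * X $$ (a, j) else 0)"
    if "\<And>k. k < Suc N \<Longrightarrow> rep_gen t N g $$ (i, k) = (if k = a then c else 0)" for g a c
    unfolding m by (subst sum_delta_times[symmetric], rule sum.cong) (simp_all add: that)
  show "(rep_gen t N Gen_q * X) $$ (i, j) = complex_of_real (exp (t * wt N i)) * X $$ (i, j)"
    using ij by (subst s[of _ i "complex_of_real (exp (t * wt N i))"]) (simp_all add: rep_gen_index)
  show "(rep_gen t N Gen_qi * X) $$ (i, j) = complex_of_real (exp (- (t * wt N i))) * X $$ (i, j)"
    using ij by (subst s[of _ i "complex_of_real (exp (- (t * wt N i)))"]) (simp_all add: rep_gen_index)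
  show "(rep_gen t N Gen_e * X) $$ (i, j) =
      (if Suc i \<le> N then complex_of_real (rcoef t N (Suc i)) * X $$ (Suc i, j) else 0)"
    using ij by (subst s[of _ "Suc i"]) (auto simp: rep_gen_index)
  show "(rep_gen t N Gen_f * X) $$ (i, j) =
      (if i = 0 then 0 else complex_of_real (rcoef t N i) * X $$ (i - 1, j))"
    using ij by (subst s[of _ "i - 1" "if i = 0 then 0 else complex_of_real (rcoef t N i)"])
      (auto simp: rep_gen_index)
qed

section \<open>The relations of \<open>\<AA>\<^sub>t\<close>\<close>

lemma adj_free_alg:
  assumes "\<And>g. s (s g) = g"
  shows "adj (free_alg s) (x + y) = adj (free_alg s) x + adj (free_alg s) y"
    and "adj (free_alg s) (x - y) = adj (free_alg s) x - adj (free_alg s) y"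
    and "adj (free_alg s) (- x) = - adj (free_alg s) x"
    and "adj (free_alg s) (x * y) = adj (free_alg s) y * adj (free_alg s) x"
    and "adj (free_alg s) (scalar c) = scalar (cnj c)"
    and "adj (free_alg s) 1 = 1"
    and "adj (free_alg s) 0 = 0"
    and "adj (free_alg s) (letter g) = letter (s g)"
    and "adj (free_alg s) (adj (free_alg s) x) = x"
proof -
  interpret A: alg_map "conj_opposite (free_alg s)" "adj (free_alg s)"
    by (rule alg_map_adj_free_alg) (rule assms)
  show add: "adj (free_alg s) (x + y) = adj (free_alg s) x + adj (free_alg s) y" for x y
    using A.map_add by (simp add: free_alg_def)
  show mult: "adj (free_alg s) (x * y) = adj (free_alg s) y * adj (free_alg s) x" for x y
    using A.map_mult by (simp add: free_alg_def)
  show scalar: "adj (free_alg s) (scalar c) = scalar (cnj c)" for c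
    using A.map_scalar by (simp add: free_alg_def)
  show zero: "adj (free_alg s) 0 = 0"
    using A.map_zero by (simp add: free_alg_def)
  show "adj (free_alg s) 1 = 1"
    using A.map_one by (simp add: free_alg_def)
  show minus: "adj (free_alg s) (- x) = - adj (free_alg s) x" for x
    using add[of x "- x"] zero by (simp add: eq_neg_iff_add_eq_0 add.commute)
  show "adj (free_alg s) (x - y) = adj (free_alg s) x - adj (free_alg s) y"
    using add[of x "- y"] minus[of y] by simp
  show letter: "adj (free_alg s) (letter g) = letter (s g)" for g
    by (simp add: free_alg_def monoid_alg_def letter_def word_inv_def)
  show "adj (free_alg s) (adj (free_alg s) x) = x"
    by (induction x rule: free_alg_induct)
      (simp_all add: add mult scalar letter assms)
qed

text \<open>The elements whose adjoint lies in the ideal form an ideal again, and it contains the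
  generators because the generating set is closed under the involution.\<close>

lemma rel_ideal_adj:
  assumes s: "\<And>g. s (s g) = g" and x: "x \<in> rel_ideal s R"
  shows "adj (free_alg s) x \<in> rel_ideal s R"
proof -
  interpret J: alg_ideal "rel_ideal s R" "word_inv s" by (rule alg_ideal_rel_ideal)

  note adj = adj_free_alg[of s, OF s]
  have J0: "0 \<in> rel_ideal s R" and Ja: "\<And>x y. x \<in> rel_ideal s R \<Longrightarrow> y \<in> rel_ideal s R \<Longrightarrow> x + y \<in> rel_ideal s R"
    using additive_subgroup.zero_closed[OF J.is_additive_subgroup]
      additive_subgroup.a_closed[OF J.is_additive_subgroup] by auto
  have "ideal {x. adj (free_alg s) x \<in> rel_ideal s R} (monoid_alg (word_inv s))"
  proof (rule idealI)
    show "subgroup {x. adj (free_alg s) x \<in> rel_ideal s R} (add_monoid (monoid_alg (word_inv s)))"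
      using J.add.group_axioms
      by (rule group.subgroupI)
        (auto simp: adj J0 intro: exI[of _ 0] Ja, auto simp: adj J.J_minus monoid_alg_a_inv[unfolded a_inv_def, simplified])
  qed (use J.I_l_closed J.I_r_closed in \<open>auto simp: adj J.ring_axioms\<close>)
  moreover have "R \<union> adj (free_alg s) ` R \<subseteq> rel_ideal s R"
    using genideal_self[of _ "R \<union> adj (free_alg s) ` R" "word_inv s"]
    by (auto simp: rel_ideal_def free_alg_def)
  then have "R \<union> adj (free_alg s) ` R \<subseteq> {x. adj (free_alg s) x \<in> rel_ideal s R}"
    by (auto simp: adj)
  ultimately show ?thesis
    using genideal_le[of "{x. adj (free_alg s) x \<in> rel_ideal s R}" "word_inv s"
        "R \<union> adj (free_alg s) ` R" x, OF alg_ideal.intro]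
      x[unfolded rel_ideal_def] by (simp add: free_alg_def)
qed

abbreviation "uJ t \<equiv> rel_ideal ugen_star (urels t)"
abbreviation "lc t \<equiv> complex_of_real (lam t)"
abbreviation "uc t \<equiv> inverse (lc t - inverse (lc t))"

lemma ugen_star_star [simp]: "ugen_star (ugen_star g) = g"
  by (cases g) auto

lemma lam_pos [simp]: "lam t > 0" "lam t \<noteq> 0"
  by (simp_all add: lam_def)

text \<open>The adjoint of the q-e relation is a scalar multiple of the q-f relation and vice versa;
  the two inverse relations are swapped, and the e-f relation is self-adjoint since its coefficient
  is real.\<close>

lemma uJ_least:
  assumes K: "alg_ideal K (word_inv ugen_star)" and R: "urels t \<subseteq> K" and x: "x \<in> uJ t"
  shows "x \<in> K"
proof -
  interpret K: alg_ideal K "word_inv ugen_star" by fact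
  let ?q = "letter Gen_q" and ?qi = "letter Gen_qi" and ?e = "letter Gen_e" and ?f = "letter Gen_f"
  note adj = adj_free_alg[of ugen_star, OF ugen_star_star]
  have sc: "scalar (- a) * (x * y - scalar b * y * x) = y * x - x * (y * scalar a)"
    if "a * b = 1" for a b and x y :: "ugen list \<Rightarrow>\<^sub>0 complex"
  proof -
    have "x * (y * scalar a) = scalar a * (x * y)"
      by (metis mult.assoc scalar_central)
    moreover have "scalar a * (scalar b * y * x) = y * x"
      using that by (simp add: mult.assoc[symmetric] flip: scalar_mult)
    ultimately show ?thesis by (simp add: scalar_uminus right_diff_distrib)
  qed
  have 1: "?f * ?q - ?q * (?f * scalar (lc t)) \<in> K"
  proof -
    have "?q * ?f - scalar (inverse (lc t)) * ?f * ?q \<in> K" using R by (simp add: urels_def Let_def)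
    then have "scalar (- lc t) * (?q * ?f - scalar (inverse (lc t)) * ?f * ?q) \<in> K" by (rule K.J_scalar)
    then show ?thesis by (subst (asm) sc) simp_all
  qed
  have 2: "?e * ?q - ?q * (?e * scalar (inverse (lc t))) \<in> K"
  proof -
    have "?q * ?e - scalar (lc t) * ?e * ?q \<in> K" using R by (simp add: urels_def Let_def)
    then have "scalar (- inverse (lc t)) * (?q * ?e - scalar (lc t) * ?e * ?q) \<in> K" by (rule K.J_scalar)
    then show ?thesis by (subst (asm) sc) simp_all
  qed
  have "adj (free_alg ugen_star) ` urels t \<subseteq> K"
    using R 1 2 by (simp add: urels_def Let_def adj scalar_central[of "uc t"])
  then show ?thesis
    using genideal_le[OF K _ x[unfolded rel_ideal_def free_alg_def]] R by (auto simp: free_alg_def)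
qed

text \<open>
  The adjoints of the relations need not be listed: they lie in the ideal generated by the relations themselves.
\<close>

locale urep = alg_map T h for T :: "('a, 'm) star_algebra_scheme" (structure)
    and h :: "(ugen list \<Rightarrow>\<^sub>0 complex) \<Rightarrow> 'a" +
  fixes t :: real
  assumes q_qi: "h (letter Gen_q * letter Gen_qi) = h 1"
    and qi_q: "h (letter Gen_qi * letter Gen_q) = h 1"
    and q_e: "h (letter Gen_q * letter Gen_e) = h (scalar (lc t) * (letter Gen_e * letter Gen_q))"
    and q_f: "h (letter Gen_q * letter Gen_f) = h (scalar (inverse (lc t)) * (letter Gen_f * letter Gen_q))"
    and e_f: "h (letter Gen_e * letter Gen_f) = h (letter Gen_f * letter Gen_e +
      scalar (uc t) * (letter Gen_q * letter Gen_q - letter Gen_qi * letter Gen_qi))"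
begin

lemma kills_uJ: "x \<in> uJ t \<Longrightarrow> h x = \<zero>"
proof -
  have k: "h (x - y) = \<zero>" if "h x = h y" for x y
    using that by (simp add: map_diff diff_eq_zero_iff)
  have "urels t \<subseteq> {x. h x = \<zero>}"
    using k[OF q_qi] k[OF qi_q] k[OF q_e] k[OF q_f] k[OF e_f]
    by (simp add: urels_def Let_def mult.assoc diff_diff_add)
  then show "x \<in> uJ t \<Longrightarrow> h x = \<zero>"
    using uJ_least[OF ideal_kernel] by blast
qed

text \<open>Multiply q x = c x q by the inverse of q on both sides. The commutation of
  \<open>Gen_qi\<close> with e and f, absent from \<open>urels\<close>, comes from here.\<close>

lemma qi_commute:
  assumes x: "h (letter Gen_q * x) = h (scalar c * (x * letter Gen_q))" and c: "c \<noteq> 0"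
  shows "h (x * letter Gen_qi) = h (scalar c * (letter Gen_qi * x))"
proof -
  let ?q = "letter Gen_q" and ?qi = "letter Gen_qi"
  have "h (?qi * (?q * x) * ?qi) = h (?qi * (scalar c * (x * ?q)) * ?qi)"
    using x by (simp only: map_mult)
  also have "?qi * (scalar c * (x * ?q)) * ?qi = scalar c * (?qi * (x * (?q * ?qi)))"
    by (simp add: mult.assoc scalar_left_commute)
  also have "h \<dots> = h (scalar c * (?qi * x))"
    using q_qi by (simp add: map_mult)
  also have "h (?qi * (?q * x) * ?qi) = h (x * ?qi)"
    using qi_q by (simp add: map_mult flip: m_assoc)
  finally show ?thesis .
qed

lemma on_coset: "the_elem (h ` (uJ t +>\<^bsub>monoid_alg (word_inv ugen_star)\<^esub> x)) = h x"
  by (rule presented_hom_eq[OF alg_ideal_rel_ideal kills_uJ])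

end


abbreviation "uproj t x \<equiv> uJ t +>\<^bsub>monoid_alg (word_inv ugen_star)\<^esub> x"

lemma urep_uproj: "urep (Ualg t) (uproj t) t"
proof -
  interpret J: alg_ideal "uJ t" "word_inv ugen_star" by (rule alg_ideal_rel_ideal)
  have J: "x \<in> urels t \<Longrightarrow> x \<in> uJ t" for x
    using genideal_self[of x "urels t \<union> adj (free_alg ugen_star) ` urels t" "word_inv ugen_star"]
    by (simp add: rel_ideal_def free_alg_def)
  show ?thesis
    unfolding Ualg_def presented_alg_def free_alg_def
    by (rule urep.intro[OF J.proj.alg_map_axioms], rule urep_axioms.intro; subst J.proj_eq_iff; rule J)
      (simp_all add: urels_def Let_def mult.assoc diff_diff_add)
qed

section \<open>Tensor products of elements of free algebras\<close>

lemma lookup_free_tensor: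
  "Poly_Mapping.lookup (free_tensor x y) (u, v) = Poly_Mapping.lookup x u * Poly_Mapping.lookup y v"
proof -
  have "Poly_Mapping.lookup (free_tensor x y) (u, v) =
    (\<Sum>u'\<in>Poly_Mapping.keys x. \<Sum>v'\<in>Poly_Mapping.keys y.
      if v' = v then if u' = u then Poly_Mapping.lookup x u' * Poly_Mapping.lookup y v' else 0 else 0)"
    unfolding free_tensor_def lookup_sum
    by (intro sum.cong refl) (auto simp: lookup_single when_def)
  also have "\<dots> = (\<Sum>u'\<in>Poly_Mapping.keys x.
      if u' = u then Poly_Mapping.lookup x u' * Poly_Mapping.lookup y v else 0)"
    by (intro sum.cong refl) (auto simp: sum.delta in_keys_iff)
  also have "\<dots> = Poly_Mapping.lookup x u * Poly_Mapping.lookup y v"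
    by (auto simp: sum.delta in_keys_iff)
  finally show ?thesis .
qed

lemma free_tensor_add:
  "free_tensor (x + x') y = free_tensor x y + free_tensor x' y"
  "free_tensor x (y + y') = free_tensor x y + free_tensor x y'"
  by (rule poly_mapping_eqI, clarsimp simp: lookup_free_tensor lookup_add algebra_simps)+

lemma free_tensor_diff:
  "free_tensor (x - x') y = free_tensor x y - free_tensor x' y"
  "free_tensor x (y - y') = free_tensor x y - free_tensor x y'"
  by (rule poly_mapping_eqI, clarsimp simp: lookup_free_tensor lookup_minus algebra_simps)+

lemma free_tensor_single:
  "free_tensor (Poly_Mapping.single u a) (Poly_Mapping.single v b) = Poly_Mapping.single (u, v) (a * b)"
  by (rule poly_mapping_eqI) (auto simp: lookup_free_tensor lookup_single when_def split: if_splits)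

lemma free_tensor_mult:
  "free_tensor x y * free_tensor x' y' = free_tensor (x * x') (y * y')"
proof (induction x rule: poly_mapping_add_induct)
  case (single u a)
  show ?case
  proof (induction x' rule: poly_mapping_add_induct)
    case (single u' a')
    show ?case
    proof (induction y rule: poly_mapping_add_induct)
      case (single v b)
      show ?case
        by (induction y' rule: poly_mapping_add_induct)
          (simp_all add: free_tensor_single free_tensor_add mult_single distrib_left distrib_right ac_simps)
    qed (simp add: free_tensor_add distrib_left distrib_right)
  qed (simp add: free_tensor_add distrib_left distrib_right)
qed (simp add: free_tensor_add distrib_left distrib_right)

lemma free_tensor_scalar:
  "free_tensor (scalar c) (scalar d) = scalar (c * d)"
  by (simp add: scalar_def free_tensor_single zero_prod_def)

lemma free_tensor_one [simp]: "free_tensor 1 1 = 1"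
  using free_tensor_scalar[of 1 1] by simp

lemma free_tensor_smult:
  "free_tensor (scalar c * x) y = scalar c * free_tensor x y"
  "free_tensor x (scalar c * y) = scalar c * free_tensor x y"
  using free_tensor_mult[of "scalar c" 1 x y] free_tensor_mult[of 1 "scalar c" x y]
    free_tensor_scalar[of c 1] free_tensor_scalar[of 1 c] by (metis mult_1 mult_1_right scalar_simps(1))+

abbreviation "tJ t \<equiv> tensor_ideal ugen_star (urels t)"
abbreviation "tproj t x \<equiv> tJ t +>\<^bsub>monoid_alg (map_prod (word_inv ugen_star) (word_inv ugen_star))\<^esub> x"

lemma alg_map_tproj: "alg_map (Ualg2 t) (tproj t)"
proof -
  interpret J: alg_ideal "tJ t" "map_prod (word_inv ugen_star) (word_inv ugen_star)"
    by (rule alg_ideal_tensor_ideal)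
  show ?thesis unfolding Ualg2_def tensor_square_alg_def by (rule J.proj.alg_map_axioms)
qed

text \<open>Write the difference as (x - x') \<otimes> y + x' \<otimes> (y - y'); each summand lies
  in \<open>tensor_ideal\<close>. The relations of \<AA> may then be used in either leg.\<close>

lemma tproj_cong:
  assumes "uproj t x = uproj t x'" "uproj t y = uproj t y'"
  shows "tproj t (free_tensor x y) = tproj t (free_tensor x' y')"
proof -
  interpret U: alg_ideal "uJ t" "word_inv ugen_star" by (rule alg_ideal_rel_ideal)
  interpret J: alg_ideal "tJ t" "map_prod (word_inv ugen_star) (word_inv ugen_star)"
    by (rule alg_ideal_tensor_ideal)
  have g: "free_tensor z 1 \<in> tJ t" "free_tensor 1 z \<in> tJ t" if "z \<in> uJ t" for z
    unfolding tensor_ideal_def using that by (auto intro!: genideal_self)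
  have "free_tensor (x - x') 1 * free_tensor 1 y \<in> tJ t"
    using assms(1) J.I_r_closed g(1) by (simp add: U.proj_eq_iff)
  moreover have "free_tensor x' 1 * free_tensor 1 (y - y') \<in> tJ t"
    using assms(2) J.I_l_closed g(2) by (simp add: U.proj_eq_iff)
  ultimately have "free_tensor (x - x') y + free_tensor x' (y - y') \<in> tJ t"
    using additive_subgroup.a_closed[OF J.is_additive_subgroup] by (simp add: free_tensor_mult)
  then show ?thesis
    by (simp add: J.proj_eq_iff free_tensor_diff)
qed

text \<open>
  Everything is lifted to free algebras: \<open>uproj\<close> and \<open>tproj\<close> are the quotient maps onto \<open>\<AA>\<^sub>t\<close> and
  \<open>\<AA>\<^sub>t \<otimes> \<AA>\<^sub>t\<close>, and \<open>urho t N\<close>, \<open>ucop\<close>, \<open>uant\<close>, \<open>utens t N M\<close> lift \<open>\<pi>\<^sub>N\<^sub>/\<^sub>2\<close>, the coproduct, the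
  antipode and \<open>\<pi>\<^sub>N\<^sub>/\<^sub>2 \<otimes> \<pi>\<^sub>M\<^sub>/\<^sub>2\<close>.
\<close>

abbreviation "urho t N \<equiv> free_eval (mat_alg (Suc N)) (rep_gen t N)"

lemma alg_map_urho: "alg_map (mat_alg (Suc N)) (urho t N)"
  and urho_letter: "urho t N (letter g) = rep_gen t N g"
  using calg.alg_map_free_eval[OF calg_mat_alg, of "rep_gen t N" "Suc N"]
    calg.free_eval_letter[OF calg_mat_alg, of "rep_gen t N" "Suc N" g] by simp_all

lemma urep_urho:
  assumes t: "t > 0"
  shows "urep (mat_alg (Suc N)) (urho t N) t"
proof (rule urep.intro[OF alg_map_urho], rule urep_axioms.intro)
  interpret R: alg_map "mat_alg (Suc N)" "urho t N" by (rule alg_map_urho)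
  let ?g = "rep_gen t N"
  have hm [simp]: "urho t N (letter a * letter b) = rep_gen t N a * rep_gen t N b" for a b
    by (simp add: R.map_mult urho_letter)
  have M [simp]: "rep_gen t N a * rep_gen t N b \<in> carrier_mat (Suc N) (Suc N)" for a b
    by (rule mult_carrier_mat) auto
  note [simp] = R.map_add R.map_diff R.map_smult mat_alg_minus
  have lexp: "lc t = complex_of_real (exp t)" by (simp add: lam_def)

  note ix = rep_gen_mult_left[OF rep_gen_carrier] rep_gen_index
  have e: "exp (t * wt N i) = exp t * exp (t * wt N (Suc i))" for i
    by (simp add: wt_def algebra_simps flip: exp_add)
  show "urho t N (letter Gen_q * letter Gen_qi) = urho t N 1"
    "urho t N (letter Gen_qi * letter Gen_q) = urho t N 1"
    by (auto intro!: eq_matI simp: ix simp flip: of_real_mult exp_add simp del: index_mult_mat(1))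
  show "urho t N (letter Gen_q * letter Gen_e) = urho t N (scalar (lc t) * (letter Gen_e * letter Gen_q))"
  proof (rule eq_matI)
    fix i j assume "i < dim_row (urho t N (scalar (lc t) * (letter Gen_e * letter Gen_q)))"
      "j < dim_col (urho t N (scalar (lc t) * (letter Gen_e * letter Gen_q)))"
    then have ij: "i < Suc N" "j < Suc N" by simp_all
    show "urho t N (letter Gen_q * letter Gen_e) $$ (i, j) =
      urho t N (scalar (lc t) * (letter Gen_e * letter Gen_q)) $$ (i, j)"
      using ij e[of i] by (auto simp: ix lexp simp del: index_mult_mat(1))
  qed simp_all
  show "urho t N (letter Gen_q * letter Gen_f) = urho t N (scalar (inverse (lc t)) * (letter Gen_f * letter Gen_q))"
  proof (rule eq_matI)
    fix i j assume "i < dim_row (urho t N (scalar (inverse (lc t)) * (letter Gen_f * letter Gen_q)))"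
      "j < dim_col (urho t N (scalar (inverse (lc t)) * (letter Gen_f * letter Gen_q)))"
    then have ij: "i < Suc N" "j < Suc N" by simp_all
    show "urho t N (letter Gen_q * letter Gen_f) $$ (i, j) =
      urho t N (scalar (inverse (lc t)) * (letter Gen_f * letter Gen_q)) $$ (i, j)"
      using ij e[of "i - 1"]
      by (cases i) (auto simp: ix lexp simp del: index_mult_mat(1))
  qed simp_all
  show "urho t N (letter Gen_e * letter Gen_f) = urho t N (letter Gen_f * letter Gen_e +
      scalar (uc t) * (letter Gen_q * letter Gen_q - letter Gen_qi * letter Gen_qi))"
  proof -
    \<comment> \<open>Both e f and f e are diagonal, with entries the squares of
      \<open>rcoef\<close> at Suc i and at i; the relation is the defining recursion of
      \<open>rsq\<close> in disguise.\<close>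
    have "rcoef t N (Suc i) * rcoef t N (Suc i) = rcoef t N i * rcoef t N i +
      inverse (exp t - inverse (exp t)) *
      (exp (t * wt N i) * exp (t * wt N i) - exp (- (t * wt N i)) * exp (- (t * wt N i)))"
      if "i < Suc N" for i
    proof -
      have "lam t powr (2 * wt N i) = exp (t * wt N i) * exp (t * wt N i)"
        "lam t powr (- 2 * wt N i) = exp (- (t * wt N i)) * exp (- (t * wt N i))"
        unfolding lam_powr exp_add[symmetric] by (rule arg_cong[where f = exp], simp add: algebra_simps)+
      moreover have "rcoef t N i * rcoef t N i = rsq t N i"
        "rcoef t N (Suc i) * rcoef t N (Suc i) = rsq t N (Suc i)"
        using that by (auto intro!: rcoef_sq[OF t])
      ultimately show ?thesis
        by (simp only: rsq.simps(2) lam_def)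
    qed
    note * = this[THEN arg_cong[where f = complex_of_real]]
    have **: "complex_of_real (rcoef t N (Suc i)) * complex_of_real (rcoef t N (Suc i)) =
      complex_of_real (rcoef t N i) * complex_of_real (rcoef t N i) +
      inverse (complex_of_real (exp t) - inverse (complex_of_real (exp t))) *
      (complex_of_real (exp (t * wt N i)) * complex_of_real (exp (t * wt N i)) -
        complex_of_real (exp (- (t * wt N i))) * complex_of_real (exp (- (t * wt N i))))"
      if "i < Suc N" for i
      using *[OF that] by (simp only: of_real_mult of_real_add of_real_diff of_real_inverse)
    \<comment> \<open>In the last row the product is 0 because no row follows; this agrees with
      \<open>rcoef_last\<close>.\<close>
    have ef: "(rep_gen t N Gen_e * rep_gen t N Gen_f) $$ (i, j) =
        (if i = j then complex_of_real (rcoef t N (Suc i)) * complex_of_real (rcoef t N (Suc i)) else 0)"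
      if "i < Suc N" "j < Suc N" for i j
      using that t by (cases "i = N") (auto simp: ix simp del: index_mult_mat(1))
    have fe: "(rep_gen t N Gen_f * rep_gen t N Gen_e) $$ (i, j) =
        (if i = j then complex_of_real (rcoef t N i) * complex_of_real (rcoef t N i) else 0)"
      if "i < Suc N" "j < Suc N" for i j
      using that t by (cases i) (auto simp: ix simp del: index_mult_mat(1))
    have qq: "(rep_gen t N g * rep_gen t N g) $$ (i, j) = (if i = j then rep_gen t N g $$ (i, i) * rep_gen t N g $$ (i, i) else 0)"
      if "i < Suc N" "j < Suc N" "g = Gen_q \<or> g = Gen_qi" for i j g
      using that by (auto simp: ix simp del: index_mult_mat(1))
    show ?thesis
      by (rule eq_matI) (simp_all add: rep_gen_index lexp ef fe qq ** del: index_mult_mat(1))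
  qed
qed

lemma rep_uproj:
  assumes "t > 0"
  shows "rep t N (uproj t x) = urho t N x"
  using urep.on_coset[OF urep_urho[OF assms], of N x] by (simp add: rep_def presented_hom_def)

lemma Ualg_carrier: "carrier (Ualg t) = range (uproj t)"
  unfolding Ualg_def presented_alg_def free_alg_def
  by (rule alg_ideal.carrier_Q[OF alg_ideal_rel_ideal])

section \<open>The coproduct on the free algebra\<close>

abbreviation "tstar \<equiv> map_prod (word_inv ugen_star) (word_inv ugen_star)"

definition ucop :: "(ugen list \<Rightarrow>\<^sub>0 complex) \<Rightarrow> (ugen list \<times> ugen list \<Rightarrow>\<^sub>0 complex)"
  where "ucop = free_eval (monoid_alg tstar) ucoprod_gen"

lemma alg_map_ucop: "alg_map (monoid_alg tstar) ucop"
  and ucop_letter: "ucop (letter g) = ucoprod_gen g"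
  unfolding ucop_def
  using calg.alg_map_free_eval[OF calg_monoid_alg, of ucoprod_gen tstar]
    calg.free_eval_letter[OF calg_monoid_alg, of ucoprod_gen tstar g] by simp_all

lemma ucop_simps:
  "ucop (x + y) = ucop x + ucop y" "ucop (x - y) = ucop x - ucop y" "ucop (x * y) = ucop x * ucop y"
  "ucop (scalar c) = scalar c" "ucop 1 = 1"
proof -
  interpret C: alg_map "monoid_alg tstar" ucop by (rule alg_map_ucop)
  show "ucop (x + y) = ucop x + ucop y" "ucop (x - y) = ucop x - ucop y" "ucop (x * y) = ucop x * ucop y"
    "ucop (scalar c) = scalar c" "ucop 1 = 1"
    using C.map_add C.map_diff C.map_mult C.map_scalar C.map_one by simp_all
qed

lemma alg_map_comp:
  assumes "alg_map (monoid_alg s) h" "alg_map T k"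
  shows "alg_map T (\<lambda>x. k (h x))"
proof -
  interpret h: alg_map "monoid_alg s" h by fact
  interpret k: alg_map T k by fact
  show ?thesis
    by (rule alg_map.intro[OF k.calg_axioms], rule alg_map_axioms.intro)
      (use h.map_add h.map_mult h.map_scalar k.map_add k.map_mult k.map_scalar in simp_all)
qed

lemma uproj_relations:
  "uproj t (letter Gen_q * letter Gen_qi) = uproj t 1"
  "uproj t (letter Gen_qi * letter Gen_q) = uproj t 1"
  "uproj t (letter Gen_q * letter Gen_e) = uproj t (scalar (lc t) * (letter Gen_e * letter Gen_q))"
  "uproj t (letter Gen_q * letter Gen_f) = uproj t (scalar (inverse (lc t)) * (letter Gen_f * letter Gen_q))"
  "uproj t (letter Gen_e * letter Gen_f) = uproj t (letter Gen_f * letter Gen_e +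
      scalar (uc t) * (letter Gen_q * letter Gen_q - letter Gen_qi * letter Gen_qi))"
  "uproj t (letter Gen_e * letter Gen_qi) = uproj t (scalar (lc t) * (letter Gen_qi * letter Gen_e))"
  "uproj t (letter Gen_f * letter Gen_qi) = uproj t (scalar (inverse (lc t)) * (letter Gen_qi * letter Gen_f))"
proof -
  interpret U: urep "Ualg t" "uproj t" t by (rule urep_uproj)
  show "uproj t (letter Gen_q * letter Gen_qi) = uproj t 1"
  "uproj t (letter Gen_qi * letter Gen_q) = uproj t 1"
  "uproj t (letter Gen_q * letter Gen_e) = uproj t (scalar (lc t) * (letter Gen_e * letter Gen_q))"
  "uproj t (letter Gen_q * letter Gen_f) = uproj t (scalar (inverse (lc t)) * (letter Gen_f * letter Gen_q))"
  "uproj t (letter Gen_e * letter Gen_f) = uproj t (letter Gen_f * letter Gen_e +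
      scalar (uc t) * (letter Gen_q * letter Gen_q - letter Gen_qi * letter Gen_qi))"
    by (rule U.q_qi U.qi_q U.q_e U.q_f U.e_f)+
  show "uproj t (letter Gen_e * letter Gen_qi) = uproj t (scalar (lc t) * (letter Gen_qi * letter Gen_e))"
    by (rule U.qi_commute[OF U.q_e]) simp
  show "uproj t (letter Gen_f * letter Gen_qi) = uproj t (scalar (inverse (lc t)) * (letter Gen_qi * letter Gen_f))"
    by (rule U.qi_commute[OF U.q_f]) simp
qed

lemma uproj_scalar_cong: "uproj t x = uproj t y \<Longrightarrow> uproj t (scalar c * x) = uproj t (scalar c * y)"
  using alg_map.map_smult[OF urep.axioms(1)[OF urep_uproj]] by metis

lemma uproj_scalar_flip:
  assumes "uproj t x = uproj t (scalar c * y)" "c \<noteq> 0"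
  shows "uproj t y = uproj t (scalar (inverse c) * x)"
proof -
  have "uproj t (scalar (inverse c) * x) = uproj t (scalar (inverse c) * (scalar c * y))"
    by (rule uproj_scalar_cong) (rule assms)
  also have "scalar (inverse c) * (scalar c * y) = y"
    using assms(2) by (simp add: mult.assoc[symmetric] flip: scalar_mult)
  finally show ?thesis ..
qed

lemma tproj_add_cong:
  assumes "tproj t x = tproj t x'" "tproj t y = tproj t y'"
  shows "tproj t (x + y) = tproj t (x' + y')"
  using assms alg_map.map_add[OF alg_map_tproj] by metis

lemma urep_ucop: "urep (Ualg2 t) (\<lambda>x. tproj t (ucop x)) t"
proof (rule urep.intro[OF alg_map_comp[OF alg_map_ucop alg_map_tproj]], rule urep_axioms.intro)
  let ?q = "letter Gen_q" and ?qi = "letter Gen_qi" and ?e = "letter Gen_e" and ?f = "letter Gen_f"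
  note rel = uproj_relations[of t]
  note [simp] = ucop_simps ucop_letter free_tensor_mult
  have ll: "scalar (lc t) * (scalar (inverse (lc t)) * x) = x" "scalar (inverse (lc t)) * (scalar (lc t) * x) = x"
    for x :: "'w::monoid_add \<Rightarrow>\<^sub>0 complex"
    by (simp_all add: mult.assoc[symmetric] flip: scalar_mult)
  show "tproj t (ucop (?q * ?qi)) = tproj t (ucop 1)" "tproj t (ucop (?qi * ?q)) = tproj t (ucop 1)"
    using tproj_cong[OF rel(1) rel(1)] tproj_cong[OF rel(2) rel(2)] by simp_all
  have qqi: "uproj t (?q * ?qi) = uproj t (?qi * ?q)"
    using rel(1,2) by simp
  have 1: "tproj t (free_tensor (?q * ?q) (?q * x) + free_tensor (?q * x) (?q * ?qi)) =
      tproj t (scalar c * (free_tensor (?q * ?q) (x * ?q) + free_tensor (x * ?q) (?qi * ?q)))"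
    if "uproj t (?q * x) = uproj t (scalar c * (x * ?q))" for x c
    using tproj_add_cong[OF tproj_cong[OF refl that] tproj_cong[OF that qqi]]
    by (simp add: free_tensor_smult distrib_left)
  show "tproj t (ucop (?q * ?e)) = tproj t (ucop (scalar (lc t) * (?e * ?q)))"
    using 1[OF rel(3)] by (simp add: distrib_left distrib_right)
  show "tproj t (ucop (?q * ?f)) = tproj t (ucop (scalar (inverse (lc t)) * (?f * ?q)))"
    using 1[OF rel(4)] by (simp add: distrib_left distrib_right)
  show "tproj t (ucop (?e * ?f)) = tproj t (ucop (?f * ?e + scalar (uc t) * (?q * ?q - ?qi * ?qi)))"
  proof -
    \<comment> \<open>These are the four terms of \<Delta>(e) \<Delta>(f). In the mixed terms,
      reordering one leg costs a factor inverse to \<lambda> and reordering the other gives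
      \<lambda>, so they become the mixed terms of \<Delta>(f) \<Delta>(e). The pure terms leave two
      copies of the e-f relation, in which the products of q^2 and q^-2 in different legs
      cancel.\<close>
    have "tproj t (free_tensor (?q * ?q) (?e * ?f) + free_tensor (?q * ?f) (?e * ?qi) +
        (free_tensor (?e * ?q) (?qi * ?f) + free_tensor (?e * ?f) (?qi * ?qi))) =
      tproj t (free_tensor (?q * ?q) (?f * ?e + scalar (uc t) * (?q * ?q - ?qi * ?qi)) +
        free_tensor (scalar (inverse (lc t)) * (?f * ?q)) (scalar (lc t) * (?qi * ?e)) +
        (free_tensor (scalar (inverse (lc t)) * (?q * ?e)) (scalar (inverse (inverse (lc t))) * (?f * ?qi)) +
         free_tensor (?f * ?e + scalar (uc t) * (?q * ?q - ?qi * ?qi)) (?qi * ?qi)))"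
      by (intro tproj_add_cong tproj_cong refl rel uproj_scalar_flip[OF rel(3)] uproj_scalar_flip[OF rel(7)])
        simp_all
    then show ?thesis
      by (simp add: distrib_left distrib_right free_tensor_smult free_tensor_add free_tensor_diff
        right_diff_distrib ll add_ac)
  qed
qed

lemma Ucoprod_uproj: "Ucoprod t (uproj t x) = tproj t (ucop x)"
proof -
  interpret T: alg_map "Ualg2 t" "tproj t" by (rule alg_map_tproj)
  interpret C: urep "Ualg2 t" "\<lambda>x. tproj t (ucop x)" t by (rule urep_ucop)
  have "free_eval (Ualg2 t) (\<lambda>g. tproj t (ucoprod_gen g)) z = tproj t (ucop z)" for z
    by (rule alg_map_unique[OF T.alg_map_free_eval C.alg_map_axioms])
      (simp_all add: T.free_eval_letter ucop_letter)
  then have "free_eval (Ualg2 t) (\<lambda>g. tproj t (ucoprod_gen g)) = (\<lambda>z. tproj t (ucop z))" ..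
  then show ?thesis
    using C.on_coset[of x] by (simp add: Ucoprod_def presented_hom_def)
qed

section \<open>The antipode on the free algebra\<close>

definition uant :: "real \<Rightarrow> (ugen list \<Rightarrow>\<^sub>0 complex) \<Rightarrow> (ugen list \<Rightarrow>\<^sub>0 complex)"
  where "uant t = free_eval (opposite_alg (free_alg ugen_star)) (uantipode_gen t)"

lemma calg_opposite_free: "calg (opposite_alg (free_alg s))"
  unfolding free_alg_def by (rule calg.calg_opposite[OF calg_monoid_alg])

lemma uant_simps:
  "uant t (x + y) = uant t x + uant t y" "uant t (x - y) = uant t x - uant t y"
  "uant t (x * y) = uant t y * uant t x"
  "uant t (scalar c) = scalar c" "uant t 1 = 1" "uant t (letter g) = uantipode_gen t g"
proof -
  interpret O: calg "opposite_alg (free_alg ugen_star)" by (rule calg_opposite_free)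
  interpret C: alg_map "opposite_alg (free_alg ugen_star)" "uant t"
    unfolding uant_def by (rule O.alg_map_free_eval) (simp add: free_alg_def)
  show add: "uant t (x + y) = uant t x + uant t y" for x y
    using C.map_add by (simp add: free_alg_def)
  show "uant t (x - y) = uant t x - uant t y"
    using add[of "x - y" y] by simp
  show "uant t (x * y) = uant t y * uant t x" "uant t (scalar c) = scalar c" "uant t 1 = 1"
    using C.map_mult C.map_scalar C.map_one by (simp_all add: free_alg_def)
  show "uant t (letter g) = uantipode_gen t g"
    unfolding uant_def by (rule O.free_eval_letter) (simp add: free_alg_def)
qed

lemma urep_uant: "urep (opposite_alg (Ualg t)) (\<lambda>x. uproj t (uant t x)) t"
proof -
  interpret U: alg_map "Ualg t" "uproj t" by (rule urep.axioms(1)[OF urep_uproj])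
  let ?q = "letter Gen_q" and ?qi = "letter Gen_qi" and ?e = "letter Gen_e" and ?f = "letter Gen_f"
  note rel = uproj_relations[of t]
  have ll: "scalar (lc t) * (scalar (inverse (lc t)) * x) = x" "scalar (inverse (lc t)) * (scalar (lc t) * x) = x"
    for x :: "'w::monoid_add \<Rightarrow>\<^sub>0 complex"
    by (simp_all add: mult.assoc[symmetric] flip: scalar_mult)
  have map: "alg_map (opposite_alg (Ualg t)) (\<lambda>x. uproj t (uant t x))"
    by (rule alg_map.intro[OF U.calg_opposite], rule alg_map_axioms.intro)
      (simp_all add: uant_simps U.map_add U.map_mult U.map_scalar)
  note [simp] = uant_simps
  show ?thesis
  proof (rule urep.intro[OF map], rule urep_axioms.intro)
    show "uproj t (uant t (?q * ?qi)) = uproj t (uant t 1)" "uproj t (uant t (?qi * ?q)) = uproj t (uant t 1)"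
      using rel by simp_all
    \<comment> \<open>Used for x = e and x = f, with d the factor in the antipode: S reverses
      products, so the relations with q turn into those with its inverse.\<close>
    have 1: "uproj t (- (scalar d * x) * ?qi) = uproj t (scalar c * (?qi * - (scalar d * x)))"
      if "uproj t (x * ?qi) = uproj t (scalar c * (?qi * x))" for x c d
    proof -
      have "uproj t (scalar (- d) * (x * ?qi)) = uproj t (scalar (- d) * (scalar c * (?qi * x)))"
        by (rule uproj_scalar_cong[OF that])
      moreover have "scalar (- d) * (scalar c * (?qi * x)) = scalar c * (?qi * - (scalar d * x))"
        by (subst scalar_left_commute) (simp add: scalar_uminus scalar_left_commute[of ?qi d])
      ultimately show ?thesis
        by (simp add: scalar_uminus mult.assoc)
    qed
    show "uproj t (uant t (?q * ?e)) = uproj t (uant t (scalar (lc t) * (?e * ?q)))"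
      using 1[OF rel(6)] by (simp add: scalar_central[of "lc t"])
    show "uproj t (uant t (?q * ?f)) = uproj t (uant t (scalar (inverse (lc t)) * (?f * ?q)))"
      using 1[OF rel(7)] by (simp add: scalar_central[of "inverse (lc t)"])
    \<comment> \<open>The factors in S(e) and S(f) are inverse to each other, so S exchanges e f
      with f e. It also exchanges q^2 with q^-2, hence carries the relation to itself.\<close>
    show "uproj t (uant t (?e * ?f)) = uproj t (uant t (?f * ?e + scalar (uc t) * (?q * ?q - ?qi * ?qi)))"
    proof -
      have "uproj t (?e * ?f + scalar (uc t) * (?qi * ?qi - ?q * ?q)) = uproj t (?f * ?e)"
        using rel(5) U.map_add[of "?e * ?f" "scalar (uc t) * (?qi * ?qi - ?q * ?q)"]
        by (simp add: right_diff_distrib flip: U.map_add)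
      moreover have "uant t (?e * ?f) = ?f * ?e" "uant t (?f * ?e) = ?e * ?f"
        by (simp_all add: mult.assoc scalar_left_commute[of ?f] scalar_left_commute[of ?e] ll)
      moreover have "uant t (scalar (uc t) * (?q * ?q - ?qi * ?qi)) = scalar (uc t) * (?qi * ?qi - ?q * ?q)"
        by (simp add: scalar_central[of "uc t"])
      ultimately show ?thesis
        by (simp add: uant_simps(1) del: uant_simps(3))
    qed
  qed
qed

lemma Uantipode_uproj: "Uantipode t (uproj t x) = uproj t (uant t x)"
proof -
  interpret U: alg_map "Ualg t" "uproj t" by (rule urep.axioms(1)[OF urep_uproj])
  interpret O: calg "opposite_alg (Ualg t)" by (rule U.calg_opposite)
  interpret C: urep "opposite_alg (Ualg t)" "\<lambda>x. uproj t (uant t x)" t by (rule urep_uant)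
  have "free_eval (opposite_alg (Ualg t)) (\<lambda>g. uproj t (uantipode_gen t g)) z = uproj t (uant t z)" for z
    by (rule alg_map_unique[OF O.alg_map_free_eval C.alg_map_axioms])
      (simp_all add: O.free_eval_letter uant_simps)
  then have "free_eval (opposite_alg (Ualg t)) (\<lambda>g. uproj t (uantipode_gen t g)) = (\<lambda>z. uproj t (uant t z))" ..
  then show ?thesis
    using C.on_coset[of x] by (simp add: Uantipode_def presented_hom_def free_alg_def)
qed

section \<open>Tensor products of representations\<close>

lemma pair_index_less: "i < n \<Longrightarrow> k < m \<Longrightarrow> i * m + k < n * m" for i k n m :: nat
proof -
  assume "i < n" "k < m"
  then have "i * m + k < Suc i * m" "Suc i * m \<le> n * m" by (simp, intro mult_le_mono1) simp
  then show ?thesis by linarith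
qed

lemma sum_lessThan_mult: "(\<Sum>r<n * m. f r) = (\<Sum>a<n. \<Sum>b<m. f (a * m + b))"
  for f :: "nat \<Rightarrow> 'a::comm_monoid_add"
proof -
  have "sum f {a * m..<a * m + m} = (\<Sum>b<m. f (a * m + b))" for a
    using sum.shift_bounds_nat_ivl[of f 0 "a * m" m] by (simp add: atLeast0LessThan add.commute)
  then show ?thesis by (simp flip: sum.nat_group)
qed

lemma pair_indexE:
  fixes n m :: nat
  assumes "r < n * m"
  obtains i k where "r = i * m + k" "i < n" "k < m"
proof
  have "m > 0" using assms by (cases m) auto
  then show "r = r div m * m + r mod m" "r mod m < m" by simp_all
  show "r div m < n" using assms by (simp add: less_mult_imp_div_less)
qed

lemma kron_carrier:
  "A \<in> carrier_mat n n' \<Longrightarrow> B \<in> carrier_mat m m' \<Longrightarrow> kron A B \<in> carrier_mat (n * m) (n' * m')"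
  by (auto simp: kron_def)

lemma kron_index:
  assumes "A \<in> carrier_mat n n'" "B \<in> carrier_mat m m'" "i < n" "k < m" "j < n'" "l < m'"
  shows "kron A B $$ (i * m + k, j * m' + l) = A $$ (i, j) * B $$ (k, l)"
  using assms pair_index_less[of i n k m] pair_index_less[of j n' l m'] by (auto simp: kron_def)

lemma eq_pair_matI:
  assumes "X \<in> carrier_mat (n * m) (n' * m')" "Y \<in> carrier_mat (n * m) (n' * m')"
    and "\<And>i j k l. i < n \<Longrightarrow> k < m \<Longrightarrow> j < n' \<Longrightarrow> l < m' \<Longrightarrow>
      X $$ (i * m + k, j * m' + l) = Y $$ (i * m + k, j * m' + l)"
  shows "X = Y"
proof (rule eq_matI)
  fix r s assume "r < dim_row Y" "s < dim_col Y"
  then have "r < n * m" "s < n' * m'" using assms by auto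
  then show "X $$ (r, s) = Y $$ (r, s)"
    by (elim pair_indexE) (auto intro: assms(3))
qed (use assms in auto)

lemma kron_mult:
  assumes "A \<in> carrier_mat n n" "B \<in> carrier_mat m m" "C \<in> carrier_mat n n" "D \<in> carrier_mat m m"
  shows "kron A B * kron C D = kron (A * C) (B * D)"
proof (rule eq_pair_matI)
  fix i j k l assume ij: "i < n" "k < m" "j < n" "l < m"
  note idx = pair_index_less[OF ij(1,2)] pair_index_less[OF ij(3,4)]
  have "(kron A B * kron C D) $$ (i * m + k, j * m + l) =
      (\<Sum>a<n. \<Sum>b<m. (A $$ (i, a) * B $$ (k, b)) * (C $$ (a, j) * D $$ (b, l)))"
    unfolding mult_mat_index[OF kron_carrier[OF assms(1,2)] kron_carrier[OF assms(3,4)] idx] sum_lessThan_mult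
    by (intro sum.cong refl) (use assms ij in \<open>simp add: kron_index\<close>)
  also have "\<dots> = (\<Sum>a<n. A $$ (i, a) * C $$ (a, j)) * (\<Sum>b<m. B $$ (k, b) * D $$ (b, l))"
    by (simp add: sum_product mult_ac)
  also have "\<dots> = kron (A * C) (B * D) $$ (i * m + k, j * m + l)"
    using assms ij by (subst kron_index[of _ n n _ m m]) (auto simp: mult_mat_index simp del: index_mult_mat(1))
  finally show "(kron A B * kron C D) $$ (i * m + k, j * m + l) = \<dots>" .
qed (use assms in \<open>auto intro!: mult_carrier_mat kron_carrier\<close>)

lemma kron_one: "kron (1\<^sub>m n) (1\<^sub>m m) = 1\<^sub>m (n * m)"
proof (rule eq_pair_matI)
  fix i j k l assume ij: "i < n" "k < m" "j < n" "l < m"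
  have "i * m + k = j * m + l \<longleftrightarrow> i = j \<and> k = l"
    using ij by (metis add_left_cancel div_mult_self3 div_less mod_less mod_mult_self3 add.right_neutral less_nat_zero_code)
  then show "kron (1\<^sub>m n) (1\<^sub>m m) $$ (i * m + k, j * m + l) = 1\<^sub>m (n * m) $$ (i * m + k, j * m + l)"
    using ij pair_index_less[OF ij(1,2)] pair_index_less[OF ij(3,4)]
    by (subst kron_index[of _ n n _ m m]) auto
qed (auto intro!: kron_carrier)

lemma kron_add:
  assumes "A \<in> carrier_mat n n" "A' \<in> carrier_mat n n" "B \<in> carrier_mat m m" "B' \<in> carrier_mat m m"
  shows "kron (A + A') B = kron A B + kron A' B" "kron A (B + B') = kron A B + kron A B'"
proof -
  note c = kron_carrier[where n = n and n' = n and m = m and m' = m]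
  show "kron (A + A') B = kron A B + kron A' B"
    by (rule eq_pair_matI[of _ n m n m])
      (use assms in \<open>auto intro!: c simp: kron_index[where n = n and n' = n and m = m and m' = m] pair_index_less
        carrier_matD[OF c] distrib_right\<close>)
  show "kron A (B + B') = kron A B + kron A B'"
    by (rule eq_pair_matI[of _ n m n m])
      (use assms in \<open>auto intro!: c simp: kron_index[where n = n and n' = n and m = m and m' = m] pair_index_less
        carrier_matD[OF c] distrib_left\<close>)
qed

lemma kron_smult:
  assumes "A \<in> carrier_mat n n" "B \<in> carrier_mat m m"
  shows "kron (a \<cdot>\<^sub>m A) (b \<cdot>\<^sub>m B) = (a * b) \<cdot>\<^sub>m kron A B"
proof -
  note c = kron_carrier[where n = n and n' = n and m = m and m' = m]
  show ?thesis
    by (rule eq_pair_matI[of _ n m n m])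
      (use assms in \<open>auto intro!: c simp: kron_index[where n = n and n' = n and m = m and m' = m] pair_index_less carrier_matD[OF c]\<close>)
qed

lemma kron_zero:
  assumes "A \<in> carrier_mat n n" "B \<in> carrier_mat m m"
  shows "kron (0\<^sub>m n n) B = 0\<^sub>m (n * m) (n * m)" "kron A (0\<^sub>m m m) = 0\<^sub>m (n * m) (n * m)"
proof -
  note c = kron_carrier[where n = n and n' = n and m = m and m' = m]
  show "kron (0\<^sub>m n n) B = 0\<^sub>m (n * m) (n * m)"
    by (rule eq_pair_matI[of _ n m n m])
      (use assms in \<open>auto intro!: c simp: kron_index[where n = n and n' = n and m = m and m' = m] pair_index_less\<close>)
  show "kron A (0\<^sub>m m m) = 0\<^sub>m (n * m) (n * m)"
    by (rule eq_pair_matI[of _ n m n m])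
      (use assms in \<open>auto intro!: c simp: kron_index[where n = n and n' = n and m = m and m' = m] pair_index_less\<close>)
qed

lemma urho_carrier [simp, intro]: "urho t N x \<in> carrier_mat (Suc N) (Suc N)"
  using alg_map.closed[OF alg_map_urho] by simp

lemma urho_simps:
  "urho t N (x + y) = urho t N x + urho t N y" "urho t N (x * y) = urho t N x * urho t N y"
  "urho t N 1 = 1\<^sub>m (Suc N)" "urho t N (scalar c * x) = c \<cdot>\<^sub>m urho t N x"
  "urho t N 0 = 0\<^sub>m (Suc N) (Suc N)" "urho t N (scalar c) = c \<cdot>\<^sub>m 1\<^sub>m (Suc N)"
  using alg_map.map_add[OF alg_map_urho] alg_map.map_mult[OF alg_map_urho] alg_map.map_one[OF alg_map_urho]
    alg_map.map_smult[OF alg_map_urho] alg_map.map_zero[OF alg_map_urho] alg_map.map_scalar[OF alg_map_urho]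
  by simp_all

definition utens :: "real \<Rightarrow> nat \<Rightarrow> nat \<Rightarrow> (ugen list \<times> ugen list \<Rightarrow>\<^sub>0 complex) \<Rightarrow> complex mat"
  where "utens t N M = lin_ext (mat_alg (Suc N * Suc M))
    (\<lambda>(u, v). kron (urho t N (Poly_Mapping.single u 1)) (urho t M (Poly_Mapping.single v 1)))"

lemma utens_word_carrier:
  "(\<lambda>(u, v). kron (urho t N (Poly_Mapping.single u 1)) (urho t M (Poly_Mapping.single v 1))) w
    \<in> carrier (mat_alg (Suc N * Suc M))"
  unfolding mat_alg_simps case_prod_beta by (rule kron_carrier) auto

lemma alg_map_utens: "alg_map (mat_alg (Suc N * Suc M)) (utens t N M)"
  unfolding utens_def
proof (rule calg.alg_map_lin_ext[OF calg_mat_alg utens_word_carrier])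
  let ?g = "\<lambda>(u, v). kron (urho t N (Poly_Mapping.single u 1)) (urho t M (Poly_Mapping.single v 1))"
  fix v w :: "ugen list \<times> ugen list"
  have "urho t N (Poly_Mapping.single (a + b) 1) = urho t N (Poly_Mapping.single a 1) * urho t N (Poly_Mapping.single b 1)"
    for N :: nat and a b :: "ugen list"
    using urho_simps(2)[of N t "Poly_Mapping.single a 1" "Poly_Mapping.single b 1"] by (simp add: mult_single)
  then show "?g (v + w) = ?g v \<otimes>\<^bsub>mat_alg (Suc N * Suc M)\<^esub> ?g w"
    by (cases v; cases w) (simp add: kron_mult[OF urho_carrier urho_carrier urho_carrier urho_carrier])
  show "?g 0 = \<one>\<^bsub>mat_alg (Suc N * Suc M)\<^esub>"
    by (simp only: zero_prod_def case_prod_conv single_one urho_simps kron_one mat_alg_simps)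
qed

lemma utens_free_tensor: "utens t N M (free_tensor x y) = kron (urho t N x) (urho t M y)"
proof -
  interpret T: alg_map "mat_alg (Suc N * Suc M)" "utens t N M" by (rule alg_map_utens)
  note add = T.map_add[simplified mat_alg_simps]
  have sing: "urho t N (Poly_Mapping.single w c) = c \<cdot>\<^sub>m urho t N (Poly_Mapping.single w 1)" for N :: nat and w c
    using urho_simps(4)[of N t c "Poly_Mapping.single w 1"] by (simp add: scalar_def mult_single)
  show ?thesis
  proof (induction x rule: poly_mapping_add_induct)
    case (single u a)
    show ?case
    proof (induction y rule: poly_mapping_add_induct)
      case (single v b)
      have "utens t N M (free_tensor (Poly_Mapping.single u a) (Poly_Mapping.single v b)) =
        (a * b) \<cdot>\<^sub>m kron (urho t N (Poly_Mapping.single u 1)) (urho t M (Poly_Mapping.single v 1))"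
        unfolding utens_def free_tensor_single
        by (subst calg.lin_ext_single[OF calg_mat_alg utens_word_carrier]) simp
      then show ?case
        unfolding sing[of _ _ a] sing[of _ _ b] by (simp only: kron_smult[OF urho_carrier urho_carrier])
    qed (simp only: free_tensor_add add urho_simps kron_add[OF urho_carrier urho_carrier urho_carrier urho_carrier])
  qed (simp only: free_tensor_add add urho_simps kron_add[OF urho_carrier urho_carrier urho_carrier urho_carrier])
qed

text \<open>Each generator of \<open>tensor_ideal\<close> has a leg that the representations kill,
  and a Kronecker product with a zero factor vanishes; so the map is constant on cosets.\<close>

lemma rep_tensor_tproj:
  assumes t: "t > 0"
  shows "rep_tensor t N M (tproj t z) = utens t N M z"
proof -
  interpret T: alg_map "mat_alg (Suc N * Suc M)" "utens t N M" by (rule alg_map_utens)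
  have k: "urho t N x = 0\<^sub>m (Suc N) (Suc N)" if "x \<in> uJ t" for x N
    using urep.kills_uJ[OF urep_urho[OF t] that] by simp
  have "(\<lambda>x. free_tensor x 1) ` uJ t \<union> free_tensor 1 ` uJ t \<subseteq> {z. utens t N M z = \<zero>\<^bsub>mat_alg (Suc N * Suc M)\<^esub>}"
    by (auto simp: utens_free_tensor k kron_zero[OF urho_carrier urho_carrier])
  then have 0: "utens t N M z = \<zero>\<^bsub>mat_alg (Suc N * Suc M)\<^esub>" if "z \<in> tJ t" for z
    using genideal_le[OF T.ideal_kernel _ that[unfolded tensor_ideal_def]] by simp
  have "(\<lambda>z. finsum (mat_alg ((N + 1) * (M + 1)))
    (\<lambda>(u, v). Poly_Mapping.lookup z (u, v) \<cdot>\<^sub>m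
       kron (free_eval (mat_alg (N + 1)) (rep_gen t N) (Poly_Mapping.single u 1))
            (free_eval (mat_alg (M + 1)) (rep_gen t M) (Poly_Mapping.single v 1)))
    (Poly_Mapping.keys z)) = utens t N M"
    by (simp add: fun_eq_iff utens_def lin_ext_def case_prod_unfold)
  then show ?thesis
    unfolding rep_tensor_def
    by (simp only: T.presented_hom_eq[OF alg_ideal_tensor_ideal 0])
qed

section \<open>The Clebsch-Gordan decomposition with spin one half\<close>

lemma rep_gen_mult_right:
  assumes X: "X \<in> carrier_mat m (Suc N)" and ij: "i < m" "j < Suc N"
  shows "(X * rep_gen t N Gen_q) $$ (i, j) = X $$ (i, j) * complex_of_real (exp (t * wt N j))"
    and "(X * rep_gen t N Gen_qi) $$ (i, j) = X $$ (i, j) * complex_of_real (exp (- (t * wt N j)))"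
    and "(X * rep_gen t N Gen_e) $$ (i, j) =
      (if j = 0 then 0 else X $$ (i, j - 1) * complex_of_real (rcoef t N j))"
    and "(X * rep_gen t N Gen_f) $$ (i, j) =
      (if j < N then X $$ (i, Suc j) * complex_of_real (rcoef t N (Suc j)) else 0)"
proof -
  note m = mult_mat_index[OF X rep_gen_carrier ij]
  have s: "(X * rep_gen t N g) $$ (i, j) = (if a < Suc N then X $$ (i, a) * c else 0)"
    if "\<And>k. k < Suc N \<Longrightarrow> rep_gen t N g $$ (k, j) = (if k = a then c else 0)" for g a c
    unfolding m using sum_delta_times[of a c "\<lambda>k. X $$ (i, k)" "Suc N"]
    by (simp add: that mult.commute del: sum.lessThan_Suc)
  show "(X * rep_gen t N Gen_q) $$ (i, j) = X $$ (i, j) * complex_of_real (exp (t * wt N j))"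
    using ij by (subst s[of _ j "complex_of_real (exp (t * wt N j))"]) (auto simp: rep_gen_index)
  show "(X * rep_gen t N Gen_qi) $$ (i, j) = X $$ (i, j) * complex_of_real (exp (- (t * wt N j)))"
    using ij by (subst s[of _ j "complex_of_real (exp (- (t * wt N j)))"]) (auto simp: rep_gen_index)
  show "(X * rep_gen t N Gen_e) $$ (i, j) =
      (if j = 0 then 0 else X $$ (i, j - 1) * complex_of_real (rcoef t N j))"
    using ij by (subst s[of _ "j - 1" "if j = 0 then 0 else complex_of_real (rcoef t N j)"])
      (auto simp: rep_gen_index)
  show "(X * rep_gen t N Gen_f) $$ (i, j) =
      (if j < N then X $$ (i, Suc j) * complex_of_real (rcoef t N (Suc j)) else 0)"
    using ij by (subst s[of _ "Suc j" "complex_of_real (rcoef t N (Suc j))"]) (auto simp: rep_gen_index)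
qed

text \<open>Two expansions exchanged by t to -t; they are the addition formulas behind the
  Clebsch-Gordan relations.\<close>

lemma qnum_succ:
  assumes "t > 0"
  shows "qnum t (x + 1) = exp (t * x) + exp (- t) * qnum t x"
    and "qnum t (x + 1) = exp (- (t * x)) + exp t * qnum t x"
proof -
  define X L where "X = exp (t * x)" and "L = exp t"
  have pos: "X > 0" "L > 0" and d: "L - 1 / L \<noteq> 0"
    using assms by (auto simp: X_def L_def simp flip: exp_minus inverse_eq_divide)
  have e: "qnum t (x + 1) = (X * L - 1 / (X * L)) / (L - 1 / L)" "qnum t x = (X - 1 / X) / (L - 1 / L)"
    "exp (- t) = 1 / L" "exp (- (t * x)) = 1 / X"
    by (simp_all add: qnum_def X_def L_def exp_add exp_minus exp_diff distrib_left divide_inverse)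
  have *: "a / d = y + z * (b / d)" if "a = y * d + z * b" "d \<noteq> 0" for a b d y z :: real
    using that by (simp add: field_simps)
  show "qnum t (x + 1) = exp (t * x) + exp (- t) * qnum t x"
    "qnum t (x + 1) = exp (- (t * x)) + exp t * qnum t x"
    unfolding e X_def[symmetric] L_def[symmetric]
    by (rule *; use pos d in \<open>simp add: field_simps\<close>)+
qed

text \<open>
  With \<open>\<eta>\<^sub>0, \<eta>\<^sub>1\<close> the basis of \<open>H\<^sub>1\<^sub>/\<^sub>2\<close>, the vectors \<open>c\<^sub>p \<xi>\<^sub>p \<otimes> \<eta>\<^sub>0 + d\<^sub>p \<xi>\<^sub>p\<^sub>-\<^sub>1 \<otimes> \<eta>\<^sub>1\<close> span the
  component of spin \<open>(N + 1)/2\<close>, and \<open>-d\<^sub>p \<xi>\<^sub>p \<otimes> \<eta>\<^sub>0 + c\<^sub>p \<xi>\<^sub>p\<^sub>-\<^sub>1 \<otimes> \<eta>\<^sub>1\<close> (\<open>1 \<le> p \<le> N\<close>) the one of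
  spin \<open>(N - 1)/2\<close>. The coefficients are normalised by \<open>c\<^sub>p\<^sup>2 + d\<^sub>p\<^sup>2 = [N + 1]\<close>.
\<close>

definition cgc :: "real \<Rightarrow> nat \<Rightarrow> nat \<Rightarrow> real"
  where "cgc t N p = exp (- (t * real p / 2)) * sqrt (qnum t (real N + 1 - real p))"

definition cgd :: "real \<Rightarrow> nat \<Rightarrow> nat \<Rightarrow> real"
  where "cgd t N p = exp (t * (real N + 1 - real p) / 2) * sqrt (qnum t (real p))"

lemma cgc_pos: "t > 0 \<Longrightarrow> p \<le> N \<Longrightarrow> cgc t N p > 0"
  by (simp add: cgc_def qnum_pos)

lemma cgd_pos: "t > 0 \<Longrightarrow> p > 0 \<Longrightarrow> cgd t N p > 0"
  by (simp add: cgd_def qnum_pos)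

lemma cgd_0 [simp]: "cgd t N 0 = 0"
  by (simp add: cgd_def)

lemma cgc_last [simp]: "cgc t N (Suc N) = 0"
  by (simp add: cgc_def)

text \<open>Entries of the intertwining relations for e and f. The digit in a name is the basis
  vector of the spin one half factor in the row; primes mark the component of spin (N - 1)/2. For q
  and its inverse, additivity of weights suffices.\<close>

lemma
  fixes t :: real and N i :: nat
  assumes t: "t > 0" and i: "i \<le> N"
  defines "c \<equiv> cgc t N" and "d \<equiv> cgd t N"
    and "r \<equiv> rcoef t N" and "R \<equiv> rcoef t (Suc N)" and "R' \<equiv> rcoef t (N - 1)"
  shows cg_e0: "c i * R (Suc i) = exp (t * wt N i) * d (Suc i) + exp (- (t / 2)) * (r (Suc i) * c (Suc i))"
    and cg_e1: "d (Suc i) * R (Suc (Suc i)) = exp (t / 2) * (r (Suc i) * d (Suc (Suc i)))"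
    and cg_f0: "i > 0 \<Longrightarrow> c i * R i = exp (- (t / 2)) * (r i * c (i - 1))"
    and cg_f1: "d (Suc i) * R (Suc i) = exp (t * wt N i) * c i + exp (t / 2) * (r i * d i)"
    and cg_e0': "i < N \<Longrightarrow> - (d i * R' i) = exp (t * wt N i) * c (Suc i) - exp (- (t / 2)) * (r (Suc i) * d (Suc i))"
    and cg_e1': "Suc i < N \<Longrightarrow> c (Suc i) * R' (Suc i) = exp (t / 2) * (r (Suc i) * c (Suc (Suc i)))"
    and cg_f0': "i > 1 \<Longrightarrow> d i * R' (i - 1) = exp (- (t / 2)) * (r i * d (i - 1))"
    and cg_f1': "i > 0 \<Longrightarrow> c (Suc i) * R' i = exp (t / 2) * (r i * c i) - exp (t * wt N i) * d i"
proof -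
  \<comment> \<open>The exponentials become monomials in a, b, m, the powers of \<lambda> to i/2,
    n/2 and 1/2, and the roots become values of s. Four relations compare monomials; the four with
    two terms on the right use \<open>s1\<close> or \<open>s2\<close> once.\<close>
  define n where "n = real N - real i"
  define s where "s = (\<lambda>x. sqrt (qnum t x))"
  define a b m where "a = exp (t * real i / 2)" and "b = exp (t * n / 2)" and "m = exp (t / 2)"
  have pos: "a > 0" "b > 0" "m > 0" by (simp_all add: a_def b_def m_def)
  have N: "real N = n + real i" by (simp add: n_def)
  have n: "n \<ge> 0" using i by (simp add: n_def)
  have m2: "exp t = m * m" "exp (- t) = 1 / (m * m)" "exp (t / 2) = m" "exp (- (t / 2)) = 1 / m"
    by (simp_all add: m_def exp_minus inverse_eq_divide flip: exp_add)
  have w: "exp (t * wt N i) = b / a"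
    by (simp add: wt_def N a_def b_def field_simps flip: exp_diff)
  have s1: "s (n + 1) * s (n + 1) = b * b + s n * s n / (m * m)"
    using qnum_succ(1)[OF t, of n] n qnum_nonneg[OF t, of n] qnum_nonneg[OF t, of "n + 1"]
    by (simp add: s_def m2 b_def flip: exp_add)
  have s2: "s (real i + 1) * s (real i + 1) = 1 / (a * a) + m * m * (s (real i) * s (real i))"
    using qnum_succ(2)[OF t, of "real i"] qnum_nonneg[OF t, of "real i"] qnum_nonneg[OF t, of "real i + 1"]
    by (simp add: s_def m2 a_def exp_minus inverse_eq_divide flip: exp_add)
  have sum: "real N + 1 - real i = n + 1" "real N + 1 - real (Suc i) = n" "real N + 1 - real (Suc (Suc i)) = n - 1"
    "i > 0 \<Longrightarrow> real N + 1 - real (i - 1) = n + 2"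
    by (simp_all add: N of_nat_diff)
  have half: "exp (x + t / 2) = exp x * m" "exp (x - t / 2) = exp x / m" for x
    by (simp_all add: m_def exp_add exp_diff)
  have ea: "exp (- (t * real i / 2)) = 1 / a"
    by (simp add: a_def exp_minus inverse_eq_divide)
  have c: "c i = s (n + 1) / a" "c (Suc i) = s n / (a * m)" "c (Suc (Suc i)) = s (n - 1) / (a * m * m)"
    "i > 0 \<Longrightarrow> c (i - 1) = s (n + 2) * m / a"
  proof -
    have e: "- (t * real (Suc i) / 2) = - (t * real i / 2) - t / 2"
      "- (t * real (Suc (Suc i)) / 2) = - (t * real i / 2) - t / 2 - t / 2"
      "i > 0 \<Longrightarrow> - (t * real (i - 1) / 2) = - (t * real i / 2) + t / 2"
      by (simp_all add: of_nat_diff field_simps)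
    show "c i = s (n + 1) / a" "c (Suc i) = s n / (a * m)" "c (Suc (Suc i)) = s (n - 1) / (a * m * m)"
      unfolding c_def cgc_def sum e half ea s_def by simp_all
    show "c (i - 1) = s (n + 2) * m / a" if "i > 0"
      unfolding c_def cgc_def sum(4)[OF that] e(3)[OF that] half ea s_def by simp
  qed
  have d: "d i = b * m * s (real i)" "d (Suc i) = b * s (real i + 1)" "d (Suc (Suc i)) = b * s (real i + 2) / m"
    "i > 0 \<Longrightarrow> d (i - 1) = b * m * m * s (real i - 1)"
  proof -
    have e: "t * (n + 1) / 2 = t * n / 2 + t / 2" "t * (n - 1) / 2 = t * n / 2 - t / 2"
      "t * (n + 2) / 2 = t * n / 2 + t / 2 + t / 2"
      by (simp_all add: field_simps)
    show "d i = b * m * s (real i)" "d (Suc i) = b * s (real i + 1)" "d (Suc (Suc i)) = b * s (real i + 2) / m"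
      unfolding d_def cgd_def sum e half b_def[symmetric] s_def by (simp_all add: add.commute)
    show "d (i - 1) = b * m * m * s (real i - 1)" if "i > 0"
      unfolding d_def cgd_def sum(4)[OF that] e half b_def[symmetric] s_def
      using that by (simp add: of_nat_diff)
  qed
  have r: "r i = s (real i) * s (n + 1)" "r (Suc i) = s (real i + 1) * s n"
    by (simp_all add: r_def rcoef_eq[OF t] s_def N add.commute)
  have R: "R i = s (real i) * s (n + 2)" "R (Suc i) = s (real i + 1) * s (n + 1)" "R (Suc (Suc i)) = s (real i + 2) * s n"
    by (simp_all add: R_def rcoef_eq[OF t] s_def N algebra_simps)
  have R': "N > 0 \<Longrightarrow> R' i = s (real i) * s n" "N > 0 \<Longrightarrow> R' (Suc i) = s (real i + 1) * s (n - 1)"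
    "i > 0 \<Longrightarrow> N > 0 \<Longrightarrow> R' (i - 1) = s (real i - 1) * s (n + 1)"
    by (simp_all add: R'_def rcoef_eq[OF t] s_def N of_nat_diff algebra_simps)
  show "c i * R (Suc i) = exp (t * wt N i) * d (Suc i) + exp (- (t / 2)) * (r (Suc i) * c (Suc i))"
  proof -
    have "c i * R (Suc i) = (s (n + 1) * s (n + 1)) * s (real i + 1) / a"
      by (simp add: c R)
    then show ?thesis unfolding s1 w m2 c d r using pos by (simp add: field_simps)
  qed
  show "d (Suc i) * R (Suc (Suc i)) = exp (t / 2) * (r (Suc i) * d (Suc (Suc i)))"
    unfolding w m2 c d r R using pos by (simp add: field_simps)
  show "i > 0 \<Longrightarrow> c i * R i = exp (- (t / 2)) * (r i * c (i - 1))"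
    unfolding w m2 c d r R using pos by (simp add: field_simps)
  show "d (Suc i) * R (Suc i) = exp (t * wt N i) * c i + exp (t / 2) * (r i * d i)"
  proof -
    have "d (Suc i) * R (Suc i) = (s (real i + 1) * s (real i + 1)) * b * s (n + 1)"
      by (simp add: d R)
    then show ?thesis unfolding s2 w m2 c d r using pos by (simp add: field_simps)
  qed
  show "i < N \<Longrightarrow> - (d i * R' i) = exp (t * wt N i) * c (Suc i) - exp (- (t / 2)) * (r (Suc i) * d (Suc i))"
  proof -
    assume "i < N"
    have "exp (- (t / 2)) * (r (Suc i) * d (Suc i)) = (s (real i + 1) * s (real i + 1)) * b * s n / m"
      by (simp add: d r m2)
    then show ?thesis unfolding s2 w c d using pos \<open>i < N\<close> by (simp add: R' field_simps)
  qed
  show "Suc i < N \<Longrightarrow> c (Suc i) * R' (Suc i) = exp (t / 2) * (r (Suc i) * c (Suc (Suc i)))"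
    unfolding w m2 c d r using pos by (simp add: R' field_simps)
  show "i > 1 \<Longrightarrow> d i * R' (i - 1) = exp (- (t / 2)) * (r i * d (i - 1))"
    unfolding w m2 c r d(1) using pos i d(4) R'(3) by (simp add: field_simps)
  show "i > 0 \<Longrightarrow> c (Suc i) * R' i = exp (t / 2) * (r i * c i) - exp (t * wt N i) * d i"
  proof -
    assume "i > 0"
    have f: "exp (t / 2) * (r i * c i) = (s (n + 1) * s (n + 1)) * s (real i) * m / a"
      by (simp add: c r m2)
    show ?thesis unfolding f unfolding s1 w c d using pos \<open>i > 0\<close> i by (simp add: R' field_simps)
  qed
qed

text \<open>
  The rows of \<open>X\<close> belonging to the tensor factor \<open>\<eta>\<^sub>b\<close>.
\<close>

definition slice :: "complex mat \<Rightarrow> nat \<Rightarrow> nat \<Rightarrow> complex mat"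
  where "slice X n b = mat n (dim_col X) (\<lambda>(a, j). X $$ (a * 2 + b, j))"

text \<open>Reduces multiplication by A \<otimes> B to multiplication by A on the two halves of X,
  where the row formulas for the generators apply.\<close>

lemma kron_mult_slice:
  assumes A: "A \<in> carrier_mat n n" and B: "B \<in> carrier_mat 2 2" and X: "X \<in> carrier_mat (n * 2) m"
    and ij: "i < n" "k < 2" "j < m"
  shows "(kron A B * X) $$ (i * 2 + k, j) =
    B $$ (k, 0) * (A * slice X n 0) $$ (i, j) + B $$ (k, 1) * (A * slice X n 1) $$ (i, j)"
proof -
  have S: "slice X n b \<in> carrier_mat n m" for b using X by (auto simp: slice_def)
  have "(kron A B * X) $$ (i * 2 + k, j) =
      (\<Sum>a<n. \<Sum>b<2. (A $$ (i, a) * B $$ (k, b)) * X $$ (a * 2 + b, j))"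
    unfolding mult_mat_index[OF kron_carrier[OF A B] X pair_index_less[OF ij(1,2)] ij(3)] sum_lessThan_mult
    by (intro sum.cong refl) (use assms in \<open>simp add: kron_index\<close>)
  also have "\<dots> = (\<Sum>a<n. B $$ (k, 0) * (A $$ (i, a) * slice X n 0 $$ (a, j)) +
      B $$ (k, 1) * (A $$ (i, a) * slice X n 1 $$ (a, j)))"
    by (intro sum.cong refl) (use X ij in \<open>simp add: slice_def numeral_2_eq_2 algebra_simps\<close>)
  also have "\<dots> = B $$ (k, 0) * (A * slice X n 0) $$ (i, j) + B $$ (k, 1) * (A * slice X n 1) $$ (i, j)"
    unfolding mult_mat_index[OF A S ij(1,3)] by (simp add: sum.distrib sum_distrib_left)
  finally show ?thesis .
qed

lemma intertwine:
  assumes h: "alg_map (mat_alg n) h" and k: "alg_map (mat_alg m) k" and V: "V \<in> carrier_mat m n"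
    and gen: "\<And>g. V * h (letter g) = k (letter g) * V"
  shows "V * h x = k x * V"
proof -
  interpret h: alg_map "mat_alg n" h by fact
  interpret k: alg_map "mat_alg m" k by fact
  note hc = h.closed[simplified] and kc = k.closed[simplified]
  show ?thesis
  proof (induction x rule: free_alg_induct)
    case (scalar c)
    then show ?case
      using V by (simp add: h.map_scalar k.map_scalar mult_smult_distrib[of V m n "1\<^sub>m n" n]
        mult_smult_assoc_mat[of "1\<^sub>m m" m m V n])
  next
    case (letter g x)
    have "V * h (letter g * x) = (V * h (letter g)) * h x"
      using V hc by (simp add: h.map_mult assoc_mult_mat[of _ m n _ n _ n])
    also have "\<dots> = k (letter g) * (V * h x)"
      using V hc kc by (simp add: gen assoc_mult_mat[of _ m m _ n _ n])
    also have "\<dots> = k (letter g * x) * V"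
      using V kc letter by (simp add: k.map_mult assoc_mult_mat[of _ m m _ m _ n])
    finally show ?case .
  next
    case (add x y)
    then show ?case
      using V hc kc by (simp add: h.map_add k.map_add mult_add_distrib_mat[of _ m n _ n] add_mult_distrib_mat[of _ m m _ _ n])
  qed
qed

text \<open>The vectors of the upper component as columns; row i * 2 + k belongs to
  \<open>\<xi>\<^sub>i \<otimes> \<eta>\<^sub>k\<close>. For t > 0 each row has exactly one nonzero
  entry, which \<open>cg_coef\<close> exploits.\<close>

definition cgV :: "real \<Rightarrow> nat \<Rightarrow> complex mat"
  where "cgV t N = mat (Suc N * 2) (Suc (Suc N)) (\<lambda>(r, j).
    if r mod 2 = 0 then if j = r div 2 then complex_of_real (cgc t N j) else 0
    else if j = Suc (r div 2) then complex_of_real (cgd t N j) else 0)"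

text \<open>The lower component starts at p = 1, so column j carries the vector for p = Suc j. For N
  = 0 there are no columns.\<close>

definition cgV' :: "real \<Rightarrow> nat \<Rightarrow> complex mat"
  where "cgV' t N = mat (Suc N * 2) N (\<lambda>(r, j).
    if r mod 2 = 0 then if r div 2 = Suc j then - complex_of_real (cgd t N (Suc j)) else 0
    else if j = r div 2 then complex_of_real (cgc t N (Suc j)) else 0)"

lemma cgV_carrier: "cgV t N \<in> carrier_mat (Suc N * 2) (Suc (Suc N))"
  and cgV'_carrier: "cgV' t N \<in> carrier_mat (Suc N * 2) N"
  by (simp_all add: cgV_def cgV'_def)

lemma cgV_index:
  assumes "i < Suc N" "j < Suc (Suc N)"
  shows "cgV t N $$ (i * 2, j) = (if j = i then complex_of_real (cgc t N j) else 0)"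
    and "cgV t N $$ (Suc (i * 2), j) = (if j = Suc i then complex_of_real (cgd t N j) else 0)"
proof -
  have "i * 2 < Suc N * 2" "Suc (i * 2) < Suc N * 2" "Suc (i * 2) mod 2 = 1"
    using assms by (auto, presburger)
  then show "cgV t N $$ (i * 2, j) = (if j = i then complex_of_real (cgc t N j) else 0)"
    "cgV t N $$ (Suc (i * 2), j) = (if j = Suc i then complex_of_real (cgd t N j) else 0)"
    using assms by (simp_all add: cgV_def)
qed

lemma cgV'_index:
  assumes "i < Suc N" "j < N"
  shows "cgV' t N $$ (i * 2, j) = (if i = Suc j then - complex_of_real (cgd t N (Suc j)) else 0)"
    and "cgV' t N $$ (Suc (i * 2), j) = (if j = i then complex_of_real (cgc t N (Suc j)) else 0)"
proof -
  have "i * 2 < Suc N * 2" "Suc (i * 2) < Suc N * 2" "Suc (i * 2) mod 2 = 1"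
    using assms by (auto, presburger)
  then show "cgV' t N $$ (i * 2, j) = (if i = Suc j then - complex_of_real (cgd t N (Suc j)) else 0)"
    "cgV' t N $$ (Suc (i * 2), j) = (if j = i then complex_of_real (cgc t N (Suc j)) else 0)"
    using assms by (simp_all add: cgV'_def)
qed

lemma rep_gen_1:
  assumes "t > 0"
  shows "rep_gen t 1 Gen_q $$ (0, 0) = complex_of_real (exp (t / 2))" "rep_gen t 1 Gen_q $$ (0, 1) = 0"
    "rep_gen t 1 Gen_q $$ (1, 0) = 0" "rep_gen t 1 Gen_q $$ (1, 1) = complex_of_real (exp (- (t / 2)))"
    "rep_gen t 1 Gen_qi $$ (0, 0) = complex_of_real (exp (- (t / 2)))" "rep_gen t 1 Gen_qi $$ (0, 1) = 0"
    "rep_gen t 1 Gen_qi $$ (1, 0) = 0" "rep_gen t 1 Gen_qi $$ (1, 1) = complex_of_real (exp (t / 2))"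
    "rep_gen t 1 Gen_e $$ (0, 0) = 0" "rep_gen t 1 Gen_e $$ (0, 1) = 1"
    "rep_gen t 1 Gen_e $$ (1, 0) = 0" "rep_gen t 1 Gen_e $$ (1, 1) = 0"
    "rep_gen t 1 Gen_f $$ (0, 0) = 0" "rep_gen t 1 Gen_f $$ (0, 1) = 0"
    "rep_gen t 1 Gen_f $$ (1, 0) = 1" "rep_gen t 1 Gen_f $$ (1, 1) = 0"
  using assms by (simp_all add: rep_gen_index wt_def rcoef_eq)

definition urho2 :: "real \<Rightarrow> nat \<Rightarrow> (ugen list \<Rightarrow>\<^sub>0 complex) \<Rightarrow> complex mat"
  where "urho2 t N = (\<lambda>x. utens t N 1 (ucop x))"

lemma alg_map_urho2: "alg_map (mat_alg (Suc N * 2)) (urho2 t N)"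
  using alg_map_comp[OF alg_map_ucop alg_map_utens[of N 1]] by (simp add: numeral_2_eq_2 urho2_def)

lemma urho2_letter:
  "urho2 t N (letter Gen_q) = kron (rep_gen t N Gen_q) (rep_gen t 1 Gen_q)"
  "urho2 t N (letter Gen_qi) = kron (rep_gen t N Gen_qi) (rep_gen t 1 Gen_qi)"
  "urho2 t N (letter Gen_e) = kron (rep_gen t N Gen_q) (rep_gen t 1 Gen_e) + kron (rep_gen t N Gen_e) (rep_gen t 1 Gen_qi)"
  "urho2 t N (letter Gen_f) = kron (rep_gen t N Gen_q) (rep_gen t 1 Gen_f) + kron (rep_gen t N Gen_f) (rep_gen t 1 Gen_qi)"
  using alg_map.map_add[OF alg_map_utens[of N 1 t]]
  by (simp_all only: urho2_def ucop_letter ucoprod_gen.simps utens_free_tensor urho_letter mat_alg_simps)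


lemma urho2_mult_index:
  assumes t: "t > 0" and X: "X \<in> carrier_mat (Suc N * 2) m" and ij: "i < Suc N" "j < m"
  shows "(urho2 t N (letter Gen_q) * X) $$ (i * 2, j) =
      complex_of_real (exp (t / 2)) * (complex_of_real (exp (t * wt N i)) * X $$ (i * 2, j))"
    and "(urho2 t N (letter Gen_q) * X) $$ (Suc (i * 2), j) =
      complex_of_real (exp (- (t / 2))) * (complex_of_real (exp (t * wt N i)) * X $$ (Suc (i * 2), j))"
    and "(urho2 t N (letter Gen_qi) * X) $$ (i * 2, j) =
      complex_of_real (exp (- (t / 2))) * (complex_of_real (exp (- (t * wt N i))) * X $$ (i * 2, j))"
    and "(urho2 t N (letter Gen_qi) * X) $$ (Suc (i * 2), j) =
      complex_of_real (exp (t / 2)) * (complex_of_real (exp (- (t * wt N i))) * X $$ (Suc (i * 2), j))"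
    and "(urho2 t N (letter Gen_e) * X) $$ (i * 2, j) =
      complex_of_real (exp (t * wt N i)) * X $$ (Suc (i * 2), j) + complex_of_real (exp (- (t / 2))) *
        (if Suc i \<le> N then complex_of_real (rcoef t N (Suc i)) * X $$ (Suc i * 2, j) else 0)"
    and "(urho2 t N (letter Gen_e) * X) $$ (Suc (i * 2), j) = complex_of_real (exp (t / 2)) *
        (if Suc i \<le> N then complex_of_real (rcoef t N (Suc i)) * X $$ (Suc (Suc i * 2), j) else 0)"
    and "(urho2 t N (letter Gen_f) * X) $$ (i * 2, j) = complex_of_real (exp (- (t / 2))) *
        (if i = 0 then 0 else complex_of_real (rcoef t N i) * X $$ ((i - 1) * 2, j))"
    and "(urho2 t N (letter Gen_f) * X) $$ (Suc (i * 2), j) =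
      complex_of_real (exp (t * wt N i)) * X $$ (i * 2, j) + complex_of_real (exp (t / 2)) *
        (if i = 0 then 0 else complex_of_real (rcoef t N i) * X $$ (Suc ((i - 1) * 2), j))"
proof -
  have S: "slice X (Suc N) b \<in> carrier_mat (Suc N) m" for b using X by (auto simp: slice_def)
  have Sx: "slice X (Suc N) 0 $$ (a, j) = X $$ (a * 2, j)" "slice X (Suc N) 1 $$ (a, j) = X $$ (Suc (a * 2), j)"
    if "a < Suc N" for a
    using that X ij by (auto simp: slice_def)
  have B: "rep_gen t 1 g \<in> carrier_mat 2 2" for g
    using rep_gen_carrier[of t 1 g] by (simp add: numeral_2_eq_2)
  have K: "kron (rep_gen t N g) (rep_gen t 1 g') \<in> carrier_mat (Suc N * 2) (Suc N * 2)" for g g'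
    by (intro kron_carrier rep_gen_carrier B)
  have k: "(kron (rep_gen t N g) (rep_gen t 1 g') * X) $$ (i * 2, j) =
      rep_gen t 1 g' $$ (0, 0) * (rep_gen t N g * slice X (Suc N) 0) $$ (i, j) +
      rep_gen t 1 g' $$ (0, 1) * (rep_gen t N g * slice X (Suc N) 1) $$ (i, j)"
    "(kron (rep_gen t N g) (rep_gen t 1 g') * X) $$ (Suc (i * 2), j) =
      rep_gen t 1 g' $$ (1, 0) * (rep_gen t N g * slice X (Suc N) 0) $$ (i, j) +
      rep_gen t 1 g' $$ (1, 1) * (rep_gen t N g * slice X (Suc N) 1) $$ (i, j)" for g g'
    using kron_mult_slice[OF rep_gen_carrier B X ij(1) _ ij(2), of 0] kron_mult_slice[OF rep_gen_carrier B X ij(1) _ ij(2), of 1]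
    by simp_all
  have idx: "i * 2 < Suc N * 2" "Suc (i * 2) < Suc N * 2" using ij by auto
  have plus: "((kron (rep_gen t N g) (rep_gen t 1 g') + kron (rep_gen t N h) (rep_gen t 1 h')) * X) $$ (r, j) =
     (kron (rep_gen t N g) (rep_gen t 1 g') * X) $$ (r, j) + (kron (rep_gen t N h) (rep_gen t 1 h') * X) $$ (r, j)"
    if "r < Suc N * 2" for r g g' h h'
    unfolding add_mult_distrib_mat[OF K K X]
    by (rule index_add_mat(1)) (use that ij X K[of h h'] in \<open>simp_all only: index_mult_mat carrier_matD\<close>)
  note m = rep_gen_mult_left[OF S ij]
  note simps = urho2_letter plus[OF idx(1)] plus[OF idx(2)] k m rep_gen_1[OF t] Sx[OF ij(1)]
    mult_zero_left mult_1 add_0_left add_0_right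
  show "(urho2 t N (letter Gen_q) * X) $$ (i * 2, j) =
      complex_of_real (exp (t / 2)) * (complex_of_real (exp (t * wt N i)) * X $$ (i * 2, j))"
    "(urho2 t N (letter Gen_q) * X) $$ (Suc (i * 2), j) =
      complex_of_real (exp (- (t / 2))) * (complex_of_real (exp (t * wt N i)) * X $$ (Suc (i * 2), j))"
    "(urho2 t N (letter Gen_qi) * X) $$ (i * 2, j) =
      complex_of_real (exp (- (t / 2))) * (complex_of_real (exp (- (t * wt N i))) * X $$ (i * 2, j))"
    "(urho2 t N (letter Gen_qi) * X) $$ (Suc (i * 2), j) =
      complex_of_real (exp (t / 2)) * (complex_of_real (exp (- (t * wt N i))) * X $$ (Suc (i * 2), j))"
    by (simp_all only: simps)
  have up: "(if Suc i \<le> N then complex_of_real (rcoef t N (Suc i)) * slice X (Suc N) b $$ (Suc i, j) else 0) =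
      (if Suc i \<le> N then complex_of_real (rcoef t N (Suc i)) * X $$ (Suc i * 2 + b, j) else 0)" if "b < 2" for b
    using that X ij by (auto simp: slice_def)
  have dn: "(if i = 0 then 0 else complex_of_real (rcoef t N i) * slice X (Suc N) b $$ (i - 1, j)) =
      (if i = 0 then 0 else complex_of_real (rcoef t N i) * X $$ ((i - 1) * 2 + b, j))" if "b < 2" for b
    using that X ij by (auto simp: slice_def)

  show "(urho2 t N (letter Gen_e) * X) $$ (i * 2, j) =
      complex_of_real (exp (t * wt N i)) * X $$ (Suc (i * 2), j) + complex_of_real (exp (- (t / 2))) *
        (if Suc i \<le> N then complex_of_real (rcoef t N (Suc i)) * X $$ (Suc i * 2, j) else 0)"
    "(urho2 t N (letter Gen_e) * X) $$ (Suc (i * 2), j) = complex_of_real (exp (t / 2)) *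
        (if Suc i \<le> N then complex_of_real (rcoef t N (Suc i)) * X $$ (Suc (Suc i * 2), j) else 0)"
    "(urho2 t N (letter Gen_f) * X) $$ (i * 2, j) = complex_of_real (exp (- (t / 2))) *
        (if i = 0 then 0 else complex_of_real (rcoef t N i) * X $$ ((i - 1) * 2, j))"
    "(urho2 t N (letter Gen_f) * X) $$ (Suc (i * 2), j) =
      complex_of_real (exp (t * wt N i)) * X $$ (i * 2, j) + complex_of_real (exp (t / 2)) *
        (if i = 0 then 0 else complex_of_real (rcoef t N i) * X $$ (Suc ((i - 1) * 2), j))"
    using up[of 0] up[of 1] dn[of 0] dn[of 1] by (simp_all only: simps) simp_all
qed

lemma eq_two_rowsI:
  assumes "X \<in> carrier_mat (n * 2) m" "Y \<in> carrier_mat (n * 2) m"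
    and "\<And>i j. i < n \<Longrightarrow> j < m \<Longrightarrow> X $$ (i * 2, j) = Y $$ (i * 2, j)"
    and "\<And>i j. i < n \<Longrightarrow> j < m \<Longrightarrow> X $$ (Suc (i * 2), j) = Y $$ (Suc (i * 2), j)"
  shows "X = Y"
proof (rule eq_matI)
  fix r j assume "r < dim_row Y" "j < dim_col Y"
  then have r: "r < n * 2" and j: "j < m" using assms by auto
  from r obtain i k where "r = i * 2 + k" "i < n" "k < 2" by (rule pair_indexE)
  then show "X $$ (r, j) = Y $$ (r, j)"
    using assms(3,4) j by (cases k) (auto simp: less_Suc_eq numeral_2_eq_2)
qed (use assms in auto)

lemma urho2_carrier: "urho2 t N x \<in> carrier_mat (Suc N * 2) (Suc N * 2)"
  using alg_map.closed[OF alg_map_urho2] by simp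

lemma cgV_intertwine:
  assumes t: "t > 0"
  shows "cgV t N * urho t (Suc N) x = urho2 t N x * cgV t N"
proof (rule intertwine[OF alg_map_urho alg_map_urho2 cgV_carrier])
  fix g
  note V = cgV_carrier[of t N]
  note L = rep_gen_mult_right[OF V]
  note R = urho2_mult_index[OF t V]
  have idx: "i < Suc N \<Longrightarrow> i * 2 < Suc N * 2" "i < Suc N \<Longrightarrow> Suc (i * 2) < Suc N * 2" for i by auto
  note [simp del] = index_mult_mat(1) mult_Suc mult_Suc_right
  note cg = cg_e0[OF t] cg_e1[OF t] cg_f0[OF t] cg_f1[OF t]
  note cg' = cg[THEN arg_cong[where f = complex_of_real]]
  \<comment> \<open>Weights add: \<open>\<xi>\<^sub>i \<otimes> \<eta>\<^sub>0\<close> and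
    \<open>\<xi>\<^sub>i \<otimes> \<eta>\<^sub>1\<close> have weight \<open>wt N i\<close> plus or
    minus 1/2, the weights of columns i and Suc i in spin (N + 1)/2.\<close>
  have q: "exp (t * wt (Suc N) i) = exp (t / 2) * exp (t * wt N i)"
    "exp (t * wt (Suc N) (Suc i)) = exp (- (t / 2)) * exp (t * wt N i)"
    "exp (- (t * wt (Suc N) i)) = exp (- (t / 2)) * exp (- (t * wt N i))"
    "exp (- (t * wt (Suc N) (Suc i))) = exp (t / 2) * exp (- (t * wt N i))" for i
    unfolding mult_exp_exp by (rule arg_cong[where f = exp], simp add: wt_def field_simps)+
  show "cgV t N * urho t (Suc N) (letter g) = urho2 t N (letter g) * cgV t N"
    unfolding urho_letter
  proof (rule eq_two_rowsI[of _ "Suc N" "Suc (Suc N)"])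
    fix i j assume ij: "i < Suc N" "j < Suc (Suc N)"
    show "(cgV t N * rep_gen t (Suc N) g) $$ (i * 2, j) = (urho2 t N (letter g) * cgV t N) $$ (i * 2, j)"
    proof (cases g)
      \<comment> \<open>In the last column the second term of the relation drops out, as
        \<open>cgc\<close> vanishes at Suc N; the row that it would come from does not
        exist.\<close>
      case Gen_e
      then show ?thesis
        using ij cg'(1)[of i N]
        by (cases "j = Suc N") (auto simp: L[OF idx(1)] R cgV_index)
    next
      case Gen_f
      then show ?thesis
        using ij cg'(3)[of i N] by (auto simp: L[OF idx(1)] R cgV_index)
    next
      case Gen_q
      then show ?thesis
        using ij by (auto simp: L[OF idx(1)] R cgV_index q(1,3))
    next
      case Gen_qi
      then show ?thesis
        using ij by (auto simp: L[OF idx(1)] R cgV_index q(1,3))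
    qed
    show "(cgV t N * rep_gen t (Suc N) g) $$ (Suc (i * 2), j) = (urho2 t N (letter g) * cgV t N) $$ (Suc (i * 2), j)"
    proof (cases g)
      case Gen_e
      then show ?thesis
        using ij cg'(2)[of i N]
        by (auto simp: L[OF idx(2)] R cgV_index)
    next
      case Gen_f
      then show ?thesis
        using ij cg'(4)[of i N] by (auto simp: L[OF idx(2)] R cgV_index)
    next
      case Gen_q
      then show ?thesis
        using ij by (auto simp: L[OF idx(2)] R cgV_index q(2,4))
    next
      case Gen_qi
      then show ?thesis
        using ij by (auto simp: L[OF idx(2)] R cgV_index q(2,4))
    qed
  qed (use V urho2_carrier in \<open>auto intro!: mult_carrier_mat\<close>)
qed


text \<open>The first spin is (M + 1)/2, hence positive: only then is there a lower component, and
  its spin is M/2.\<close>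

lemma cgV'_intertwine:
  assumes t: "t > 0"
  shows "cgV' t (Suc M) * urho t M x = urho2 t (Suc M) x * cgV' t (Suc M)"
proof (rule intertwine[OF alg_map_urho alg_map_urho2 cgV'_carrier])
  fix g
  let ?N = "Suc M"
  note V = cgV'_carrier[of t ?N]
  note L = rep_gen_mult_right[OF V]
  note R = urho2_mult_index[OF t V]
  have idx: "i < Suc ?N \<Longrightarrow> i * 2 < Suc ?N * 2" "i < Suc ?N \<Longrightarrow> Suc (i * 2) < Suc ?N * 2" for i by auto
  note [simp del] = index_mult_mat(1) mult_Suc mult_Suc_right
  note cg' = cg_e0'[OF t, of _ ?N, THEN arg_cong[where f = complex_of_real]]
    cg_e1'[OF t, of _ ?N, THEN arg_cong[where f = complex_of_real]]
    cg_f0'[OF t, of _ ?N, THEN arg_cong[where f = complex_of_real]]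
    cg_f1'[OF t, of _ ?N, THEN arg_cong[where f = complex_of_real]]
  have q: "exp (t * wt M i) = exp (t / 2) * exp (t * wt ?N (Suc i))"
    "exp (t * wt M i) = exp (- (t / 2)) * exp (t * wt ?N i)"
    "exp (- (t * wt M i)) = exp (- (t / 2)) * exp (- (t * wt ?N (Suc i)))"
    "exp (- (t * wt M i)) = exp (t / 2) * exp (- (t * wt ?N i))" for i
    unfolding mult_exp_exp by (rule arg_cong[where f = exp], simp add: wt_def field_simps)+
  show "cgV' t ?N * urho t M (letter g) = urho2 t ?N (letter g) * cgV' t ?N"
    unfolding urho_letter
  proof (rule eq_two_rowsI[of _ "Suc ?N" ?N])
    fix i j assume ij: "i < Suc ?N" "j < ?N"
    show "(cgV' t ?N * rep_gen t M g) $$ (i * 2, j) = (urho2 t ?N (letter g) * cgV' t ?N) $$ (i * 2, j)"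
    proof (cases g)
      case Gen_e
      then show ?thesis
        using ij cg'(1)[of i] t
        by (cases "j = 0") (auto simp: L[OF idx(1)] R cgV'_index)
    next
      case Gen_f
      then show ?thesis
        using ij cg'(3)[of i] by (auto simp: L[OF idx(1)] R cgV'_index)
    next
      case Gen_q
      then show ?thesis
        using ij by (auto simp: L[OF idx(1)] R cgV'_index q(1))
    next
      case Gen_qi
      then show ?thesis
        using ij by (auto simp: L[OF idx(1)] R cgV'_index q(3))
    qed
    show "(cgV' t ?N * rep_gen t M g) $$ (Suc (i * 2), j) = (urho2 t ?N (letter g) * cgV' t ?N) $$ (Suc (i * 2), j)"
    proof (cases g)
      case Gen_e
      then show ?thesis
        using ij cg'(2)[of i] by (auto simp: L[OF idx(2)] R cgV'_index)
    next
      case Gen_f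
      then show ?thesis
        using ij cg'(4)[of i] by (cases "j = M") (auto simp: L[OF idx(2)] R cgV'_index)
    next
      case Gen_q
      then show ?thesis
        using ij by (auto simp: L[OF idx(2)] R cgV'_index q(2))
    next
      case Gen_qi
      then show ?thesis
        using ij by (auto simp: L[OF idx(2)] R cgV'_index q(4))
    qed
  qed (use V urho2_carrier in \<open>auto intro!: mult_carrier_mat\<close>)
qed

lemma mult_two_cols_index:
  fixes Y V :: "complex mat"
  assumes "Y \<in> carrier_mat m (n * 2)" "V \<in> carrier_mat (n * 2) l" "r < m" "p < l"
  shows "(Y * V) $$ (r, p) = (\<Sum>a<n. V $$ (a * 2, p) * Y $$ (r, a * 2)) +
    (\<Sum>a<n. V $$ (Suc (a * 2), p) * Y $$ (r, Suc (a * 2)))"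
proof -
  have "(\<Sum>b<2. f b) = f 0 + f (Suc 0)" for f :: "nat \<Rightarrow> complex"
    by (simp add: numeral_2_eq_2)
  then show ?thesis
    unfolding mult_mat_index[OF assms] sum_lessThan_mult
    by (simp add: sum.distrib) (simp add: mult.commute)
qed

lemma mult_cgV_index:
  assumes Y: "Y \<in> carrier_mat m (Suc N * 2)" and r: "r < m" and p: "p < Suc (Suc N)"
  shows "(Y * cgV t N) $$ (r, p) = (if p \<le> N then complex_of_real (cgc t N p) * Y $$ (r, p * 2) else 0) +
    (if p > 0 then complex_of_real (cgd t N p) * Y $$ (r, Suc ((p - 1) * 2)) else 0)"
proof -
  have "(\<Sum>a<Suc N. cgV t N $$ (a * 2, p) * Y $$ (r, a * 2)) =
      (\<Sum>a<Suc N. (if a = p then complex_of_real (cgc t N p) else 0) * Y $$ (r, a * 2))"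
    by (rule sum.cong) (use p in \<open>auto simp: cgV_index\<close>)
  moreover have "(\<Sum>a<Suc N. cgV t N $$ (Suc (a * 2), p) * Y $$ (r, Suc (a * 2))) =
      (\<Sum>a<Suc N. (if a = p - 1 then if p > 0 then complex_of_real (cgd t N p) else 0 else 0) * Y $$ (r, Suc (a * 2)))"
    by (rule sum.cong) (use p in \<open>auto simp: cgV_index\<close>)
  ultimately show ?thesis
    using p unfolding mult_two_cols_index[OF Y cgV_carrier r p] sum_delta_times by auto
qed

lemma mult_cgV'_index:
  assumes Y: "Y \<in> carrier_mat m (Suc N * 2)" and r: "r < m" and p: "p < N"
  shows "(Y * cgV' t N) $$ (r, p) =
    complex_of_real (cgc t N (Suc p)) * Y $$ (r, Suc (p * 2)) - complex_of_real (cgd t N (Suc p)) * Y $$ (r, Suc p * 2)"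
proof -
  have "(\<Sum>a<Suc N. cgV' t N $$ (a * 2, p) * Y $$ (r, a * 2)) =
      (\<Sum>a<Suc N. (if a = Suc p then - complex_of_real (cgd t N (Suc p)) else 0) * Y $$ (r, a * 2))"
    by (rule sum.cong) (use p in \<open>auto simp: cgV'_index\<close>)
  moreover have "(\<Sum>a<Suc N. cgV' t N $$ (Suc (a * 2), p) * Y $$ (r, Suc (a * 2))) =
      (\<Sum>a<Suc N. (if a = p then complex_of_real (cgc t N (Suc p)) else 0) * Y $$ (r, Suc (a * 2)))"
    by (rule sum.cong) (use p in \<open>auto simp: cgV'_index\<close>)
  ultimately show ?thesis
    using p unfolding mult_two_cols_index[OF Y cgV'_carrier r p] sum_delta_times by auto
qed

text \<open>The vectors with 1 <= p <= N come in pairs, one from each component, supported on the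
  same two coordinates; the matrix of such a pair has determinant c^2 + d^2 > 0. The first and last
  vectors of the upper component are nonzero multiples of basis vectors and settle the two remaining
  coordinates.\<close>

lemma cg_complete:
  assumes t: "t > 0" and Y: "Y \<in> carrier_mat m (Suc N * 2)"
    and V: "Y * cgV t N = 0\<^sub>m m (Suc (Suc N))" and V': "Y * cgV' t N = 0\<^sub>m m N"
  shows "Y = 0\<^sub>m m (Suc N * 2)"
proof -
  let ?c = "\<lambda>p. complex_of_real (cgc t N p)" and ?d = "\<lambda>p. complex_of_real (cgd t N p)"
  have inner: "Y $$ (r, Suc p * 2) = 0 \<and> Y $$ (r, Suc (p * 2)) = 0" if r: "r < m" and p: "p < N" for r p
  proof -
    have e1: "?c (Suc p) * Y $$ (r, Suc p * 2) + ?d (Suc p) * Y $$ (r, Suc (p * 2)) = 0"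
      using mult_cgV_index[OF Y r, of "Suc p" t] p r by (simp add: V)
    have e2: "?c (Suc p) * Y $$ (r, Suc (p * 2)) - ?d (Suc p) * Y $$ (r, Suc p * 2) = 0"
      using mult_cgV'_index[OF Y r p, of t] p r by (simp add: V')
    have solve: "x = 0 \<and> y = 0" if "c * x + d * y = 0" "c * y - d * x = 0" "c > 0" "d > 0"
      for x y :: complex and c d :: real
    proof -
      have "(c * c + d * d) * x = c * (c * x + d * y) - d * (c * y - d * x)"
        "(c * c + d * d) * y = d * (c * x + d * y) + c * (c * y - d * x)"
        by (simp_all add: algebra_simps)
      moreover have "c * c + d * d > 0"
        using that(3,4) by (intro add_pos_pos mult_pos_pos)
      then have "complex_of_real c * complex_of_real c + complex_of_real d * complex_of_real d \<noteq> 0"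
        unfolding of_real_mult[symmetric] of_real_add[symmetric] of_real_eq_0_iff by (rule less_imp_neq[symmetric])
      ultimately show ?thesis unfolding that(1,2) by simp
    qed
    show ?thesis
      by (rule solve[OF e1 e2]) (use p in \<open>simp_all add: cgc_pos[OF t] cgd_pos[OF t]\<close>)
  qed
  have first: "Y $$ (r, 0) = 0" if "r < m" for r
    using mult_cgV_index[OF Y that, of 0 t] that cgc_pos[OF t, of 0 N] by (simp add: V)
  have last: "Y $$ (r, Suc (N * 2)) = 0" if "r < m" for r
    using mult_cgV_index[OF Y that, of "Suc N" t] that cgd_pos[OF t, of "Suc N" N] by (simp add: V)
  show ?thesis
  proof (rule eq_matI)
    fix r s assume "r < dim_row (0\<^sub>m m (Suc N * 2) :: complex mat)" "s < dim_col (0\<^sub>m m (Suc N * 2) :: complex mat)"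
    then have r: "r < m" and s: "s < Suc N * 2" by simp_all
    from s obtain a b where "s = a * 2 + b" "a < Suc N" "b < 2" by (rule pair_indexE)
    then consider "s = a * 2" "a = 0" | p where "s = Suc p * 2" "p < N" | "s = Suc (N * 2)" | "s = Suc (a * 2)" "a < N"
      by (cases b; cases a; cases "a = N") auto
    then have "Y $$ (r, s) = 0"
    proof cases
      case 1 then show ?thesis using first[OF r] by simp
    next
      case 2 then show ?thesis using inner[OF r] by blast
    next
      case 3 then show ?thesis using last[OF r] by blast
    next
      case 4 then show ?thesis using inner[OF r] by blast
    qed
    then show "Y $$ (r, s) = 0\<^sub>m m (Suc N * 2) $$ (r, s)" using r s by simp
  qed (use Y in auto)
qed

text \<open>By the intertwining relations, \<open>urho2 t N x\<close> annihilates the columns of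
  both intertwiners, so \<open>cg_complete\<close> applies. This is the independence of the preimage
  on which \<open>Acoprod\<close> rests.\<close>

lemma urho2_kernel:
  assumes t: "t > 0" and 1: "urho t (Suc N) x = 0\<^sub>m (Suc (Suc N)) (Suc (Suc N))"
    and 2: "\<And>M. N = Suc M \<Longrightarrow> urho t M x = 0\<^sub>m (Suc M) (Suc M)"
  shows "urho2 t N x = 0\<^sub>m (Suc N * 2) (Suc N * 2)"
proof (rule cg_complete[OF t urho2_carrier])
  show "urho2 t N x * cgV t N = 0\<^sub>m (Suc N * 2) (Suc (Suc N))"
    using cgV_intertwine[OF t, of N x] right_mult_zero_mat[OF cgV_carrier] by (simp only: 1)
  show "urho2 t N x * cgV' t N = 0\<^sub>m (Suc N * 2) N"
  proof (cases N)
    case 0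
    show ?thesis
      by (rule eq_matI) (use 0 urho2_carrier[of t N x] cgV'_carrier[of t N] in auto)
  next
    case (Suc M)
    show ?thesis
      using cgV'_intertwine[OF t, of M x] right_mult_zero_mat[OF cgV'_carrier[of t "Suc M"]] 2[OF Suc] Suc by simp
  qed
qed

section \<open>Joint surjectivity of the representations\<close>

lemma urho_dim [simp]: "dim_row (urho t N x) = Suc N" "dim_col (urho t N x) = Suc N"
  by (rule carrier_matD[OF urho_carrier])+

lemma mat_unit_simps [simp]:
  "mat_unit n i j \<in> carrier_mat n n" "dim_row (mat_unit n i j) = n" "dim_col (mat_unit n i j) = n"
  "p < n \<Longrightarrow> r < n \<Longrightarrow> mat_unit n i j $$ (p, r) = (if p = i \<and> r = j then 1 else 0)"
  by (simp_all add: mat_unit_def)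

text \<open>
  For \<open>m = 2 N\<close> the roots are the values of \<open>q\<close> at all half-integral weights from \<open>-N/2\<close> up to, but excluding,
  \<open>N/2\<close>; so among the spins up to \<open>N/2\<close> only the highest weight vector of the largest one survives.
\<close>

primrec qpoly :: "real \<Rightarrow> nat \<Rightarrow> nat \<Rightarrow> (ugen list \<Rightarrow>\<^sub>0 complex)" where
  "qpoly t N 0 = 1"
| "qpoly t N (Suc s) = qpoly t N s * (letter Gen_q - scalar (complex_of_real (exp (t * (real N - real (Suc s)) / 2))))"

lemma urho_diff: "urho t N (x - y) = urho t N x - urho t N y"
  using alg_map.map_diff[OF alg_map_urho] mat_alg_minus[OF urho_carrier urho_carrier] by simp

lemma urho_qpoly_index:
  assumes "i < Suc k" "j < Suc k"
  shows "urho t k (qpoly t N m) $$ (i, j) = (if i = j then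
    \<Prod>s<m. complex_of_real (exp (t * wt k i)) - complex_of_real (exp (t * (real N - real (Suc s)) / 2)) else 0)"
proof (induction m)
  case 0
  then show ?case using assms by (simp add: urho_simps)
next
  case (Suc m)
  define c where "c = complex_of_real (exp (t * (real N - real (Suc m)) / 2))"
  have "urho t k (qpoly t N (Suc m)) =
      urho t k (qpoly t N m) * rep_gen t k Gen_q - urho t k (qpoly t N m) * (c \<cdot>\<^sub>m 1\<^sub>m (Suc k))"
    unfolding qpoly.simps c_def[symmetric] urho_simps(2) urho_diff urho_letter urho_simps(6)
    by (rule mult_minus_distrib_mat[of _ "Suc k" "Suc k" _ "Suc k"]) auto
  also have "urho t k (qpoly t N m) * (c \<cdot>\<^sub>m 1\<^sub>m (Suc k)) = c \<cdot>\<^sub>m urho t k (qpoly t N m)"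
    by (subst mult_smult_distrib[of _ "Suc k" "Suc k" _ "Suc k"]) (auto simp: right_mult_one_mat[OF urho_carrier])
  finally have "urho t k (qpoly t N (Suc m)) $$ (i, j) =
      (urho t k (qpoly t N m) * rep_gen t k Gen_q) $$ (i, j) - c * urho t k (qpoly t N m) $$ (i, j)"
    using assms by (simp del: qpoly.simps index_mult_mat(1))
  then show ?case
    unfolding rep_gen_mult_right(1)[OF urho_carrier assms] Suc prod.lessThan_Suc c_def[symmetric]
    by (simp add: left_diff_distrib mult.commute del: qpoly.simps)
qed

lemma urho_qpoly_low:
  assumes "k < N"
  shows "urho t k (qpoly t N (2 * N)) = 0\<^sub>m (Suc k) (Suc k)"
proof (rule eq_matI)
  fix i j assume "i < dim_row (0\<^sub>m (Suc k) (Suc k) :: complex mat)" "j < dim_col (0\<^sub>m (Suc k) (Suc k) :: complex mat)"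
  then have ij: "i < Suc k" "j < Suc k" by simp_all
  \<comment> \<open>The root of index s is the value of q at weight (N - Suc s)/2. It equals the
    weight k/2 - i when Suc s = N - k + 2 i, which lies between 1 and 2 N because i <= k <
    N.\<close>
  define s where "s = N - k + 2 * i - 1"
  have s: "s < 2 * N" "real (Suc s) = real N - real k + 2 * real i"
    using assms ij by (auto simp: s_def of_nat_diff)
  have "t * wt k i = t * (real N - real (Suc s)) / 2"
    unfolding s wt_def by (simp add: algebra_simps)
  then have "(\<Prod>s<2 * N. complex_of_real (exp (t * wt k i)) - complex_of_real (exp (t * (real N - real (Suc s)) / 2))) = 0"
    using s(1) by (intro prod_zero finite_lessThan bexI[of _ s]) (simp_all del: of_nat_Suc)
  then show "urho t k (qpoly t N (2 * N)) $$ (i, j) = 0\<^sub>m (Suc k) (Suc k) $$ (i, j)"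
    by (simp only: urho_qpoly_index[OF ij] index_zero_mat(1)[OF ij] if_cancel)
qed simp_all

lemma urho_qpoly_top:
  assumes "t > 0"
  obtains c where "c \<noteq> 0" "urho t N (qpoly t N (2 * N)) = c \<cdot>\<^sub>m mat_unit (Suc N) 0 0"
proof -
  define c where "c = (\<Prod>s<2 * N. complex_of_real (exp (t * wt N 0)) - complex_of_real (exp (t * (real N - real (Suc s)) / 2)))"
  have "t * wt N 0 \<noteq> t * (real N - real (Suc s)) / 2" for s
    using assms by (simp add: wt_def)
  then have "c \<noteq> 0"
    by (simp add: c_def del: of_nat_Suc)
  moreover have "urho t N (qpoly t N (2 * N)) = c \<cdot>\<^sub>m mat_unit (Suc N) 0 0"
  proof (rule eq_matI)
    fix i j assume "i < dim_row (c \<cdot>\<^sub>m mat_unit (Suc N) 0 0)" "j < dim_col (c \<cdot>\<^sub>m mat_unit (Suc N) 0 0)"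
    then have ij: "i < Suc N" "j < Suc N" by simp_all
    \<comment> \<open>In spin N/2 the weight N/2 - i is met by the root of index 2 i - 1, which
      exists for 1 <= i <= N; so only the top diagonal entry survives.\<close>
    have zero: "(\<Prod>s<2 * N. complex_of_real (exp (t * wt N i)) - complex_of_real (exp (t * (real N - real (Suc s)) / 2))) = 0"
      if "i > 0"
    proof -
      have "wt N i = (real N - real (Suc (2 * i - 1))) / 2"
        using that by (simp add: wt_def of_nat_diff field_simps)
      then show ?thesis
        using that ij by (intro prod_zero finite_lessThan bexI[of _ "2 * i - 1"]) (auto simp del: of_nat_Suc)
    qed
    have "(\<Prod>s<2 * N. complex_of_real (exp (t * wt N i)) - complex_of_real (exp (t * (real N - real (Suc s)) / 2))) =
        (if i = 0 then c else 0)"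
    proof (cases "i = 0")
      case True
      show ?thesis unfolding if_P[OF True] unfolding True c_def ..
    next
      case False
      then show ?thesis unfolding if_not_P[OF False] by (intro zero) simp
    qed
    then show "urho t N (qpoly t N (2 * N)) $$ (i, j) = (c \<cdot>\<^sub>m mat_unit (Suc N) 0 0) $$ (i, j)"
      unfolding urho_qpoly_index[OF ij] using ij by (simp only:) auto
  qed simp_all
  ultimately show ?thesis by (rule that)
qed

text \<open>The image under spin N/2 of the common kernel of all smaller spins. It is stable under
  the generators on either side, so one matrix unit in it produces all others.\<close>

definition in_top_image :: "real \<Rightarrow> nat \<Rightarrow> complex mat \<Rightarrow> bool"
  where "in_top_image t N a \<longleftrightarrow> (\<exists>x. urho t N x = a \<and> (\<forall>k<N. urho t k x = 0\<^sub>m (Suc k) (Suc k)))"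

lemma in_top_image_smult: "in_top_image t N a \<Longrightarrow> in_top_image t N (c \<cdot>\<^sub>m a)"
proof -
  assume "in_top_image t N a"
  then obtain x where x: "urho t N x = a" "\<forall>k<N. urho t k x = 0\<^sub>m (Suc k) (Suc k)" by (auto simp: in_top_image_def)
  then show "in_top_image t N (c \<cdot>\<^sub>m a)"
    unfolding in_top_image_def by (intro exI[of _ "scalar c * x"]) (auto simp: urho_simps(4))
qed

lemma in_top_image_add: "in_top_image t N a \<Longrightarrow> in_top_image t N b \<Longrightarrow> in_top_image t N (a + b)"
proof -
  assume "in_top_image t N a" "in_top_image t N b"
  then obtain x y where "urho t N x = a" "\<forall>k<N. urho t k x = 0\<^sub>m (Suc k) (Suc k)"
    "urho t N y = b" "\<forall>k<N. urho t k y = 0\<^sub>m (Suc k) (Suc k)" by (auto simp: in_top_image_def)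
  then show "in_top_image t N (a + b)"
    unfolding in_top_image_def by (intro exI[of _ "x + y"]) (auto simp: urho_simps)
qed

lemma in_top_image_mult:
  assumes "in_top_image t N a"
  shows "in_top_image t N (rep_gen t N g * a)" "in_top_image t N (a * rep_gen t N g)"
proof -
  obtain x where x: "urho t N x = a" "\<forall>k<N. urho t k x = 0\<^sub>m (Suc k) (Suc k)"
    using assms by (auto simp: in_top_image_def)
  show "in_top_image t N (rep_gen t N g * a)"
    unfolding in_top_image_def using x
    by (intro exI[of _ "letter g * x"]) (auto simp: urho_simps urho_letter right_mult_zero_mat[OF rep_gen_carrier])
  show "in_top_image t N (a * rep_gen t N g)"
    unfolding in_top_image_def using x
    by (intro exI[of _ "x * letter g"]) (auto simp: urho_simps urho_letter left_mult_zero_mat[OF rep_gen_carrier])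
qed

lemma in_top_image_cancel: "in_top_image t N (c \<cdot>\<^sub>m a) \<Longrightarrow> c \<noteq> 0 \<Longrightarrow> in_top_image t N a"
proof -
  assume "in_top_image t N (c \<cdot>\<^sub>m a)" "c \<noteq> 0"
  moreover from this have "inverse c \<cdot>\<^sub>m (c \<cdot>\<^sub>m a) = a" by (intro eq_matI) auto
  ultimately show "in_top_image t N a" using in_top_image_smult[of t N "c \<cdot>\<^sub>m a" "inverse c"] by simp
qed

text \<open>From the unit at (0, 0), left multiplication by f moves down the first column and right
  multiplication by e moves along a row. The factors picked up are values of \<open>rcoef\<close> at
  1, ..., N, hence nonzero: this is the irreducibility of the representation.\<close>

lemma in_top_image_mat_unit:
  assumes t: "t > 0" and ij: "i \<le> N" "j \<le> N"
  shows "in_top_image t N (mat_unit (Suc N) i j)"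
proof -
  have 0: "in_top_image t N (mat_unit (Suc N) 0 0)"
  proof -
    obtain c where "c \<noteq> 0" "urho t N (qpoly t N (2 * N)) = c \<cdot>\<^sub>m mat_unit (Suc N) 0 0"
      using urho_qpoly_top[OF t] .
    then show ?thesis
      by - (rule in_top_image_cancel[of t N c], auto simp: in_top_image_def urho_qpoly_low intro!: exI[of _ "qpoly t N (2 * N)"])
  qed
  have 1: "in_top_image t N (mat_unit (Suc N) i 0)" if "i \<le> N" for i
    using that
  proof (induction i)
    case (Suc i)
    have "rep_gen t N Gen_f * mat_unit (Suc N) i 0 = complex_of_real (rcoef t N (Suc i)) \<cdot>\<^sub>m mat_unit (Suc N) (Suc i) 0"
      by (rule eq_matI)
        (use Suc.prems in \<open>auto simp: rep_gen_mult_left[OF mat_unit_simps(1)] simp del: index_mult_mat(1)\<close>)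
    then show ?case
      using in_top_image_mult(1)[of t N "mat_unit (Suc N) i 0" Gen_f] Suc rcoef_pos[OF t, of "Suc i" N]
      by - (rule in_top_image_cancel[of t N "complex_of_real (rcoef t N (Suc i))"], auto)
  qed (rule 0)
  show ?thesis
    using ij(2)
  proof (induction j)
    case (Suc j)
    have "mat_unit (Suc N) i j * rep_gen t N Gen_e = complex_of_real (rcoef t N (Suc j)) \<cdot>\<^sub>m mat_unit (Suc N) i (Suc j)"
      by (rule eq_matI)
        (use Suc.prems in \<open>auto simp: rep_gen_mult_right[OF mat_unit_simps(1)] simp del: index_mult_mat(1)\<close>)
    then show ?case
      using in_top_image_mult(2)[of t N "mat_unit (Suc N) i j" Gen_e] Suc rcoef_pos[OF t, of "Suc j" N]
      by - (rule in_top_image_cancel[of t N "complex_of_real (rcoef t N (Suc j))"], auto)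
  qed (rule 1[OF ij(1)])
qed

lemma in_top_image_all:
  assumes t: "t > 0" and a: "a \<in> carrier_mat (Suc N) (Suc N)"
  shows "in_top_image t N a"
proof -
  have Z: "in_top_image t N (0\<^sub>m (Suc N) (Suc N))"
    unfolding in_top_image_def by (rule exI[of _ 0]) (simp add: urho_simps)
  have *: "in_top_image t N (mat (Suc N) (Suc N) (\<lambda>p. if p \<in> S then a $$ p else 0))"
    if "finite S" "S \<subseteq> {..N} \<times> {..N}" for S
    using that
  proof (induction S rule: finite_induct)
    case empty
    have "mat (Suc N) (Suc N) (\<lambda>p. if p \<in> {} then a $$ p else 0) = 0\<^sub>m (Suc N) (Suc N)"
      by (rule eq_matI) auto
    then show ?case using Z by simp
  next
    case (insert p S)
    obtain i j where p: "p = (i, j)" by (cases p)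
    have "mat (Suc N) (Suc N) (\<lambda>q. if q \<in> insert p S then a $$ q else 0) =
        a $$ (i, j) \<cdot>\<^sub>m mat_unit (Suc N) i j + mat (Suc N) (Suc N) (\<lambda>q. if q \<in> S then a $$ q else 0)"
      by (rule eq_matI) (use insert p in auto)
    then show ?case
      using insert p by (simp add: in_top_image_add in_top_image_smult in_top_image_mat_unit[OF t])
  qed
  have "mat (Suc N) (Suc N) (\<lambda>p. if p \<in> {..N} \<times> {..N} then a $$ p else 0) = a"
    by (rule eq_matI) (use a in auto)
  then show ?thesis using *[of "{..N} \<times> {..N}"] by simp
qed

text \<open>Induction on the largest spin: its value is corrected by an element that all smaller
  spins annihilate, so their values stay untouched.\<close>

lemma joint_surjective:
  assumes t: "t > 0" and a: "\<And>k. a k \<in> carrier_mat (Suc k) (Suc k)"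
  shows "\<exists>x. \<forall>k\<le>N. urho t k x = a k"
proof (induction N)
  case 0
  then show ?case using in_top_image_all[OF t a, of 0] by (auto simp: in_top_image_def)
next
  case (Suc N)
  then obtain x where x: "\<forall>k\<le>N. urho t k x = a k" by blast
  have "a (Suc N) - urho t (Suc N) x \<in> carrier_mat (Suc (Suc N)) (Suc (Suc N))"
    by (rule minus_carrier_mat) simp
  then obtain y where y: "urho t (Suc N) y = a (Suc N) - urho t (Suc N) x" "\<forall>k<Suc N. urho t k y = 0\<^sub>m (Suc k) (Suc k)"
    using in_top_image_all[OF t, of "a (Suc N) - urho t (Suc N) x" "Suc N"] by (auto simp: in_top_image_def)
  have "urho t (Suc N) x + (a (Suc N) - urho t (Suc N) x) = a (Suc N)"
    by (rule eq_matI) (use a[of "Suc N"] in auto)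
  then have "\<forall>k\<le>Suc N. urho t k (x + y) = a k"
    using x y a by (auto simp: urho_simps le_Suc_eq right_add_zero_mat)
  then show ?case by blast
qed

text \<open>Evaluates the \<open>THE\<close> in \<open>Acoprod\<close> for second spin 1/2: a
  preimage exists by \<open>joint_surjective\<close>, and two preimages differ by an element to
  which \<open>urho2_kernel\<close> applies. The intertwining relation then passes from x to
  a.\<close>

lemma Acoprod_cgV:
  assumes t: "t > 0" and a: "a \<in> Acarrier"
  shows "Acoprod t a N 1 \<in> carrier_mat (Suc N * 2) (Suc N * 2)"
    and "cgV t N * a (Suc N) = Acoprod t a N 1 * cgV t N"
proof -
  have ac: "a k \<in> carrier_mat (Suc k) (Suc k)" for k
    using a by (simp add: Acarrier_def)
  obtain x where x: "\<forall>k\<le>Suc N. urho t k x = a k"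
    using joint_surjective[OF t ac] by blast
  \<comment> \<open>\<open>Iset N 1\<close> consists of N + 1 and, for N > 0, of N - 1: the
    components covered by the two intertwiners.\<close>
  have I: "Suc N \<in> Iset N 1" "N = Suc M \<Longrightarrow> M \<in> Iset N 1" "k \<in> Iset N 1 \<Longrightarrow> k \<le> Suc N" for M k
    by (auto simp: Iset_def)
  have rt: "rep_tensor t N 1 (Ucoprod t (uproj t y)) = urho2 t N y" for y
    by (simp only: Ucoprod_uproj rep_tensor_tproj[OF t] urho2_def)
  have "Acoprod t a N 1 = urho2 t N x"
    unfolding Acoprod_def
  proof (rule the_equality)
    show "\<exists>z\<in>carrier (Ualg t). (\<forall>k\<in>Iset N 1. rep t k z = a k) \<and> urho2 t N x = rep_tensor t N 1 (Ucoprod t z)"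
      using x I(3) by (auto intro!: bexI[of _ "uproj t x"] simp: rep_uproj[OF t] rt[unfolded One_nat_def] Ualg_carrier)
    fix Y assume "\<exists>z\<in>carrier (Ualg t). (\<forall>k\<in>Iset N 1. rep t k z = a k) \<and> Y = rep_tensor t N 1 (Ucoprod t z)"
    then obtain y where y: "\<And>k. k \<in> Iset N 1 \<Longrightarrow> urho t k y = a k" and Y: "Y = urho2 t N y"
      by (auto simp: Ualg_carrier rep_uproj[OF t] rt[unfolded One_nat_def])
    have d: "urho t k (y - x) = 0\<^sub>m (Suc k) (Suc k)" if "k \<in> Iset N 1" for k
    proof -
      have "urho t k y = urho t k x" using that y x I(3) by simp
      then show ?thesis using minus_r_inv_mat[OF urho_carrier] by (simp add: urho_diff)
    qed
    interpret U: alg_map "mat_alg (Suc N * 2)" "urho2 t N" by (rule alg_map_urho2)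
    have "urho2 t N (y - x) = \<zero>\<^bsub>mat_alg (Suc N * 2)\<^esub>"
      using urho2_kernel[OF t d[OF I(1)] d[OF I(2)]] by simp
    then show "Y = urho2 t N x"
      by (simp only: Y U.map_diff U.diff_eq_zero_iff[OF U.closed U.closed])
  qed
  then show "Acoprod t a N 1 \<in> carrier_mat (Suc N * 2) (Suc N * 2)"
    "cgV t N * a (Suc N) = Acoprod t a N 1 * cgV t N"
    using urho2_carrier[of t N x] cgV_intertwine[OF t, of N x] x by simp_all
qed

section \<open>The antipode and the dual\<close>

text \<open>
  \<open>\<pi>\<^sub>k \<circ> S\<close> is the transpose of \<open>\<pi>\<^sub>k\<close>, conjugated by an antidiagonal matrix.
\<close>

definition antirep :: "real \<Rightarrow> nat \<Rightarrow> complex mat \<Rightarrow> complex mat"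
  where "antirep t k X = mat (Suc k) (Suc k) (\<lambda>(i, j). (- lc t) ^ i / (- lc t) ^ j * X $$ (k - j, k - i))"

lemma antirep_carrier [simp]: "antirep t k X \<in> carrier_mat (Suc k) (Suc k)"
  by (simp add: antirep_def)

text \<open>The diagonal factors are quotients and cancel at the summation index; transposition
  reverses the product, and reversing the basis only reorders the sum.\<close>

lemma antirep_mult:
  assumes X: "X \<in> carrier_mat (Suc k) (Suc k)" and Y: "Y \<in> carrier_mat (Suc k) (Suc k)"
  shows "antirep t k (X * Y) = antirep t k Y * antirep t k X"
proof (rule eq_matI)
  fix i j assume "i < dim_row (antirep t k Y * antirep t k X)" "j < dim_col (antirep t k Y * antirep t k X)"
  then have ij: "i < Suc k" "j < Suc k" by (simp_all add: antirep_def)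
  have "(antirep t k Y * antirep t k X) $$ (i, j) =
      (\<Sum>l<Suc k. (- lc t) ^ i / (- lc t) ^ j * (X $$ (k - j, k - l) * Y $$ (k - l, k - i)))"
    unfolding mult_mat_index[OF antirep_carrier antirep_carrier ij]
    by (intro sum.cong refl) (use ij in \<open>simp add: antirep_def\<close>)
  also have "\<dots> = (- lc t) ^ i / (- lc t) ^ j * (\<Sum>l<Suc k. X $$ (k - j, k - l) * Y $$ (k - l, k - i))"
    by (rule sum_distrib_left[symmetric])
  also have "(\<Sum>l<Suc k. X $$ (k - j, k - l) * Y $$ (k - l, k - i)) =
      (\<Sum>l<Suc k. X $$ (k - j, l) * Y $$ (l, k - i))"
    by (rule sum.reindex_bij_witness[of _ "\<lambda>l. k - l" "\<lambda>l. k - l"]) auto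
  also have "\<dots> = (X * Y) $$ (k - j, k - i)"
    by (rule mult_mat_index[OF X Y, symmetric]) simp_all
  finally show "antirep t k (X * Y) $$ (i, j) = (antirep t k Y * antirep t k X) $$ (i, j)"
    using ij by (simp add: antirep_def del: index_mult_mat(1))
qed (simp_all add: antirep_def)

text \<open>Origin of the base -\<lambda>: for e the nonzero entries have j = i + 1, so the factor
  is the inverse of -\<lambda>; for f they have i = j + 1, so it is -\<lambda>. Reversing the basis
  negates weights, which inverts q, and \<open>rcoef_sym\<close> matches the remaining
  coefficients.\<close>

lemma antirep_rep_gen:
  assumes t: "t > 0"
  shows "antirep t k (rep_gen t k g) = urho t k (uantipode_gen t g)"
proof (rule eq_matI)
  fix i j assume "i < dim_row (urho t k (uantipode_gen t g))" "j < dim_col (urho t k (uantipode_gen t g))"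
  then have ij: "i < Suc k" "j < Suc k" by simp_all
  have u: "urho t k (- (scalar c * letter g)) = (- c) \<cdot>\<^sub>m rep_gen t k g" for c g
    using urho_simps(4)[of k t "- c" "letter g"] by (simp add: scalar_uminus urho_letter)
  have w: "i < Suc k \<Longrightarrow> wt k (k - i) = - wt k i" for i
    by (simp add: wt_def of_nat_diff)
  have r: "i < k \<Longrightarrow> rcoef t k (k - i) = rcoef t k (Suc i)" for i
    by (rule rcoef_sym[OF t]) simp
  show "antirep t k (rep_gen t k g) $$ (i, j) = urho t k (uantipode_gen t g) $$ (i, j)"
  proof (cases g)
    case Gen_e
    show ?thesis
    proof (cases "j = Suc i")
      case True
      have "Suc (k - j) = k - i" using True ij by simp
      then show ?thesis
        using Gen_e ij True r[of i]
        by (simp add: antirep_def u rep_gen_index divide_inverse mult.commute del: diff_Suc_Suc)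
    next
      case False
      have "k - i \<noteq> Suc (k - j)" using False ij by linarith
      then show ?thesis
        using Gen_e ij False by (simp add: antirep_def u rep_gen_index)
    qed
  next
    case Gen_f
    show ?thesis
    proof (cases "i = Suc j")
      case True
      have "k - j = Suc (k - i)" using True ij by simp
      then show ?thesis
        using Gen_f ij True r[of j] by (simp add: antirep_def u rep_gen_index del: diff_Suc_Suc)
    next
      case False
      have "k - j \<noteq> Suc (k - i)" using False ij by linarith
      then show ?thesis
        using Gen_f ij False by (simp add: antirep_def u rep_gen_index)
    qed
  next
    case Gen_q
    have "k - j = k - i \<longleftrightarrow> i = j" using ij by auto
    then show ?thesis
      using Gen_q ij w[of i] by (auto simp: antirep_def urho_letter rep_gen_index)
  next
    case Gen_qi
    have "k - j = k - i \<longleftrightarrow> i = j" using ij by auto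
    then show ?thesis
      using Gen_qi ij w[of i] by (auto simp: antirep_def urho_letter rep_gen_index)
  qed
qed (simp_all add: antirep_def)

lemma urho_uant:
  assumes t: "t > 0"
  shows "urho t k (uant t x) = antirep t k (urho t k x)"
proof (induction x rule: free_alg_induct)
  case (scalar c)
  show ?case
    unfolding uant_simps urho_simps
    by (rule eq_matI) (auto simp: antirep_def)
next
  case (letter g x)
  show ?case
    unfolding uant_simps urho_simps letter urho_letter
    by (simp only: antirep_mult[OF rep_gen_carrier urho_carrier] antirep_rep_gen[OF t])
next
  case (add x y)
  then show ?case
    unfolding uant_simps urho_simps by (intro eq_matI) (auto simp: antirep_def distrib_left)
qed

text \<open>Independence of the preimage is immediate here: by \<open>urho_uant\<close> the value
  depends on x only through its image under spin k/2.\<close>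

lemma Aantipode_eq:
  assumes t: "t > 0" and b: "b \<in> Acarrier"
  shows "Aantipode t b k = antirep t k (b k)"
proof -
  obtain x where x: "urho t k x = b k"
    using joint_surjective[OF t, of b k] b by (auto simp: Acarrier_def)
  have e: "rep t k (Uantipode t (uproj t y)) = antirep t k (urho t k y)" for y
    by (simp only: Uantipode_uproj rep_uproj[OF t] urho_uant[OF t])
  show ?thesis
    unfolding Aantipode_def
  proof (rule the_equality)
    show "\<exists>y\<in>carrier (Ualg t). rep t k y = b k \<and> antirep t k (b k) = rep t k (Uantipode t y)"
      using x by (auto intro!: bexI[of _ "uproj t x"] simp: rep_uproj[OF t] e Ualg_carrier)
    show "Y = antirep t k (b k)"
      if "\<exists>y\<in>carrier (Ualg t). rep t k y = b k \<and> Y = rep t k (Uantipode t y)" for Y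
      using that by (auto simp: rep_uproj[OF t] e Ualg_carrier)
  qed
qed

lemma mat_adjoint_carrier: "A \<in> carrier_mat n n \<Longrightarrow> mat_adjoint A \<in> carrier_mat n n"
  for A :: "complex mat"
  by (auto simp: mat_adjoint_def)

lemma mat_adjoint_index:
  "A \<in> carrier_mat n n \<Longrightarrow> i < n \<Longrightarrow> j < n \<Longrightarrow> mat_adjoint A $$ (i, j) = cnj (A $$ (j, i))"
  for A :: "complex mat"
  by (auto simp: mat_adjoint_def mat_of_rows_index)

lemma AcarrierD: "a \<in> Acarrier \<Longrightarrow> a k \<in> carrier_mat (Suc k) (Suc k)"
  by (simp add: Acarrier_def)

lemma Acarrier_map:
  assumes "a \<in> Acarrier" "\<And>k. f k (a k) \<in> carrier_mat (Suc k) (Suc k)"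
    "\<And>k. f k (0\<^sub>m (Suc k) (Suc k)) = 0\<^sub>m (Suc k) (Suc k)"
  shows "(\<lambda>k. f k (a k)) \<in> Acarrier"
proof -
  have "{k. f k (a k) \<noteq> 0\<^sub>m (k + 1) (k + 1)} \<subseteq> {k. a k \<noteq> 0\<^sub>m (k + 1) (k + 1)}"
    using assms(3) by auto
  moreover have "finite {k. a k \<noteq> 0\<^sub>m (k + 1) (k + 1)}"
    using assms(1) by (simp add: Acarrier_def)
  ultimately have "finite {k. f k (a k) \<noteq> 0\<^sub>m (k + 1) (k + 1)}"
    by (rule finite_subset)
  then show ?thesis
    using assms(2) by (simp add: Acarrier_def)
qed

lemma Aadj_closed: "a \<in> Acarrier \<Longrightarrow> Aadj a \<in> Acarrier"
proof -
  assume a: "a \<in> Acarrier"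
  have "mat_adjoint (0\<^sub>m (Suc k) (Suc k)) = (0\<^sub>m (Suc k) (Suc k) :: complex mat)" for k
    using mat_adjoint_carrier[OF zero_carrier_mat[of "Suc k" "Suc k"]]
    by (intro eq_matI) (auto simp: mat_adjoint_index[of _ "Suc k"])
  then show ?thesis
    unfolding Aadj_def using a AcarrierD[OF a]
    by (intro Acarrier_map[of a "\<lambda>_. mat_adjoint"]) (auto intro: mat_adjoint_carrier)
qed

lemma Aantipode_closed:
  assumes t: "t > 0" and a: "a \<in> Acarrier"
  shows "Aantipode t a \<in> Acarrier"
proof -
  have "antirep t k (0\<^sub>m (Suc k) (Suc k)) = 0\<^sub>m (Suc k) (Suc k)" for k
    by (rule eq_matI) (auto simp: antirep_def)
  then have "(\<lambda>k. antirep t k (a k)) \<in> Acarrier"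
    using a by (intro Acarrier_map[of a "antirep t"]) auto
  moreover have "Aantipode t a = (\<lambda>k. antirep t k (a k))"
    by (rule ext) (rule Aantipode_eq[OF t a])
  ultimately show ?thesis by simp
qed

section \<open>Matrix coefficients as elements of the dual\<close>

definition coef :: "nat \<Rightarrow> nat \<Rightarrow> nat \<Rightarrow> (nat \<Rightarrow> complex mat) \<Rightarrow> complex"
  where "coef N i j = (\<lambda>a\<in>Acarrier. a N $$ (i, j))"

lemma umat_eq_coef: "umat i j = coef 1 (i - 1) (j - 1)"
  by (simp add: umat_def coef_def)

lemma Bdual_simps [simp]:
  "carrier (Bdual t) = Bcarrier"
  "b \<otimes>\<^bsub>Bdual t\<^esub> b' = (\<lambda>a\<in>Acarrier. pair_tensor (Acoprod t a) b' b)"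
  "\<one>\<^bsub>Bdual t\<^esub> = (\<lambda>a\<in>Acarrier. Acounit a)"
  "b \<oplus>\<^bsub>Bdual t\<^esub> b' = (\<lambda>a\<in>Acarrier. b a + b' a)"
  "c \<odot>\<^bsub>Bdual t\<^esub> b = (\<lambda>a\<in>Acarrier. c * b a)"
  "adj (Bdual t) b = (\<lambda>a\<in>Acarrier. cnj (b (Aantipode t (Aadj a))))"
  by (simp_all add: Bdual_def)

text \<open>The factor -\<lambda> is the one in \<open>antirep\<close> at (1, 0). With \<nu> the
  inverse of \<lambda>, the second equation says that u12 is -\<nu> times the adjoint of u21, in
  accordance with the unitary matrix that defines P.\<close>

lemma adj_umat:
  assumes t: "t > 0"
  shows "adj (Bdual t) (umat 1 1) = umat 2 2"
    and "adj (Bdual t) (umat 2 1) = (\<lambda>a\<in>Acarrier. - lc t * umat 1 2 a)"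
proof -
  have "Aantipode t (Aadj a) \<in> Acarrier" if "a \<in> Acarrier" for a
    by (intro Aantipode_closed Aadj_closed t that)
  moreover have "Aantipode t (Aadj a) 1 $$ (0, 0) = cnj (a 1 $$ (1, 1))"
    "Aantipode t (Aadj a) 1 $$ (1, 0) = - lc t * cnj (a 1 $$ (0, 1))" if "a \<in> Acarrier" for a
    unfolding Aantipode_eq[OF t Aadj_closed[OF that]]
    using AcarrierD[OF that, of 1] mat_adjoint_index[of "a 1" "Suc 1"]
    by (simp_all add: antirep_def Aadj_def)
  ultimately show "adj (Bdual t) (umat 1 1) = umat 2 2"
    "adj (Bdual t) (umat 2 1) = (\<lambda>a\<in>Acarrier. - lc t * umat 1 2 a)"
    by (auto simp: umat_def fun_eq_iff restrict_def)
qed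

lemma Aemb_closed: "X \<in> carrier_mat (Suc k) (Suc k) \<Longrightarrow> Aemb k X \<in> Acarrier"
proof -
  assume "X \<in> carrier_mat (Suc k) (Suc k)"
  moreover have "{l. Aemb k X l \<noteq> 0\<^sub>m (l + 1) (l + 1)} \<subseteq> {k}"
    by (auto simp: Aemb_def)
  then have "finite {l. Aemb k X l \<noteq> 0\<^sub>m (l + 1) (l + 1)}"
    by (rule finite_subset) simp
  ultimately show ?thesis by (auto simp: Acarrier_def Aemb_def)
qed

lemma coef_Aemb:
  assumes "X \<in> carrier_mat (Suc k) (Suc k)" "i \<le> N" "j \<le> N"
  shows "coef N i j (Aemb k X) = (if k = N then X $$ (i, j) else 0)"
  using assms Aemb_closed[OF assms(1)] by (auto simp: coef_def Aemb_def)

lemma dual_supp_coef: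
  assumes "i \<le> N" "j \<le> N"
  shows "dual_supp (coef N i j) = {N}"
proof -
  have "\<exists>X\<in>carrier_mat (Suc N) (Suc N). X $$ (i, j) \<noteq> (0 :: complex)"
    using assms by (intro bexI[of _ "mat_unit (Suc N) i j"]) auto
  then show ?thesis
    using coef_Aemb[OF _ assms] by (auto simp: dual_supp_def split: if_splits)
qed

lemma sum_delta_pair:
  "(\<Sum>i'\<le>N. \<Sum>j'\<le>N. (if i = i' \<and> j = j' then 1 else 0) * g i' j') = (if i \<le> N \<and> j \<le> N then g i j else (0 :: complex))"
  for N :: nat
proof -
  have 1: "(\<Sum>j'\<le>N. (if j = j' then 1 else 0) * f j') = (if j \<le> N then f j else (0 :: complex))" for j f
  proof -
    have "(\<Sum>j'\<le>N. (if j = j' then 1 else 0) * f j') = (\<Sum>j'\<le>N. if j = j' then f j' else 0)"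
      by (intro sum.cong refl) auto
    then show ?thesis by simp
  qed
  have "(\<Sum>i'\<le>N. \<Sum>j'\<le>N. (if i = i' \<and> j = j' then 1 else 0) * g i' j') =
      (\<Sum>i'\<le>N. (if i = i' then 1 else 0) * (\<Sum>j'\<le>N. (if j = j' then 1 else 0) * g i' j'))"
    unfolding sum_distrib_left by (intro sum.cong refl) auto
  then show ?thesis unfolding 1 by simp
qed

text \<open>The left factor reads off the second tensor leg, because the product of the dual pairs
  with the legs in reverse order. Each coefficient lives on one block, so the sums in
  \<open>pair_tensor\<close> collapse to a single entry.\<close>

lemma coef_mult:
  assumes "i \<le> N" "j \<le> N" "k \<le> M" "l \<le> M"
  shows "coef M k l \<otimes>\<^bsub>Bdual t\<^esub> coef N i j =
    (\<lambda>a\<in>Acarrier. Acoprod t a N M $$ (i * (M + 1) + k, j * (M + 1) + l))"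
proof -
  have "pair_tensor Y (coef N i j) (coef M k l) = Y N M $$ (i * (M + 1) + k, j * (M + 1) + l)" for Y
  proof -
    let ?Y = "\<lambda>i j k l. Y N M $$ (i * (M + 1) + k, j * (M + 1) + l)"
    have "pair_tensor Y (coef N i j) (coef M k l) =
        (\<Sum>i'\<le>N. \<Sum>j'\<le>N. (if i = i' \<and> j = j' then 1 else 0) *
          (\<Sum>k'\<le>M. \<Sum>l'\<le>M. (if k = k' \<and> l = l' then 1 else 0) * ?Y i' j' k' l'))"
      using assms by (simp add: pair_tensor_def dual_supp_coef coef_Aemb sum_distrib_left mult_ac)
    then show ?thesis using assms by (simp only: sum_delta_pair simp_thms if_True)
  qed
  then show ?thesis by simp
qed

section \<open>Matrix coefficients generate the dual\<close>

lemma Bcarrier_add: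
  "b \<in> Bcarrier \<Longrightarrow> x \<in> Acarrier \<Longrightarrow> y \<in> Acarrier \<Longrightarrow> b (\<lambda>k. x k + y k) = b x + b y"
  by (simp add: Bcarrier_def)

lemma Bcarrier_smult:
  "b \<in> Bcarrier \<Longrightarrow> x \<in> Acarrier \<Longrightarrow> b (\<lambda>k. c \<cdot>\<^sub>m x k) = c * b x"
  by (simp add: Bcarrier_def)

lemma Bcarrier_zero:
  assumes "b \<in> Bcarrier"
  shows "b (\<lambda>k. 0\<^sub>m (Suc k) (Suc k)) = 0"
proof -
  have "(\<lambda>k. 0\<^sub>m (Suc k) (Suc k)) \<in> Acarrier" by (simp add: Acarrier_def)
  then show ?thesis
    using Bcarrier_smult[OF assms, of "\<lambda>k. 0\<^sub>m (Suc k) (Suc k)" 0] by simp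
qed

lemma Bcarrier_Aemb:
  assumes b: "b \<in> Bcarrier" and X: "X \<in> carrier_mat (Suc k) (Suc k)"
  shows "b (Aemb k X) = (\<Sum>p\<in>{..k} \<times> {..k}. X $$ p * b (Aemb k (mat_unit (Suc k) (fst p) (snd p))))"
proof -
  let ?R = "\<lambda>S. mat (Suc k) (Suc k) (\<lambda>p. if p \<in> S then X $$ p else 0)"
  have *: "b (Aemb k (?R S)) = (\<Sum>p\<in>S. X $$ p * b (Aemb k (mat_unit (Suc k) (fst p) (snd p))))"
    if "finite S" "S \<subseteq> {..k} \<times> {..k}" for S
    using that
  proof (induction S rule: finite_induct)
    case empty
    have "Aemb k (?R {}) = (\<lambda>l. 0\<^sub>m (Suc l) (Suc l))"
      by (auto simp: Aemb_def fun_eq_iff intro!: eq_matI)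
    then show ?case using Bcarrier_zero[OF b] by simp
  next
    case (insert p S)
    let ?E = "mat_unit (Suc k) (fst p) (snd p)"
    have "Aemb k (?R (insert p S)) = (\<lambda>l. X $$ p \<cdot>\<^sub>m Aemb k ?E l + Aemb k (?R S) l)"
      by (rule ext, rule eq_matI) (use insert in \<open>auto simp: Aemb_def split: if_splits\<close>)
    moreover have "(\<lambda>l. X $$ p \<cdot>\<^sub>m Aemb k ?E l) = Aemb k (X $$ p \<cdot>\<^sub>m ?E)"
      by (auto simp: Aemb_def fun_eq_iff)
    then have "(\<lambda>l. X $$ p \<cdot>\<^sub>m Aemb k ?E l) \<in> Acarrier"
      by (simp add: Aemb_closed)
    ultimately have "b (Aemb k (?R (insert p S))) = X $$ p * b (Aemb k ?E) + b (Aemb k (?R S))"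
      by (simp add: Bcarrier_add[OF b] Bcarrier_smult[OF b] Aemb_closed)
    then show ?case using insert by simp
  qed
  have "?R ({..k} \<times> {..k}) = X" by (rule eq_matI) (use X in auto)
  then show ?thesis using *[of "{..k} \<times> {..k}"] by simp
qed

text \<open>The index set must not depend on a, so that b is one fixed linear combination of
  coefficients. Blocks outside \<open>dual_supp b\<close> contribute 0, and so do blocks where a
  vanishes; hence the support of a can be traded for that of b.\<close>

lemma Bcarrier_expand:
  assumes b: "b \<in> Bcarrier"
  shows "b = (\<lambda>a\<in>Acarrier. \<Sum>k\<in>dual_supp b. \<Sum>p\<in>{..k} \<times> {..k}.
    b (Aemb k (mat_unit (Suc k) (fst p) (snd p))) * coef k (fst p) (snd p) a)"
proof (rule extensionalityI[of _ Acarrier])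
  show "b \<in> extensional Acarrier" using b by (simp add: Bcarrier_def)
  fix a assume a: "a \<in> Acarrier"
  define K where "K = {k. a k \<noteq> 0\<^sub>m (k + 1) (k + 1)}"
  have K: "finite K" using a by (simp add: K_def Acarrier_def)
  have fin: "finite (dual_supp b)" using b by (simp add: Bcarrier_def)
  \<comment> \<open>Additivity of b concerns two summands, so a is assembled from its nonzero blocks
    one at a time.\<close>
  let ?R = "\<lambda>S k. if k \<in> S then a k else 0\<^sub>m (Suc k) (Suc k)"
  have *: "?R S \<in> Acarrier \<and> b (?R S) = (\<Sum>k\<in>S. b (Aemb k (a k)))" if "finite S" for S
    using that
  proof (induction S rule: finite_induct)
    case empty
    then show ?case using Bcarrier_zero[OF b] by (simp add: Acarrier_def)
  next
    case (insert k S)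
    have e: "?R (insert k S) = (\<lambda>l. Aemb k (a k) l + ?R S l)"
      using insert(2) AcarrierD[OF a] by (auto simp: fun_eq_iff Aemb_def)
    have "{l. ?R (insert k S) l \<noteq> 0\<^sub>m (l + 1) (l + 1)} \<subseteq> insert k S" by auto
    then have "finite {l. ?R (insert k S) l \<noteq> 0\<^sub>m (l + 1) (l + 1)}"
      by (rule finite_subset) (simp add: insert)
    then have "?R (insert k S) \<in> Acarrier"
      using AcarrierD[OF a] by (simp add: Acarrier_def)
    moreover have "b (?R (insert k S)) = b (Aemb k (a k)) + b (?R S)"
      unfolding e by (rule Bcarrier_add[OF b Aemb_closed[OF AcarrierD[OF a]]]) (use insert in simp)
    ultimately show ?case using insert by simp
  qed
  have "a = ?R K" by (auto simp: K_def)
  then have "b a = (\<Sum>k\<in>K. b (Aemb k (a k)))" using *[OF K] by simp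
  also have "\<dots> = (\<Sum>k\<in>K \<inter> dual_supp b. b (Aemb k (a k)))"
    by (rule sum.mono_neutral_right) (use K AcarrierD[OF a] in \<open>auto simp: dual_supp_def\<close>)
  also have "\<dots> = (\<Sum>k\<in>dual_supp b. b (Aemb k (a k)))"
  proof (rule sum.mono_neutral_left[OF fin])
    show "\<forall>k\<in>dual_supp b - K \<inter> dual_supp b. b (Aemb k (a k)) = 0"
    proof
      fix k assume "k \<in> dual_supp b - K \<inter> dual_supp b"
      then have "Aemb k (a k) = (\<lambda>l. 0\<^sub>m (Suc l) (Suc l))" by (auto simp: K_def Aemb_def)
      then show "b (Aemb k (a k)) = 0" by (simp add: Bcarrier_zero[OF b])
    qed
  qed simp
  also have "\<dots> = (\<Sum>k\<in>dual_supp b. \<Sum>p\<in>{..k} \<times> {..k}.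
    b (Aemb k (mat_unit (Suc k) (fst p) (snd p))) * coef k (fst p) (snd p) a)"
    using a by (intro sum.cong refl) (simp add: Bcarrier_Aemb[OF b AcarrierD[OF a]] coef_def mult.commute)
  finally show "b a = (\<lambda>a\<in>Acarrier. \<Sum>k\<in>dual_supp b. \<Sum>p\<in>{..k} \<times> {..k}.
    b (Aemb k (mat_unit (Suc k) (fst p) (snd p))) * coef k (fst p) (snd p) a) a"
    using a by simp
qed simp

text \<open>Single entries of V a = \<Delta>(a) V. The rows i * 2 of V isolate the rows 0, ..., N of
  a; the row Suc N is reached only through the row N * 2 + 1 of V, where the coefficient is
  \<open>cgd\<close>.\<close>

lemma cg_coef:
  assumes t: "t > 0" and a: "a \<in> Acarrier" and j: "j \<le> Suc N"
  shows "i \<le> N \<Longrightarrow> complex_of_real (cgc t N i) * a (Suc N) $$ (i, j) =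
      (if j \<le> N then complex_of_real (cgc t N j) * Acoprod t a N 1 $$ (i * 2, j * 2) else 0) +
      (if j > 0 then complex_of_real (cgd t N j) * Acoprod t a N 1 $$ (i * 2, (j - 1) * 2 + 1) else 0)"
    and "complex_of_real (cgd t N (Suc N)) * a (Suc N) $$ (Suc N, j) =
      (if j \<le> N then complex_of_real (cgc t N j) * Acoprod t a N 1 $$ (N * 2 + 1, j * 2) else 0) +
      (if j > 0 then complex_of_real (cgd t N j) * Acoprod t a N 1 $$ (N * 2 + 1, (j - 1) * 2 + 1) else 0)"
proof -
  note A = AcarrierD[OF a, of "Suc N"]
  have r: "(cgV t N * a (Suc N)) $$ (r, j) =
      (if j \<le> N then complex_of_real (cgc t N j) * Acoprod t a N 1 $$ (r, j * 2) else 0) +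
      (if j > 0 then complex_of_real (cgd t N j) * Acoprod t a N 1 $$ (r, (j - 1) * 2 + 1) else 0)"
    if "r < Suc N * 2" for r
    unfolding Acoprod_cgV(2)[OF t a] using mult_cgV_index[OF Acoprod_cgV(1)[OF t a] that, of j t] j by simp
  have l: "(cgV t N * a (Suc N)) $$ (r, j) = (if l < Suc (Suc N) then c * a (Suc N) $$ (l, j) else 0)"
    if "r < Suc N * 2" "\<And>s. s < Suc (Suc N) \<Longrightarrow> cgV t N $$ (r, s) = (if s = l then c else 0)" for r l c
  proof -
    have "(cgV t N * a (Suc N)) $$ (r, j) = (\<Sum>s<Suc (Suc N). (if s = l then c else 0) * a (Suc N) $$ (s, j))"
      unfolding mult_mat_index[OF cgV_carrier A that(1) le_imp_less_Suc[OF j]]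
      by (rule sum.cong) (simp_all add: that(2))
    then show ?thesis unfolding sum_delta_times .
  qed
  show "complex_of_real (cgc t N i) * a (Suc N) $$ (i, j) =
      (if j \<le> N then complex_of_real (cgc t N j) * Acoprod t a N 1 $$ (i * 2, j * 2) else 0) +
      (if j > 0 then complex_of_real (cgd t N j) * Acoprod t a N 1 $$ (i * 2, (j - 1) * 2 + 1) else 0)"
    if "i \<le> N"
  proof -
    have i: "i * 2 < Suc N * 2" using that by simp
    have "(cgV t N * a (Suc N)) $$ (i * 2, j) = complex_of_real (cgc t N i) * a (Suc N) $$ (i, j)"
      using l[OF i, of i "complex_of_real (cgc t N i)"] that by (simp add: cgV_index del: index_mult_mat(1))
    then show ?thesis using r[OF i] by simp
  qed
  show "complex_of_real (cgd t N (Suc N)) * a (Suc N) $$ (Suc N, j) =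
      (if j \<le> N then complex_of_real (cgc t N j) * Acoprod t a N 1 $$ (N * 2 + 1, j * 2) else 0) +
      (if j > 0 then complex_of_real (cgd t N j) * Acoprod t a N 1 $$ (N * 2 + 1, (j - 1) * 2 + 1) else 0)"
  proof -
    have i: "N * 2 + 1 < Suc N * 2" by simp
    have "(cgV t N * a (Suc N)) $$ (N * 2 + 1, j) = complex_of_real (cgd t N (Suc N)) * a (Suc N) $$ (Suc N, j)"
      using l[OF i, of "Suc N" "complex_of_real (cgd t N (Suc N))"] by (simp add: cgV_index del: index_mult_mat(1))
    then show ?thesis using r[OF i] by simp
  qed
qed

text \<open>Stands for the range of \<theta>. Adjoints serve only to supply the four coefficients of
  spin one half, which appear below as the assumption \<open>u\<close>.\<close>

locale dual_subalg =
  fixes t :: real and I :: "((nat \<Rightarrow> complex mat) \<Rightarrow> complex) set"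
  assumes t: "t > 0"
    and one: "\<one>\<^bsub>Bdual t\<^esub> \<in> I"
    and add: "b \<in> I \<Longrightarrow> b' \<in> I \<Longrightarrow> b \<oplus>\<^bsub>Bdual t\<^esub> b' \<in> I"
    and mult: "b \<in> I \<Longrightarrow> b' \<in> I \<Longrightarrow> b \<otimes>\<^bsub>Bdual t\<^esub> b' \<in> I"
    and smult: "b \<in> I \<Longrightarrow> c \<odot>\<^bsub>Bdual t\<^esub> b \<in> I"
begin

lemma sum_closed:
  assumes "finite S" "\<And>s. s \<in> S \<Longrightarrow> (\<lambda>a\<in>Acarrier. f s a) \<in> I"
  shows "(\<lambda>a\<in>Acarrier. \<Sum>s\<in>S. f s a) \<in> I"
  using assms
proof (induction S rule: finite_induct)
  \<comment> \<open>The zero functional is 0 times the unit.\<close>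
  case empty
  then show ?case using smult[OF one, of 0] by (simp add: restrict_def cong: if_cong)
next
  case (insert s S)
  have "(\<lambda>a\<in>Acarrier. f s a) \<oplus>\<^bsub>Bdual t\<^esub> (\<lambda>a\<in>Acarrier. \<Sum>s\<in>S. f s a) \<in> I"
    by (rule add) (use insert in \<open>blast+\<close>)
  moreover have "(\<lambda>a\<in>Acarrier. f s a) \<oplus>\<^bsub>Bdual t\<^esub> (\<lambda>a\<in>Acarrier. \<Sum>s\<in>S. f s a) =
      (\<lambda>a\<in>Acarrier. \<Sum>s\<in>insert s S. f s a)"
    using insert by (auto simp: fun_eq_iff)
  ultimately show ?case by (simp only:)
qed

text \<open>Solve \<open>cg_coef\<close> for the entry on the left: the divisors, \<open>cgc\<close>
  for i <= N and \<open>cgd\<close> at Suc N, are positive, and the right side combines at most two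
  products of a coefficient \<open>u\<close> with one covered by the induction hypothesis.\<close>

lemma coef_closed:
  assumes u: "\<And>i j. i \<le> 1 \<Longrightarrow> j \<le> 1 \<Longrightarrow> coef 1 i j \<in> I"
  shows "i \<le> N \<Longrightarrow> j \<le> N \<Longrightarrow> coef N i j \<in> I"
proof (induction N arbitrary: i j)
  \<comment> \<open>In spin 0 the only coefficient is the counit of \<open>A\<close>, which is the
    unit of the dual.\<close>
  case 0
  then have "coef 0 i j = \<one>\<^bsub>Bdual t\<^esub>" by (simp add: coef_def Acounit_def fun_eq_iff)
  then show ?case using one by (simp only:)
next
  case (Suc N)
  have prod: "(\<lambda>a\<in>Acarrier. Acoprod t a N 1 $$ (i * 2 + k, j * 2 + l)) \<in> I"
    if "i \<le> N" "j \<le> N" "k \<le> 1" "l \<le> 1" for i j k l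
    using mult[OF u[OF that(3,4)] Suc.IH[OF that(1,2)]] unfolding coef_mult[OF that] one_add_one .
  \<comment> \<open>One summand is absent when j = Suc N or j = 0; it is then the zero functional,
    obtained as an empty sum.\<close>
  have row: "(\<lambda>a\<in>Acarrier. d * (
      (if j \<le> N then complex_of_real (cgc t N j) * Acoprod t a N 1 $$ (i * 2 + k, j * 2) else 0) +
      (if j > 0 then complex_of_real (cgd t N j) * Acoprod t a N 1 $$ (i * 2 + k, (j - 1) * 2 + 1) else 0))) \<in> I"
    if i: "i \<le> N" and k: "k \<le> 1" for i k d
  proof -
    have 1: "(\<lambda>a\<in>Acarrier. if j \<le> N then complex_of_real (cgc t N j) * Acoprod t a N 1 $$ (i * 2 + k, j * 2) else 0) \<in> I"
    proof (cases "j \<le> N")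
      case True
      show ?thesis
        using smult[OF prod[OF i True k, of 0], of "complex_of_real (cgc t N j)"] True
        by (simp add: restrict_def cong: if_cong)
    next
      case False
      then show ?thesis using sum_closed[of "{}"] by simp
    qed
    have 2: "(\<lambda>a\<in>Acarrier. if j > 0 then complex_of_real (cgd t N j) * Acoprod t a N 1 $$ (i * 2 + k, (j - 1) * 2 + 1) else 0) \<in> I"
    proof (cases "j > 0")
      case True
      show ?thesis
        using smult[OF prod[OF i _ k, of "j - 1" 1], of "complex_of_real (cgd t N j)"] True Suc.prems
        by (simp add: restrict_def cong: if_cong)
    next
      case False
      then show ?thesis using sum_closed[of "{}"] by simp
    qed
    show ?thesis
      using smult[OF add[OF 1 2], of d] by (simp add: restrict_def cong: if_cong)
  qed
  show ?case
  proof (cases "i \<le> N")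
    case True
    have "coef (Suc N) i j = (\<lambda>a\<in>Acarrier. inverse (complex_of_real (cgc t N i)) * (
      (if j \<le> N then complex_of_real (cgc t N j) * Acoprod t a N 1 $$ (i * 2 + 0, j * 2) else 0) +
      (if j > 0 then complex_of_real (cgd t N j) * Acoprod t a N 1 $$ (i * 2 + 0, (j - 1) * 2 + 1) else 0)))"
      unfolding coef_def
    proof (rule restrict_ext)
      fix a assume "a \<in> Acarrier"
      then show "a (Suc N) $$ (i, j) = inverse (complex_of_real (cgc t N i)) * (
        (if j \<le> N then complex_of_real (cgc t N j) * Acoprod t a N 1 $$ (i * 2 + 0, j * 2) else 0) +
        (if j > 0 then complex_of_real (cgd t N j) * Acoprod t a N 1 $$ (i * 2 + 0, (j - 1) * 2 + 1) else 0))"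
        using cgc_pos[OF t True] by (simp only: add_0_right cg_coef(1)[OF t _ Suc.prems(2) True, symmetric]) simp
    qed
    then show ?thesis using row[OF True, of 0] by (simp only:)
  next
    case False
    then have i: "i = Suc N" using Suc.prems by simp
    have "coef (Suc N) i j = (\<lambda>a\<in>Acarrier. inverse (complex_of_real (cgd t N (Suc N))) * (
      (if j \<le> N then complex_of_real (cgc t N j) * Acoprod t a N 1 $$ (N * 2 + 1, j * 2) else 0) +
      (if j > 0 then complex_of_real (cgd t N j) * Acoprod t a N 1 $$ (N * 2 + 1, (j - 1) * 2 + 1) else 0)))"
      unfolding coef_def i
    proof (rule restrict_ext)
      fix a assume "a \<in> Acarrier"
      then show "a (Suc N) $$ (Suc N, j) = inverse (complex_of_real (cgd t N (Suc N))) * (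
        (if j \<le> N then complex_of_real (cgc t N j) * Acoprod t a N 1 $$ (N * 2 + 1, j * 2) else 0) +
        (if j > 0 then complex_of_real (cgd t N j) * Acoprod t a N 1 $$ (N * 2 + 1, (j - 1) * 2 + 1) else 0))"
        using cgd_pos[OF t, of "Suc N" N] by (simp only: cg_coef(2)[OF t _ Suc.prems(2), symmetric]) simp
    qed
    then show ?thesis using row[of N 1] by (simp only:)
  qed
qed

lemma contains_Bcarrier:
  assumes u: "\<And>i j. i \<le> 1 \<Longrightarrow> j \<le> 1 \<Longrightarrow> coef 1 i j \<in> I"
  shows "Bcarrier \<subseteq> I"
proof
  fix b assume b: "b \<in> Bcarrier"
  have "finite (dual_supp b)" using b by (simp add: Bcarrier_def)
  moreover have "(\<lambda>a\<in>Acarrier. c * coef k i j a) \<in> I" if "i \<le> k" "j \<le> k" for c k i j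
    using smult[OF coef_closed[OF u that]] by simp
  ultimately show "b \<in> I"
    by (subst Bcarrier_expand[OF b]) (intro sum_closed; auto)
qed

end

lemma pgen_star_star:
  "pgen_star (pgen_star g) = g"
  by (cases g) auto

theorem proposition5p6:
  fixes t :: real
    and \<theta> :: "(pgen list \<Rightarrow>\<^sub>0 complex) set \<Rightarrow> ((nat \<Rightarrow> complex mat) \<Rightarrow> complex)"
  assumes "t > 0"
    and "star_alg_hom (Palg (inverse (lam t))) (Bdual t) \<theta>"
    and "\<theta> (Pgen (inverse (lam t)) Gen_alpha) = umat 1 1"
    and "\<theta> (Pgen (inverse (lam t)) Gen_gamma) = umat 2 1"
  shows "\<theta> ` carrier (Palg (inverse (lam t))) = carrier (Bdual t)"
proof
  let ?P = "Palg (inverse (lam t))" and ?B = "Bdual t"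
  have hom: "\<theta> \<in> Ring.ring_hom ?P ?B"
    and sm: "\<And>c x. x \<in> carrier ?P \<Longrightarrow> \<theta> (c \<odot>\<^bsub>?P\<^esub> x) = c \<odot>\<^bsub>?B\<^esub> \<theta> x"
    and adj: "\<And>x. x \<in> carrier ?P \<Longrightarrow> \<theta> (adj ?P x) = adj ?B (\<theta> x)"
    using assms(2) by (auto simp: star_alg_hom_def)
  interpret J: alg_ideal "rel_ideal pgen_star (prels (inverse (lam t)))" "word_inv pgen_star"
    by (rule alg_ideal_rel_ideal)
  have P: "?P = J.Q" by (simp add: Palg_def presented_alg_def free_alg_def)
  \<comment> \<open>The involution of the quotient is a union of cosets; it is a single coset
    because the ideal is closed under adjoints.\<close>
  have adjP: "adj ?P (J.proj x) \<in> carrier ?P" for x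
    using J.adj_Q[of x] adj_free_alg(2)[of pgen_star] rel_ideal_adj[of pgen_star]
    by (simp add: P J.carrier_Q pgen_star_star free_alg_def)
  show "\<theta> ` carrier ?P \<subseteq> carrier ?B"
    using ring_hom_closed[OF hom] by blast
  interpret I: dual_subalg t "\<theta> ` carrier ?P"
  proof
    show "\<one>\<^bsub>?B\<^esub> \<in> \<theta> ` carrier ?P"
      using ring_hom_one[OF hom] J.quot.one_closed unfolding P by (metis image_eqI)
    show "b \<oplus>\<^bsub>?B\<^esub> b' \<in> \<theta> ` carrier ?P" if "b \<in> \<theta> ` carrier ?P" "b' \<in> \<theta> ` carrier ?P" for b b'
      using that ring_hom_add[OF hom] J.quot.add.m_closed unfolding P by (elim imageE) (metis image_eqI)
    show "b \<otimes>\<^bsub>?B\<^esub> b' \<in> \<theta> ` carrier ?P" if "b \<in> \<theta> ` carrier ?P" "b' \<in> \<theta> ` carrier ?P" for b b'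
      using that ring_hom_mult[OF hom] J.quot.m_closed unfolding P by (elim imageE) (metis image_eqI)
    show "c \<odot>\<^bsub>?B\<^esub> b \<in> \<theta> ` carrier ?P" if "b \<in> \<theta> ` carrier ?P" for b c
      using that sm J.quot.smult_closed unfolding P by (elim imageE) (metis image_eqI)
  qed (rule assms(1))
  have gen: "Pgen (inverse (lam t)) g = J.proj (letter g)" for g
    by (simp add: Pgen_def free_alg_def)
  have c: "J.proj x \<in> carrier ?P" for x by (simp add: P J.carrier_Q)
  have u: "umat 1 1 \<in> \<theta> ` carrier ?P" "umat 2 1 \<in> \<theta> ` carrier ?P"
    using assms(3,4) c unfolding gen by (metis image_eqI)+
  have "adj ?B (umat 1 1) \<in> \<theta> ` carrier ?P" "adj ?B (umat 2 1) \<in> \<theta> ` carrier ?P"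
    using adj[OF c] adjP assms(3,4) unfolding gen by (metis image_eqI)+
  then have u22: "umat 2 2 \<in> \<theta> ` carrier ?P" and a: "(\<lambda>a\<in>Acarrier. - lc t * umat 1 2 a) \<in> \<theta> ` carrier ?P"
    unfolding adj_umat[OF assms(1)] by blast+
  \<comment> \<open>The adjoint of u21 gives u12 only up to the nonzero factor -\<lambda>, which a
    scalar multiple removes.\<close>
  have "inverse (- lc t) \<odot>\<^bsub>?B\<^esub> (\<lambda>a\<in>Acarrier. - lc t * umat 1 2 a) = umat 1 2"
    by (auto simp: fun_eq_iff umat_def)
  then have u12: "umat 1 2 \<in> \<theta> ` carrier ?P"
    using I.smult[OF a, of "inverse (- lc t)"] by (simp only:)
  have "coef 1 i j \<in> \<theta> ` carrier ?P" if "i \<le> 1" "j \<le> 1" for i j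
  proof -
    have "coef 1 i j = umat (Suc i) (Suc j)" by (simp add: umat_eq_coef)
    moreover have "i = 0 \<or> i = 1" "j = 0 \<or> j = 1" using that by auto
    ultimately show ?thesis using u u12 u22 by (auto simp: numeral_2_eq_2)
  qed
  then show "carrier ?B \<subseteq> \<theta> ` carrier ?P"
    using I.contains_Bcarrier by simp
qed

end
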